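(* Let $m$ be even. The restriction map $\mathrm{Res}^{G_\infty}_{K_\infty}:E(G_\infty)\to E(K_\infty)$ is surjective, and the restriction map $\mathrm{Res}^{G'_\infty}_{K'_\infty}:E(G'_\infty;\chi^{\rm VII})\to E(K'_\infty;\chi^{\rm VII})$ is bijective. Multiplication by $f_0^{\rm VII}$ gives bijective maps $\mathcal M':E(K_\infty)\to E(K'_\infty;\chi^{\rm VII})$ and $\mathcal N':E(K'_\infty;\chi^{\rm VII})\to E(K_\infty)$, where $\mathcal M'(F)(g')=f_0^{\rm VII}(g')F(\Phi(g'))$ and $\mathcal N'(f)(\Phi(g'))=f_0^{\rm VII}(g')f(g')$ for $g'\in K'_\infty$; these are the maps induced, through the restriction maps $\mathrm{Res}^{G_\infty}_{K_\infty}$ and $\mathrm{Res}^{G'_\infty}_{K'_\infty}$, by multiplication by $f_0^{\rm VII}$ between $E(G_\infty)$ and $E(G'_\infty;\chi^{\rm VII})$.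
   Context: $m$ even. $\mathfrak S_\infty$: finite permutations of $\{1,2,\dots\}$, $\mathfrak A_\infty$ the even ones, $s_i=(i\ i{+}1)$. $G_\infty=G(m,1,\infty)=D_\infty\rtimes\mathfrak S_\infty$, $D_\infty$ the restricted direct product of cyclic groups $\langle y_j\rangle$ of order $m$ ($j\ge1$), $\sigma y_j\sigma^{-1}=y_{\sigma(j)}$. $G'_\infty=R(G(m,1,\infty))$: generators $z_1,z_2,z_3,r_i,\widehat\eta_j$ ($i,j\ge1$), relations: $z_k$ central, $z_k^2=e$; $r_i^2=e$, $(r_ir_{i+1})^3=e$, $r_ir_j=z_1r_jr_i$ ($|i-j|\ge2$); $\widehat\eta_j^{\,m}=e$, $\widehat\eta_j\widehat\eta_k=z_2\widehat\eta_k\widehat\eta_j$ ($j\ne k$); $r_i\widehat\eta_jr_i^{-1}=z_3\widehat\eta_{s_i(j)}$. $Z=\langle z_1,z_2,z_3\rangle\cong\mathbf{Z}_2^3$; $\Phi:G'_\infty\to G_\infty$, $r_i\mapsto s_i$, $\widehat\eta_j\mapsto y_j$, has kernel $Z$. Write $g'=(d',\sigma')=d'\sigma'$, $d'=z_2^az_3^b\widehat\eta_1^{a_1}\widehat\eta_2^{a_2}\cdots$, $\sigma'\in\langle z_1,r_i\rangle$; $\mathrm{ord}(\prod y_j^{a_j})=\sum a_j$ mod $m$. $K_\infty=\{(d,\sigma)\in G_\infty;\mathrm{ord}(d)\text{ even},\sigma\in\mathfrak A_\infty\}$, $K'_\infty=\Phi^{-1}(K_\infty)$. $f_0^{\rm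 VII}(g')=(-1)^b$ for $g'=(d',\sigma')\in K'_\infty$ and $0$ for $g'\notin K'_\infty$. For a discrete group $H$, $K_1(H)$ is the set of positive-definite functions on $H$ invariant under inner automorphisms of $H$ with value $1$ at $e$, and $E(H)$ the set of its extremal points. $\chi^{\rm VII}\in\widehat Z$: $\chi^{\rm VII}(z_1)=\chi^{\rm VII}(z_2)=1$, $\chi^{\rm VII}(z_3)=-1$. For $H=G'_\infty$ or $K'_\infty$, $E(H;\chi^{\rm VII})=\{f\in E(H);f(zh)=\chi^{\rm VII}(z)f(h),\ z\in Z\}$. *)

theory Defs
  imports
    "HOL-Analysis.Analysis"
    "HOL-Algebra.Product_Groups"
    "HOL-Algebra.Elementary_Groups"
    "HOL-Algebra.Generated_Groups"
    "HOL-Combinatorics.Permutations"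
begin

definition pos_def_on :: "('a, 'b) monoid_scheme \<Rightarrow> ('a \<Rightarrow> complex) \<Rightarrow> bool" where
  "pos_def_on H f \<longleftrightarrow>
     (\<forall>(n::nat) (g :: nat \<Rightarrow> 'a) (c :: nat \<Rightarrow> complex). (\<forall>i<n. g i \<in> carrier H) \<longrightarrow>
        (\<Sum>i<n. \<Sum>j<n. c i * cnj (c j) * f (inv\<^bsub>H\<^esub> (g j) \<otimes>\<^bsub>H\<^esub> g i)) \<in> \<real>\<^sub>\<ge>\<^sub>0)"

text \<open>A function on a group is represented as an extensional function on the carrier, so that
  equality of such functions is equality on the carrier.\<close>

definition K1 :: "('a, 'b) monoid_scheme \<Rightarrow> ('a \<Rightarrow> complex) set" where
  "K1 H = {f \<in> extensional (carrier H).
     pos_def_on H f \<and>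
     (\<forall>x\<in>carrier H. \<forall>h\<in>carrier H. f (h \<otimes>\<^bsub>H\<^esub> x \<otimes>\<^bsub>H\<^esub> inv\<^bsub>H\<^esub> h) = f x) \<and>
     f \<one>\<^bsub>H\<^esub> = 1}"

definition Ext :: "('a, 'b) monoid_scheme \<Rightarrow> ('a \<Rightarrow> complex) set" where
  "Ext H = {f \<in> K1 H. \<forall>f1\<in>K1 H. \<forall>f2\<in>K1 H. \<forall>t::real. 0 < t \<and> t < 1 \<and>
     (\<forall>x\<in>carrier H. f x = of_real t * f1 x + of_real (1 - t) * f2 x) \<longrightarrow> f1 = f \<and> f2 = f}"

definition Ext_type ::
  "('a, 'b) monoid_scheme \<Rightarrow> 'a set \<Rightarrow> ('a \<Rightarrow> complex) \<Rightarrow> ('a \<Rightarrow> complex) set" where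
  "Ext_type H Z c = {f \<in> Ext H. \<forall>z\<in>Z. \<forall>h\<in>carrier H. f (z \<otimes>\<^bsub>H\<^esub> h) = c z * f h}"

text \<open>A letter is a generator together with a flag: \<open>(x, False)\<close> stands for \<open>x\<close> and
  \<open>(x, True)\<close> for its formal inverse. A relation is a pair of words.\<close>

type_synonym 'a word = "('a \<times> bool) list"

abbreviation words :: "'a set \<Rightarrow> 'a word set" where
  "words X \<equiv> lists (X \<times> UNIV)"

inductive pres_equiv :: "'a set \<Rightarrow> ('a word \<times> 'a word) set \<Rightarrow> 'a word \<Rightarrow> 'a word \<Rightarrow> bool"
  for X :: "'a set" and Rel :: "('a word \<times> 'a word) set" where
  refl: "w \<in> words X \<Longrightarrow> pres_equiv X Rel w w"
| sym: "pres_equiv X Rel u v \<Longrightarrow> pres_equiv X Rel v u"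
| trans: "pres_equiv X Rel u v \<Longrightarrow> pres_equiv X Rel v w \<Longrightarrow> pres_equiv X Rel u w"
| congr: "pres_equiv X Rel u v \<Longrightarrow> a \<in> words X \<Longrightarrow> b \<in> words X \<Longrightarrow>
     pres_equiv X Rel (a @ u @ b) (a @ v @ b)"
| cancel: "x \<in> X \<Longrightarrow> pres_equiv X Rel [(x, s), (x, \<not> s)] []"
| rel: "(u, v) \<in> Rel \<Longrightarrow> u \<in> words X \<Longrightarrow> v \<in> words X \<Longrightarrow> pres_equiv X Rel u v"

definition word_class :: "'a set \<Rightarrow> ('a word \<times> 'a word) set \<Rightarrow> 'a word \<Rightarrow> 'a word set" where
  "word_class X Rel w = {v. pres_equiv X Rel w v}"

definition presented_group ::
  "'a set \<Rightarrow> ('a word \<times> 'a word) set \<Rightarrow> 'a word set monoid" where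
  "presented_group X Rel =
     \<lparr>carrier = word_class X Rel ` words X,
      monoid.mult = (\<lambda>A B. {w. \<exists>u\<in>A. \<exists>v\<in>B. pres_equiv X Rel (u @ v) w}),
      one = word_class X Rel []\<rparr>"

definition eval_word :: "('g, 'b) monoid_scheme \<Rightarrow> ('a \<Rightarrow> 'g) \<Rightarrow> 'a word \<Rightarrow> 'g" where
  "eval_word G \<phi> w =
     foldr (\<lambda>(x, s) g. (if s then inv\<^bsub>G\<^esub> (\<phi> x) else \<phi> x) \<otimes>\<^bsub>G\<^esub> g) w \<one>\<^bsub>G\<^esub>"

definition Sinf :: "(nat \<Rightarrow> nat) set" where
  "Sinf = {\<sigma>. \<sigma> permutes {1..} \<and> finite {i. \<sigma> i \<noteq> i}}"

definition Ainf :: "(nat \<Rightarrow> nat) set" where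
  "Ainf = {\<sigma> \<in> Sinf. evenperm \<sigma>}"

text \<open>The element \<open>y\<^sub>1\<^bsup>a\<^sub>1\<^esup> y\<^sub>2\<^bsup>a\<^sub>2\<^esup> \<dots>\<close> of \<open>D\<^sub>\<infinity>\<close> is the function \<open>j \<mapsto> a\<^sub>j\<close> with
  \<open>a\<^sub>j \<in> {0..<m}\<close>.\<close>

definition Dinf :: "nat \<Rightarrow> (nat \<Rightarrow> int) monoid" where
  "Dinf m = sum_group {1..} (\<lambda>_. integer_mod_group m)"

definition perm_act :: "(nat \<Rightarrow> nat) \<Rightarrow> (nat \<Rightarrow> int) \<Rightarrow> nat \<Rightarrow> int" where
  "perm_act \<sigma> d = (\<lambda>j\<in>{1..}. d (Hilbert_Choice.inv \<sigma> j))"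

definition Ginf :: "nat \<Rightarrow> ((nat \<Rightarrow> int) \<times> (nat \<Rightarrow> nat)) monoid" where
  "Ginf m =
     \<lparr>carrier = carrier (Dinf m) \<times> Sinf,
      monoid.mult = (\<lambda>(d, \<sigma>) (d', \<sigma>'). (d \<otimes>\<^bsub>Dinf m\<^esub> perm_act \<sigma> d', \<sigma> \<circ> \<sigma>')),
      one = (\<one>\<^bsub>Dinf m\<^esub>, id)\<rparr>"

definition sG :: "nat \<Rightarrow> nat \<Rightarrow> (nat \<Rightarrow> int) \<times> (nat \<Rightarrow> nat)" where
  "sG m i = (\<one>\<^bsub>Dinf m\<^esub>, Transposition.transpose i (Suc i))"

definition yG :: "nat \<Rightarrow> nat \<Rightarrow> (nat \<Rightarrow> int) \<times> (nat \<Rightarrow> nat)" where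
  "yG m j = ((\<lambda>i\<in>{1..}. if i = j then 1 mod int m else 0), id)"

definition ord_D :: "nat \<Rightarrow> (nat \<Rightarrow> int) \<Rightarrow> int" where
  "ord_D m d = (\<Sum>j | j \<in> {1..} \<and> d j \<noteq> 0. d j) mod int m"

definition Kinf :: "nat \<Rightarrow> ((nat \<Rightarrow> int) \<times> (nat \<Rightarrow> nat)) set" where
  "Kinf m = {(d, \<sigma>) \<in> carrier (Ginf m). even (ord_D m d) \<and> \<sigma> \<in> Ainf}"

datatype gen = Zgen nat | Rgen nat | Egen nat

definition gens :: "gen set" where
  "gens = Zgen ` {1, 2, 3} \<union> Rgen ` {1..} \<union> Egen ` {1..}"

abbreviation zw :: "nat \<Rightarrow> gen word" where "zw k \<equiv> [(Zgen k, False)]"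
abbreviation rw :: "nat \<Rightarrow> gen word" where "rw i \<equiv> [(Rgen i, False)]"
abbreviation rw_inv :: "nat \<Rightarrow> gen word" where "rw_inv i \<equiv> [(Rgen i, True)]"
abbreviation ew :: "nat \<Rightarrow> gen word" where "ew j \<equiv> [(Egen j, False)]"

definition rels :: "nat \<Rightarrow> (gen word \<times> gen word) set" where
  "rels m =
     {(zw k @ [(x, False)], [(x, False)] @ zw k) | k x. k \<in> {1, 2, 3} \<and> x \<in> gens}
   \<union> {(zw k @ zw k, []) | k. k \<in> {1, 2, 3}}
   \<union> {(rw i @ rw i, []) | i. i \<ge> 1}
   \<union> {(concat (replicate 3 (rw i @ rw (i + 1))), []) | i. i \<ge> 1}
   \<union> {(rw i @ rw j, zw 1 @ rw j @ rw i) | i j. i \<ge> 1 \<and> j \<ge> 1 \<and> (i + 2 \<le> j \<or> j + 2 \<le> i)}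
   \<union> {(concat (replicate m (ew j)), []) | j. j \<ge> 1}
   \<union> {(ew j @ ew k, zw 2 @ ew k @ ew j) | j k. j \<ge> 1 \<and> k \<ge> 1 \<and> j \<noteq> k}
   \<union> {(rw i @ ew j @ rw_inv i, zw 3 @ ew (Transposition.transpose i (i + 1) j)) | i j.
        i \<ge> 1 \<and> j \<ge> 1}"

definition Gp :: "nat \<Rightarrow> gen word set monoid" where
  "Gp m = presented_group gens (rels m)"

definition zp :: "nat \<Rightarrow> nat \<Rightarrow> gen word set" where
  "zp m k = word_class gens (rels m) (zw k)"

definition rp :: "nat \<Rightarrow> nat \<Rightarrow> gen word set" where
  "rp m i = word_class gens (rels m) (rw i)"

definition ep :: "nat \<Rightarrow> nat \<Rightarrow> gen word set" where
  "ep m j = word_class gens (rels m) (ew j)"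

definition Zp :: "nat \<Rightarrow> gen word set set" where
  "Zp m = generate (Gp m) {zp m 1, zp m 2, zp m 3}"

fun gen_image :: "nat \<Rightarrow> gen \<Rightarrow> (nat \<Rightarrow> int) \<times> (nat \<Rightarrow> nat)" where
  "gen_image m (Zgen k) = \<one>\<^bsub>Ginf m\<^esub>"
| "gen_image m (Rgen i) = sG m i"
| "gen_image m (Egen j) = yG m j"

text \<open>The relations hold in \<open>G\<^sub>\<infinity>\<close>, so all words in one class have the same value there.\<close>

definition Phi :: "nat \<Rightarrow> gen word set \<Rightarrow> (nat \<Rightarrow> int) \<times> (nat \<Rightarrow> nat)" where
  "Phi m A = the_elem (eval_word (Ginf m) (gen_image m) ` A)"

definition preim :: "nat \<Rightarrow> ((nat \<Rightarrow> int) \<times> (nat \<Rightarrow> nat)) set \<Rightarrow> gen word set set" where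
  "preim m L = {g \<in> carrier (Gp m). Phi m g \<in> L}"

definition Kp :: "nat \<Rightarrow> gen word set set" where
  "Kp m = preim m (Kinf m)"

abbreviation KinfG :: "nat \<Rightarrow> ((nat \<Rightarrow> int) \<times> (nat \<Rightarrow> nat)) monoid" where
  "KinfG m \<equiv> (Ginf m)\<lparr>carrier := Kinf m\<rparr>"

abbreviation KpG :: "nat \<Rightarrow> gen word set monoid" where
  "KpG m \<equiv> (Gp m)\<lparr>carrier := Kp m\<rparr>"

definition chiVII :: "nat \<Rightarrow> gen word set \<Rightarrow> complex" where
  "chiVII m = (THE c. c \<in> extensional (Zp m) \<and>
     (\<forall>z\<in>Zp m. \<forall>w\<in>Zp m. c (z \<otimes>\<^bsub>Gp m\<^esub> w) = c z * c w) \<and>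
     c (zp m 1) = 1 \<and> c (zp m 2) = 1 \<and> c (zp m 3) = -1)"

primrec eta_prod :: "nat \<Rightarrow> (nat \<Rightarrow> nat) \<Rightarrow> nat \<Rightarrow> gen word set" where
  "eta_prod m a 0 = \<one>\<^bsub>Gp m\<^esub>"
| "eta_prod m a (Suc n) = eta_prod m a n \<otimes>\<^bsub>Gp m\<^esub> (ep m (Suc n) [^]\<^bsub>Gp m\<^esub> a (Suc n))"

definition Sp :: "nat \<Rightarrow> gen word set set" where
  "Sp m = generate (Gp m) ({zp m 1} \<union> rp m ` {1..})"

text \<open>The exponent \<open>b\<close> of \<open>z\<^sub>3\<close> in \<open>g' = z\<^sub>2\<^bsup>a\<^esup> z\<^sub>3\<^bsup>b\<^esup> \<eta>\<^sub>1\<^bsup>a\<^sub>1\<^esup> \<eta>\<^sub>2\<^bsup>a\<^sub>2\<^esup> \<dots> \<sigma>'\<close>, taken in \<open>{0, 1}\<close>.\<close>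

definition z3_exp :: "nat \<Rightarrow> gen word set \<Rightarrow> nat" where
  "z3_exp m g = (THE b. b \<in> {0, 1} \<and> (\<exists>a as n. \<exists>\<sigma>\<in>Sp m.
     g = zp m 2 [^]\<^bsub>Gp m\<^esub> (a::nat) \<otimes>\<^bsub>Gp m\<^esub> zp m 3 [^]\<^bsub>Gp m\<^esub> b
           \<otimes>\<^bsub>Gp m\<^esub> eta_prod m as n \<otimes>\<^bsub>Gp m\<^esub> \<sigma>))"

definition f0VII :: "nat \<Rightarrow> gen word set \<Rightarrow> complex" where
  "f0VII m g = (if g \<in> Kp m then (-1) ^ z3_exp m g else 0)"

text \<open>For a subgroup \<open>L\<close> of \<open>G\<^sub>\<infinity>\<close>, \<open>mult_up m L\<close> turns functions on \<open>L\<close> into functions on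
  its preimage \<open>L'\<close> in \<open>G'\<^sub>\<infinity>\<close>, and \<open>mult_down m L\<close> turns functions on \<open>L'\<close> into functions
  on \<open>L\<close>; the latter is meaningful for \<open>f\<close> such that \<open>f\<^sub>0 f\<close> is constant on the fibres
  of \<open>Phi\<close>.\<close>

definition mult_up ::
  "nat \<Rightarrow> ((nat \<Rightarrow> int) \<times> (nat \<Rightarrow> nat)) set \<Rightarrow> ((nat \<Rightarrow> int) \<times> (nat \<Rightarrow> nat) \<Rightarrow> complex)
     \<Rightarrow> (gen word set \<Rightarrow> complex)" where
  "mult_up m L F = (\<lambda>g'\<in>preim m L. f0VII m g' * F (Phi m g'))"

definition mult_down ::
  "nat \<Rightarrow> ((nat \<Rightarrow> int) \<times> (nat \<Rightarrow> nat)) set \<Rightarrow> (gen word set \<Rightarrow> complex)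
     \<Rightarrow> ((nat \<Rightarrow> int) \<times> (nat \<Rightarrow> nat) \<Rightarrow> complex)" where
  "mult_down m L f =
     (\<lambda>g\<in>L. the_elem ((\<lambda>g'. f0VII m g' * f g') ` {g' \<in> preim m L. Phi m g' = g}))"

end

theory Submission
  imports Defs
begin

text \<open>
  Write \<open>G'\<close>, \<open>K'\<close>, \<open>G\<close>, \<open>K\<close> for the four groups.

  A generator \<open>r\<^sub>i\<close> or \<open>\<eta>\<^sub>i\<close> whose index is large compared with \<open>g'\<close> commutes with \<open>g'\<close> up to a central
  factor, and this factor depends only on the parities of \<open>ord d'\<close> and of \<open>\<sigma>'\<close>
  (\<open>far_commutators\<close>).  If \<open>g'\<close> lies outside \<open>K'\<close>, one of the two factors involves \<open>z\<^sub>3\<close>, so a class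
  function of type \<open>\<chi>\<close> satisfies \<open>f g' = - f g' = 0\<close> (\<open>typed_vanish\<close>).  If \<open>g'\<close> lies in \<open>K'\<close>, both
  factors are trivial, and a conjugating element can be multiplied by such generators until it lies in
  \<open>K'\<close>: the classes of \<open>G'\<close> in \<open>K'\<close> are the classes of \<open>K'\<close> (\<open>conjugate_by_even\<close>).  So restriction to
  \<open>K'\<close> and extension by zero are mutually inverse affine maps between the functions of type \<open>\<chi>\<close> on
  \<open>G'\<close> and on \<open>K'\<close>.  These sets are faces of the convex sets \<open>K1\<close> (\<open>typed_face\<close>), hence extremal
  functions correspond to each other (\<open>Ext_transport\<close>).

  The group \<open>G'\<close> maps onto the dihedral group of order 8; the \<open>r\<^sub>i\<close> go to one reflection, the \<open>\<eta>\<^sub>j\<close> to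
  another one, \<open>z\<^sub>3\<close> to the central involution, \<open>z\<^sub>1\<close> and \<open>z\<^sub>2\<close> to the identity.  The preimage of the
  centre is \<open>K'\<close>, and \<open>f\<^sub>0\<close> is the normalized character of the irreducible representation of dimension
  two.  In particular the exponent \<open>b\<close> is well defined, and on \<open>K'\<close> the function \<open>f\<^sub>0\<close> is a character
  with values in \<open>{1, -1}\<close> that agrees with \<open>\<chi>\<close> on \<open>Z\<close>.  Multiplication by \<open>f\<^sub>0\<close> thus preserves
  positive definiteness (\<open>K1_twist_iff\<close>) and exchanges functions of type \<open>\<chi>\<close> with functions that are
  trivial on \<open>Z\<close>.  The latter are the functions on \<open>K\<close>, because \<open>\<Phi>\<close> is surjective with kernel \<open>Z\<close>
  (\<open>Phi_surj\<close>, \<open>Phi_kernel\<close>); for the kernel, words are brought into a normal form, which for the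
  part in the \<open>r\<^sub>i\<close> is the enumeration of cosets for the Coxeter presentation of the symmetric groups.

  There remains the restriction from \<open>G\<close> to \<open>K\<close>.  Every \<open>h\<close> in \<open>G\<close> has conjugates \<open>h\<^sub>n\<close> that move to
  infinity.  If \<open>F\<close> is extremal, then \<open>F (x h\<^sub>n) = F x F h\<close> for all large \<open>n\<close>
  (\<open>Ext_asymptotically_multiplicative\<close>), so there are arbitrarily many conjugates \<open>k\<^sub>i\<close> of \<open>h\<close>
  with \<open>F (k\<^sub>j\<inverse> k\<^sub>i) = \<bar>F h\<bar>\<^sup>2\<close> for \<open>i \<noteq> j\<close>; conversely this property implies
  extremality (\<open>Ext_if_orthogonal_conjugates\<close>).  As \<open>G\<close> and \<open>K\<close> have the same classes in \<open>K\<close>, the property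
  passes to the restriction.  For surjectivity, the extensions of a given extremal function to class
  functions on \<open>G\<close> form a nonempty compact face, which has an extreme point (\<open>Ext_extension\<close>).
\<close>

section \<open>Positive-definite functions\<close>

lemma pos_def_on_sum:
  assumes "pos_def_on H f" and "finite I" and "\<And>i. i \<in> I \<Longrightarrow> g i \<in> carrier H"
  shows "(\<Sum>i\<in>I. \<Sum>j\<in>I. c i * cnj (c j) * f (inv\<^bsub>H\<^esub> (g j) \<otimes>\<^bsub>H\<^esub> g i)) \<in> \<real>\<^sub>\<ge>\<^sub>0"
proof -
  obtain b where b: "bij_betw b {0..<card I} I"
    using ex_bij_betw_nat_finite[OF assms(2)] by blast
  let ?F = "\<lambda>i j. c i * cnj (c j) * f (inv\<^bsub>H\<^esub> (g j) \<otimes>\<^bsub>H\<^esub> g i)"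
  have bI: "b k \<in> I" if "k < card I" for k
    using b that by (auto simp: bij_betw_def)
  have "(\<Sum>i<card I. \<Sum>j<card I. ?F (b i) (b j)) \<in> \<real>\<^sub>\<ge>\<^sub>0"
    using assms(1)[unfolded pos_def_on_def, rule_format, of "card I" "g \<circ> b" "c \<circ> b"]
    by (simp add: assms(3) bI)
  moreover have "(\<Sum>i<card I. \<Sum>j<card I. ?F (b i) (b j)) = (\<Sum>i\<in>I. \<Sum>j\<in>I. ?F i j)"
    using sum.reindex_bij_betw[OF b, of "\<lambda>i. \<Sum>j\<in>I. ?F i j"]
      sum.reindex_bij_betw[OF b, of "\<lambda>j. ?F i j" for i]
    by (simp add: atLeast0LessThan)
  ultimately show ?thesis by simp
qed

lemma sum_nonneg_Reals_I:
  fixes f :: "'i \<Rightarrow> complex"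
  shows "(\<And>i. i \<in> I \<Longrightarrow> f i \<in> \<real>\<^sub>\<ge>\<^sub>0) \<Longrightarrow> sum f I \<in> \<real>\<^sub>\<ge>\<^sub>0"
  by (induction I rule: infinite_finite_induct) auto

lemma pos_def_on_two:
  assumes "group H" and "pos_def_on H f" and x: "x \<in> carrier H"
  shows "f \<one>\<^bsub>H\<^esub> * (1 + z * cnj z) + z * f x + cnj z * f (inv\<^bsub>H\<^esub> x) \<in> \<real>\<^sub>\<ge>\<^sub>0"
proof -
  interpret group H by fact
  let ?g = "\<lambda>i::nat. if i = 0 then \<one>\<^bsub>H\<^esub> else x"
  let ?c = "\<lambda>i::nat. if i = 0 then 1 else z"
  have "(\<Sum>i\<in>{0,1}. \<Sum>j\<in>{0,1}. ?c i * cnj (?c j) * f (inv\<^bsub>H\<^esub> (?g j) \<otimes>\<^bsub>H\<^esub> ?g i)) \<in> \<real>\<^sub>\<ge>\<^sub>0"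
    by (rule pos_def_on_sum[OF assms(2)]) (use x in auto)
  then show ?thesis
    using x by (simp add: algebra_simps)
qed

lemma pos_def_on_one:
  assumes "group H" and "pos_def_on H f"
  shows "f \<one>\<^bsub>H\<^esub> \<in> \<real>\<^sub>\<ge>\<^sub>0"
  using pos_def_on_two[OF assms group.is_monoid[OF assms(1), THEN monoid.one_closed], of 0] by simp

lemma pos_def_on_inv:
  assumes "group H" and "pos_def_on H f" and x: "x \<in> carrier H"
  shows "f (inv\<^bsub>H\<^esub> x) = cnj (f x)"
  using pos_def_on_two[OF assms, of 1] pos_def_on_two[OF assms, of \<i>] pos_def_on_one[OF assms(1,2)]
  by (auto simp: complex_nonneg_Reals_iff complex_eq_iff)

text \<open>A phase rotating \<open>f x\<close> to the negative axis turns positivity on \<open>{e, x}\<close> into a bound.\<close>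

lemma pos_def_on_norm_le:
  assumes "group H" and "pos_def_on H f" and x: "x \<in> carrier H"
  shows "cmod (f x) \<le> Re (f \<one>\<^bsub>H\<^esub>)"
proof (cases "f x = 0")
  case True
  then show ?thesis using pos_def_on_one[OF assms(1,2)] by (auto simp: complex_nonneg_Reals_iff)
next
  case False
  define z where "z = - cnj (f x) / cmod (f x)"
  have "z * cnj z = 1"
    using False by (simp add: z_def complex_norm_square[symmetric] power2_eq_square mult.commute)
  moreover have "z * f x = - cmod (f x)"
    using False by (simp add: z_def mult.commute[of "cnj _"] complex_norm_square[symmetric] power2_eq_square)
  moreover from this have "cnj z * cnj (f x) = - cmod (f x)"
    by (metis complex_cnj_complex_of_real complex_cnj_minus complex_cnj_mult)
  ultimately have "f \<one>\<^bsub>H\<^esub> * 2 - 2 * cmod (f x) \<in> \<real>\<^sub>\<ge>\<^sub>0"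
    using pos_def_on_two[OF assms, of z] by (simp add: pos_def_on_inv[OF assms])
  then show ?thesis by (auto simp: complex_nonneg_Reals_iff)
qed

text \<open>In the representation attached to \<open>f\<close> the unit vector is an eigenvector of \<open>z\<close>; the
  positivity of \<open>f\<close> on the vector \<open>s (\<epsilon> - z) + u h\<inverse>\<close>, whose squared norm is affine in the real
  number \<open>s\<close>, expresses this without the representation.\<close>

lemma pos_def_on_translate:
  fixes H (structure)
  assumes "group H" and "pos_def_on H f" and f1: "f \<one>\<^bsub>H\<^esub> = 1"
    and z: "z \<in> carrier H" and h: "h \<in> carrier H"
    and fz: "f z = of_real \<epsilon>" and eps: "\<epsilon> = 1 \<or> \<epsilon> = -1"
  shows "f (h \<otimes>\<^bsub>H\<^esub> z) = of_real \<epsilon> * f h"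
proof -
  interpret group H by fact
  define w where "w = of_real \<epsilon> * f h - f (h \<otimes> z)"
  have ee: "of_real \<epsilon> * of_real \<epsilon> = (1::complex)" using eps by auto
  have iz: "f (inv z) = of_real \<epsilon>"
    using fz by (simp add: pos_def_on_inv[OF assms(1,2) z])
  have ih: "f (inv h) = cnj (f h)" by (rule pos_def_on_inv[OF assms(1,2) h])
  have ihz: "f (inv z \<otimes> inv h) = cnj (f (h \<otimes> z))"
    using pos_def_on_inv[OF assms(1,2), of "h \<otimes> z"] h z by (simp add: inv_mult_group)
  have pos: "0 \<le> cmod w ^ 2 + 2 * s * cmod w ^ 2" for s :: real
  proof -
    let ?g = "\<lambda>i::nat. if i = 0 then \<one>\<^bsub>H\<^esub> else if i = 1 then z else inv\<^bsub>H\<^esub> h"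
    let ?c = "\<lambda>i::nat. if i = 0 then of_real (\<epsilon> * s) else if i = 1 then - of_real s else w"
    have "(\<Sum>i\<in>{0,1,2}. \<Sum>j\<in>{0,1,2}. ?c i * cnj (?c j) * f (inv\<^bsub>H\<^esub> (?g j) \<otimes>\<^bsub>H\<^esub> ?g i)) \<in> \<real>\<^sub>\<ge>\<^sub>0"
      by (rule pos_def_on_sum[OF assms(2)]) (use z h in auto)
    also have "(\<Sum>i\<in>{0,1,2}. \<Sum>j\<in>{0,1,2}. ?c i * cnj (?c j) * f (inv\<^bsub>H\<^esub> (?g j) \<otimes>\<^bsub>H\<^esub> ?g i))
       = (of_real \<epsilon> * of_real \<epsilon> * of_real (s^2) + of_real (s^2) - 2 * (of_real \<epsilon> * of_real \<epsilon>) * of_real (s^2))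
         + w * cnj w + of_real s * (cnj w * w + w * cnj w)"
      using z h by (simp add: f1 fz iz ih ihz w_def algebra_simps power2_eq_square)
    also have "\<dots> = of_real (cmod w ^ 2 + 2 * s * cmod w ^ 2)"
      unfolding ee by (simp only: of_real_add of_real_mult complex_norm_square) (simp add: algebra_simps)
    finally show ?thesis by (simp add: complex_nonneg_Reals_iff)
  qed
  have "cmod w ^ 2 = 0"
    using pos[of "-1"] by simp
  then show ?thesis by (simp add: w_def)
qed

lemma K1D:
  assumes "f \<in> K1 H"
  shows "f \<in> extensional (carrier H)" "pos_def_on H f" "f \<one>\<^bsub>H\<^esub> = 1"
    "\<And>x h. x \<in> carrier H \<Longrightarrow> h \<in> carrier H \<Longrightarrow> f (h \<otimes>\<^bsub>H\<^esub> x \<otimes>\<^bsub>H\<^esub> inv\<^bsub>H\<^esub> h) = f x"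
  using assms by (auto simp: K1_def)

lemma K1_eqI:
  assumes "f \<in> K1 H" "f' \<in> K1 H" "\<And>x. x \<in> carrier H \<Longrightarrow> f x = f' x"
  shows "f = f'"
  using extensionalityI[OF K1D(1)[OF assms(1)] K1D(1)[OF assms(2)]] assms(3) by blast

lemma K1_norm_le_1:
  assumes "group H" and "f \<in> K1 H" and "x \<in> carrier H"
  shows "cmod (f x) \<le> 1"
  using pos_def_on_norm_le[OF assms(1) K1D(2)[OF assms(2)] assms(3)] K1D(3)[OF assms(2)] by simp

section \<open>Subgroups and extension by zero\<close>

lemma pos_def_on_subgroup_iff:
  assumes "group H" and "subgroup L H"
  shows "pos_def_on (H\<lparr>carrier := L\<rparr>) f \<longleftrightarrow>
     (\<forall>(n::nat) g c. (\<forall>i<n. g i \<in> L) \<longrightarrow>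
        (\<Sum>i<n. \<Sum>j<n. c i * cnj (c j) * f (inv\<^bsub>H\<^esub> (g j) \<otimes>\<^bsub>H\<^esub> g i)) \<in> \<real>\<^sub>\<ge>\<^sub>0)"
proof -
  have "(\<Sum>i<n. \<Sum>j<n. c i * cnj (c j) * f (inv\<^bsub>H\<lparr>carrier := L\<rparr>\<^esub> (g j) \<otimes>\<^bsub>H\<^esub> g i))
      = (\<Sum>i<n. \<Sum>j<n. c i * cnj (c j) * f (inv\<^bsub>H\<^esub> (g j) \<otimes>\<^bsub>H\<^esub> g i))"
    if "\<forall>i<n. g i \<in> L" for n :: nat and g c
    using that by (intro sum.cong HOL.refl) (simp add: group.m_inv_consistent[OF assms])
  then show ?thesis unfolding pos_def_on_def by simp
qed

lemma K1_subgroup_iff: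
  assumes "group H" and "subgroup L H"
  shows "f \<in> K1 (H\<lparr>carrier := L\<rparr>) \<longleftrightarrow>
     f \<in> extensional L \<and> pos_def_on (H\<lparr>carrier := L\<rparr>) f \<and>
     (\<forall>x\<in>L. \<forall>h\<in>L. f (h \<otimes>\<^bsub>H\<^esub> x \<otimes>\<^bsub>H\<^esub> inv\<^bsub>H\<^esub> h) = f x) \<and> f \<one>\<^bsub>H\<^esub> = 1"
  using group.m_inv_consistent[OF assms] by (auto simp: K1_def)

lemma K1_restrict:
  assumes "group H" and "subgroup L H" and "f \<in> K1 H"
  shows "restrict f L \<in> K1 (H\<lparr>carrier := L\<rparr>)"
proof -
  interpret group H by fact
  interpret L: subgroup L H by fact
  have "pos_def_on (H\<lparr>carrier := L\<rparr>) (restrict f L)"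
    unfolding pos_def_on_subgroup_iff[OF assms(1,2)]
  proof (intro allI impI)
    fix n :: nat and g c assume g: "\<forall>i<n. g i \<in> L"
    have "(\<Sum>i<n. \<Sum>j<n. c i * cnj (c j) * f (inv\<^bsub>H\<^esub> (g j) \<otimes>\<^bsub>H\<^esub> g i)) \<in> \<real>\<^sub>\<ge>\<^sub>0"
      using g by (intro pos_def_on_sum[OF K1D(2)[OF assms(3)]]) auto
    then show "(\<Sum>i<n. \<Sum>j<n. c i * cnj (c j) * restrict f L (inv\<^bsub>H\<^esub> (g j) \<otimes>\<^bsub>H\<^esub> g i)) \<in> \<real>\<^sub>\<ge>\<^sub>0"
      using g by (simp add: L.m_closed L.m_inv_closed)
  qed
  then show ?thesis
    unfolding K1_subgroup_iff[OF assms(1,2)]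
    using K1D[OF assms(3)] by (auto simp: L.m_closed L.m_inv_closed)
qed

definition zero_extension :: "('a, 'b) monoid_scheme \<Rightarrow> 'a set \<Rightarrow> ('a \<Rightarrow> complex) \<Rightarrow> 'a \<Rightarrow> complex"
  where "zero_extension H L f = (\<lambda>x\<in>carrier H. if x \<in> L then f x else 0)"

text \<open>The Gram sum of an extension by zero splits into one block for each left coset of \<open>L\<close>, and
  translating a coset into \<open>L\<close> does not change its block.\<close>

lemma pos_def_on_zero_extension:
  fixes H (structure)
  assumes "group H" and "subgroup L H" and pd: "pos_def_on (H\<lparr>carrier := L\<rparr>) f"
  shows "pos_def_on H (zero_extension H L f)"
  unfolding pos_def_on_def
proof (intro allI impI)
  interpret group H by fact
  interpret L: subgroup L H by fact
  fix n :: nat and g :: "nat \<Rightarrow> 'a" and c :: "nat \<Rightarrow> complex"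
  assume "\<forall>i<n. g i \<in> carrier H"
  then have g: "g i \<in> carrier H" if "i < n" for i using that by blast
  \<comment> \<open>\<open>cl i\<close> is the left coset \<open>g i L\<close>.\<close>
  define cl where "cl i = {x \<in> carrier H. inv (g i) \<otimes> x \<in> L}" for i
  have split: "inv (g j) \<otimes> x = (inv (g j) \<otimes> g i) \<otimes> (inv (g i) \<otimes> x)"
    if "i < n" "j < n" "x \<in> carrier H" for i j x
    using that g by (simp add: m_assoc) (simp add: m_assoc[symmetric])
  have cl_eq: "cl i = cl j \<longleftrightarrow> inv (g j) \<otimes> g i \<in> L" if ij: "i < n" "j < n" for i j
  proof
    assume "cl i = cl j"
    moreover have "g i \<in> cl i" using g[OF ij(1)] by (simp add: cl_def)
    ultimately show "inv (g j) \<otimes> g i \<in> L" by (auto simp: cl_def)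
  next
    assume a: "inv (g j) \<otimes> g i \<in> L"
    then have "inv (inv (g j) \<otimes> g i) \<in> L" by simp
    then have b: "inv (g i) \<otimes> g j \<in> L" using g ij by (simp add: inv_mult_group)
    show "cl i = cl j"
    proof (rule Set.set_eqI)
      fix x
      show "x \<in> cl i \<longleftrightarrow> x \<in> cl j"
      proof (cases "x \<in> carrier H")
        case True
        have "inv (g i) \<otimes> x \<in> L \<Longrightarrow> inv (g j) \<otimes> x \<in> L"
          using a L.m_closed split[OF ij True] by metis
        moreover have "inv (g j) \<otimes> x \<in> L \<Longrightarrow> inv (g i) \<otimes> x \<in> L"
          using b L.m_closed split[OF ij(2,1) True] by metis
        ultimately show ?thesis using True by (auto simp: cl_def)
      qed (simp add: cl_def)
    qed
  qed
  let ?I = "\<lambda>C. {i. i < n \<and> cl i = C}"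
  let ?t = "\<lambda>i j. c i * cnj (c j) * zero_extension H L f (inv (g j) \<otimes> g i)"
  have t0: "?t i j = 0" if "i < n" "j < n" "cl i \<noteq> cl j" for i j
    using that g cl_eq by (simp add: zero_extension_def)
  have "(\<Sum>i<n. \<Sum>j<n. ?t i j) = (\<Sum>i<n. \<Sum>j\<in>?I (cl i). ?t i j)"
  proof (rule sum.cong[OF HOL.refl])
    fix i assume i: "i \<in> {..<n}"
    show "(\<Sum>j<n. ?t i j) = (\<Sum>j\<in>?I (cl i). ?t i j)"
    proof (rule sum.mono_neutral_right)
      show "\<forall>j\<in>{..<n} - ?I (cl i). ?t i j = 0"
      proof
        fix j assume "j \<in> {..<n} - ?I (cl i)"
        then show "?t i j = 0" using i by (intro t0) auto
      qed
    qed auto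
  qed
  also have "\<dots> = (\<Sum>C\<in>cl ` {..<n}. \<Sum>i\<in>{i \<in> {..<n}. cl i = C}. \<Sum>j\<in>?I (cl i). ?t i j)"
    by (rule sum.group[symmetric]) auto
  also have "\<dots> = (\<Sum>C\<in>cl ` {..<n}. \<Sum>i\<in>?I C. \<Sum>j\<in>?I C. ?t i j)"
    by (intro sum.cong) auto
  also have "\<dots> \<in> \<real>\<^sub>\<ge>\<^sub>0"
  proof (rule sum_nonneg_Reals_I)
    fix C assume "C \<in> cl ` {..<n}"
    then obtain k where k: "k < n" "cl k = C" by auto
    define l where "l i = inv (g k) \<otimes> g i" for i
    have lL: "l i \<in> L" if "i \<in> ?I C" for i
      using that k cl_eq[of i k] by (auto simp: l_def)
    have ll: "inv (l j) \<otimes> l i = inv (g j) \<otimes> g i" if "i < n" "j < n" for i j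
      using that k g by (simp add: l_def inv_mult_group m_assoc) (simp add: m_assoc[symmetric])
    have "(\<Sum>i\<in>?I C. \<Sum>j\<in>?I C. c i * cnj (c j) * f (inv\<^bsub>H\<lparr>carrier := L\<rparr>\<^esub> (l j) \<otimes>\<^bsub>H\<lparr>carrier := L\<rparr>\<^esub> l i)) \<in> \<real>\<^sub>\<ge>\<^sub>0"
      by (rule pos_def_on_sum[OF pd]) (use lL in auto)
    also have "(\<Sum>i\<in>?I C. \<Sum>j\<in>?I C. c i * cnj (c j) * f (inv\<^bsub>H\<lparr>carrier := L\<rparr>\<^esub> (l j) \<otimes>\<^bsub>H\<lparr>carrier := L\<rparr>\<^esub> l i))
        = (\<Sum>i\<in>?I C. \<Sum>j\<in>?I C. ?t i j)"
    proof (intro sum.cong HOL.refl)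
      fix i j assume ij: "i \<in> ?I C" "j \<in> ?I C"
      have "inv (g j) \<otimes> g i \<in> L" using cl_eq[of i j] ij by auto
      then show "c i * cnj (c j) * f (inv\<^bsub>H\<lparr>carrier := L\<rparr>\<^esub> (l j) \<otimes>\<^bsub>H\<lparr>carrier := L\<rparr>\<^esub> l i) = ?t i j"
        using lL[OF ij(2)] ll[of i j] ij m_inv_consistent[OF assms(2)]
        by (auto simp: zero_extension_def)
    qed
    finally show "(\<Sum>i\<in>?I C. \<Sum>j\<in>?I C. ?t i j) \<in> \<real>\<^sub>\<ge>\<^sub>0" .
  qed
  finally show "(\<Sum>i<n. \<Sum>j<n. ?t i j) \<in> \<real>\<^sub>\<ge>\<^sub>0" .
qed

text \<open>The hypothesis on conjugacy makes a class function of \<open>L\<close> a class function of \<open>H\<close>.\<close>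

lemma K1_zero_extension:
  fixes H (structure)
  assumes "group H" and L: "L \<lhd> H" and f: "f \<in> K1 (H\<lparr>carrier := L\<rparr>)"
    and conj: "\<And>x h. x \<in> L \<Longrightarrow> h \<in> carrier H \<Longrightarrow>
      \<exists>k\<in>L. k \<otimes>\<^bsub>H\<^esub> x \<otimes>\<^bsub>H\<^esub> inv\<^bsub>H\<^esub> k = h \<otimes>\<^bsub>H\<^esub> x \<otimes>\<^bsub>H\<^esub> inv\<^bsub>H\<^esub> h"
  shows "zero_extension H L f \<in> K1 H"
proof -
  interpret group H by fact
  interpret L: normal L H by fact
  note sub = L.subgroup_axioms
  have f': "pos_def_on (H\<lparr>carrier := L\<rparr>) f" "f \<one> = 1"
    "\<And>x h. x \<in> L \<Longrightarrow> h \<in> L \<Longrightarrow> f (h \<otimes> x \<otimes> inv h) = f x"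
    using f by (auto simp: K1_subgroup_iff[OF assms(1) sub])
  have "zero_extension H L f (h \<otimes> x \<otimes> inv h) = zero_extension H L f x"
    if xh: "x \<in> carrier H" "h \<in> carrier H" for x h
  proof (cases "x \<in> L")
    case True
    then obtain k where "k \<in> L" "k \<otimes> x \<otimes> inv k = h \<otimes> x \<otimes> inv h" using conj xh by blast
    then show ?thesis using True f'(3)[of x k] xh L.inv_op_closed2[OF xh(2) True]
      by (simp add: zero_extension_def)
  next
    case False
    have "h \<otimes> x \<otimes> inv h \<notin> L"
    proof
      assume "h \<otimes> x \<otimes> inv h \<in> L"
      then have "inv h \<otimes> (h \<otimes> x \<otimes> inv h) \<otimes> h \<in> L" using xh by (simp add: L.inv_op_closed1)
      moreover have "inv h \<otimes> (h \<otimes> x \<otimes> inv h) \<otimes> h = x"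
        using xh by (simp add: m_assoc) (simp add: m_assoc[symmetric])
      ultimately show False using False by simp
    qed
    then show ?thesis using False xh by (simp add: zero_extension_def)
  qed
  then show ?thesis
    using pos_def_on_zero_extension[OF assms(1) sub f'(1)] f'(2)
    by (auto simp: K1_def zero_extension_def)
qed

section \<open>Extremal class functions\<close>

lemma ExtD:
  assumes "f \<in> Ext H" "f1 \<in> K1 H" "f2 \<in> K1 H" "0 < t" "t < (1::real)"
    and "\<And>x. x \<in> carrier H \<Longrightarrow> f x = of_real t * f1 x + of_real (1 - t) * f2 x"
  shows "f1 = f" "f2 = f"
  using assms unfolding Ext_def by blast+

lemma Ext_K1: "f \<in> Ext H \<Longrightarrow> f \<in> K1 H"
  by (simp add: Ext_def)

lemma pos_def_on_cong:
  assumes "group H" and "pos_def_on H f" and "\<And>x. x \<in> carrier H \<Longrightarrow> f' x = f x"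
  shows "pos_def_on H f'"
  unfolding pos_def_on_def
proof (intro allI impI)
  interpret group H by fact
  fix n :: nat and g c assume g: "\<forall>i<n. g i \<in> carrier H"
  have "(\<Sum>i<n. \<Sum>j<n. c i * cnj (c j) * f (inv\<^bsub>H\<^esub> (g j) \<otimes>\<^bsub>H\<^esub> g i)) \<in> \<real>\<^sub>\<ge>\<^sub>0"
    using assms(2) g unfolding pos_def_on_def by blast
  then show "(\<Sum>i<n. \<Sum>j<n. c i * cnj (c j) * f' (inv\<^bsub>H\<^esub> (g j) \<otimes>\<^bsub>H\<^esub> g i)) \<in> \<real>\<^sub>\<ge>\<^sub>0"
    using g by (simp add: assms(3))
qed

lemma pos_def_on_scale:
  assumes "pos_def_on H f" and "0 \<le> r"
  shows "pos_def_on H (\<lambda>x. of_real r * f x)"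
  unfolding pos_def_on_def
proof (intro allI impI)
  fix n :: nat and g c assume g: "\<forall>i<n. g i \<in> carrier H"
  have "(\<Sum>i<n. \<Sum>j<n. c i * cnj (c j) * f (inv\<^bsub>H\<^esub> (g j) \<otimes>\<^bsub>H\<^esub> g i)) \<in> \<real>\<^sub>\<ge>\<^sub>0"
    using assms(1) g unfolding pos_def_on_def by blast
  then have "of_real r * (\<Sum>i<n. \<Sum>j<n. c i * cnj (c j) * f (inv\<^bsub>H\<^esub> (g j) \<otimes>\<^bsub>H\<^esub> g i)) \<in> \<real>\<^sub>\<ge>\<^sub>0"
    using assms(2) by (intro nonneg_Reals_mult_I) auto
  then show "(\<Sum>i<n. \<Sum>j<n. c i * cnj (c j) * (of_real r * f (inv\<^bsub>H\<^esub> (g j) \<otimes>\<^bsub>H\<^esub> g i))) \<in> \<real>\<^sub>\<ge>\<^sub>0"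
    by (simp add: sum_distrib_left mult.left_commute)
qed

lemma pos_def_on_null:
  assumes "group H" and "pos_def_on H f" and "f \<one>\<^bsub>H\<^esub> = 0" and "x \<in> carrier H"
  shows "f x = 0"
  using pos_def_on_norm_le[OF assms(1,2,4)] assms(3) by simp

lemma K1_normalize:
  assumes "group H" and "pos_def_on H P"
    and inv: "\<And>x h. x \<in> carrier H \<Longrightarrow> h \<in> carrier H \<Longrightarrow> P (h \<otimes>\<^bsub>H\<^esub> x \<otimes>\<^bsub>H\<^esub> inv\<^bsub>H\<^esub> h) = P x"
    and r: "P \<one>\<^bsub>H\<^esub> = of_real r" "0 < r"
  shows "(\<lambda>x\<in>carrier H. of_real (1 / r) * P x) \<in> K1 H"
proof -
  interpret group H by fact
  have "pos_def_on H (\<lambda>x\<in>carrier H. of_real (1 / r) * P x)"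
    by (rule pos_def_on_cong[OF assms(1) pos_def_on_scale[OF assms(2), of "1 / r"]]) (use r in auto)
  then show ?thesis
    using inv r by (auto simp: K1_def)
qed

text \<open>Normalizing the two summands of \<open>F = P + Q\<close> writes \<open>F\<close> as a convex combination; a summand that
  is zero at the identity vanishes identically.\<close>

lemma Ext_dominates:
  assumes "group H" and F: "F \<in> Ext H" and "pos_def_on H P" "pos_def_on H Q"
    and invP: "\<And>x h. x \<in> carrier H \<Longrightarrow> h \<in> carrier H \<Longrightarrow> P (h \<otimes>\<^bsub>H\<^esub> x \<otimes>\<^bsub>H\<^esub> inv\<^bsub>H\<^esub> h) = P x"
    and invQ: "\<And>x h. x \<in> carrier H \<Longrightarrow> h \<in> carrier H \<Longrightarrow> Q (h \<otimes>\<^bsub>H\<^esub> x \<otimes>\<^bsub>H\<^esub> inv\<^bsub>H\<^esub> h) = Q x"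
    and sum: "\<And>x. x \<in> carrier H \<Longrightarrow> P x + Q x = F x"
    and x: "x \<in> carrier H"
  shows "P x = P \<one>\<^bsub>H\<^esub> * F x"
proof -
  interpret group H by fact
  obtain p q where p: "P \<one>\<^bsub>H\<^esub> = of_real p" "0 \<le> p" and q: "Q \<one>\<^bsub>H\<^esub> = of_real q" "0 \<le> q"
    using pos_def_on_one[OF assms(1,3)] pos_def_on_one[OF assms(1,4)]
    by (auto simp: nonneg_Reals_def)
  have pq: "p + q = 1"
    using sum[OF one_closed] p q K1D(3)[OF Ext_K1[OF F]] by (metis of_real_1 of_real_add of_real_eq_iff)
  consider "p = 0" | "q = 0" | "0 < p" "0 < q" using p q by fastforce
  then show ?thesis
  proof cases
    case 1
    then show ?thesis using pos_def_on_null[OF assms(1,3) _ x] p by simp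
  next
    case 2
    then show ?thesis using pos_def_on_null[OF assms(1,4) _ x] p q pq sum[OF x] by simp
  next
    case 3
    let ?f1 = "\<lambda>x\<in>carrier H. of_real (1 / p) * P x"
    let ?f2 = "\<lambda>x\<in>carrier H. of_real (1 / q) * Q x"
    have "?f1 = F"
    proof (rule ExtD(1)[OF F, of _ ?f2 p])
      show "?f1 \<in> K1 H" by (rule K1_normalize[OF assms(1,3) invP p(1) 3(1)])
      show "?f2 \<in> K1 H" by (rule K1_normalize[OF assms(1,4) invQ q(1) 3(2)])
      show "F x = of_real p * ?f1 x + of_real (1 - p) * ?f2 x" if "x \<in> carrier H" for x
      proof -
        have "1 - p = q" using pq by simp
        then show ?thesis using that 3 sum[OF that] by simp
      qed
    qed (use 3 pq in auto)
    then have "?f1 x = F x" by simp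
    then show ?thesis using x 3 p by (simp add: field_simps)
  qed
qed

text \<open>Let the conjugates \<open>h n\<close> of \<open>h 0\<close> move away, so that each element of the group eventually
  commutes with them.  Then \<open>x \<mapsto> lim F (x h n)\<close> is a class function, and for every phase \<open>\<lambda>\<close>
  the functions \<open>F x \<plusminus> (\<lambda> F (x h n) + \<lambda>\<^sup>* F (x (h n)\<inverse>)) / 2\<close> are limits of
  \<open>F ((1 \<plusminus> \<lambda> h n)\<^sup>* x (1 \<plusminus> \<lambda> h n)) / 2\<close>, hence positive definite.  Their sum is \<open>2 F\<close>, so both are
  multiples of \<open>F\<close> when \<open>F\<close> is extremal.\<close>

lemma Ext_asymptotically_multiplicative:
  fixes H (structure)
  assumes "group H" and F: "F \<in> Ext H"
    and h: "\<And>n. h n \<in> carrier H" and u: "\<And>n. u n \<in> carrier H"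
    and conj: "\<And>n. h (Suc n) = u n \<otimes> h n \<otimes> inv (u n)"
    and comm: "\<And>x. x \<in> carrier H \<Longrightarrow>
      \<forall>\<^sub>F n in sequentially. x \<otimes> h n = h n \<otimes> x \<and> x \<otimes> u n = u n \<otimes> x"
    and x: "x \<in> carrier H"
  shows "\<forall>\<^sub>F n in sequentially. F (x \<otimes> h n) = F x * F (h 0)"
proof -
  interpret group H by fact
  note FK = K1D[OF Ext_K1[OF F]]
  have const: "\<exists>a. \<forall>\<^sub>F n in sequentially. F (y \<otimes> k n) = a"
    if y: "y \<in> carrier H" and k: "\<And>n. k n \<in> carrier H" "\<And>n. k (Suc n) = u n \<otimes> k n \<otimes> inv (u n)" for y k
  proof -
    obtain N where N: "\<And>n. n \<ge> N \<Longrightarrow> y \<otimes> u n = u n \<otimes> y"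
      using comm[OF y] by (auto simp: eventually_sequentially)
    have "F (y \<otimes> k (Suc n)) = F (y \<otimes> k n)" if "n \<ge> N" for n
    proof -
      have "y \<otimes> k (Suc n) = (y \<otimes> u n) \<otimes> k n \<otimes> inv (u n)"
        using y k u by (simp add: m_assoc)
      also have "\<dots> = u n \<otimes> (y \<otimes> k n) \<otimes> inv (u n)"
        using N[OF that] y k(1) u by (simp add: m_assoc)
      finally show ?thesis using FK(4)[of "y \<otimes> k n" "u n"] y k(1) u by simp
    qed
    note step = this
    have "F (y \<otimes> k n) = F (y \<otimes> k N)" if "n \<ge> N" for n
      using that by (induction n rule: dec_induct) (auto simp: step)
    then show ?thesis by (auto simp: eventually_sequentially)
  qed
  have hconj: "inv (h (Suc n)) = u n \<otimes> inv (h n) \<otimes> inv (u n)" for n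
    using h u by (simp add: conj inv_mult_group m_assoc)
  have "\<exists>a. \<forall>\<^sub>F n in sequentially. F (y \<otimes> h n) = a" if "y \<in> carrier H" for y
    by (rule const[OF that]) (use h conj in auto)
  then obtain A where A: "\<And>y. y \<in> carrier H \<Longrightarrow> \<forall>\<^sub>F n in sequentially. F (y \<otimes> h n) = A y"
    by metis
  have "\<exists>a. \<forall>\<^sub>F n in sequentially. F (y \<otimes> inv (h n)) = a" if "y \<in> carrier H" for y
    by (rule const[OF that]) (use h hconj in auto)
  then obtain B where B: "\<And>y. y \<in> carrier H \<Longrightarrow> \<forall>\<^sub>F n in sequentially. F (y \<otimes> inv (h n)) = B y"
    by metis
  have commi: "y \<otimes> inv (h n) = inv (h n) \<otimes> y" if "y \<otimes> h n = h n \<otimes> y" "y \<in> carrier H" for y n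
    using that h[of n] by (metis inv_closed inv_solve_left inv_solve_right m_assoc m_closed)
  have Fh: "F (h n) = F (h 0)" for n
    by (induction n) (use FK(4) h u conj in auto)
  have A1: "A \<one> = F (h 0)"
  proof -
    obtain n where "F (\<one> \<otimes> h n) = A \<one>"
      using eventually_happens'[OF sequentially_bot A[OF one_closed]] by blast
    then show ?thesis using Fh[of n] h[of n] by simp
  qed
  have B1: "B \<one> = cnj (F (h 0))"
  proof -
    obtain n where "F (\<one> \<otimes> inv (h n)) = B \<one>"
      using eventually_happens'[OF sequentially_bot B[OF one_closed]] by blast
    then show ?thesis
      using Fh[of n] h[of n] pos_def_on_inv[OF assms(1) FK(2) h[of n]] by simp
  qed
  have AB_conj: "A (c \<otimes> y \<otimes> inv c) = A y \<and> B (c \<otimes> y \<otimes> inv c) = B y"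
    if y: "y \<in> carrier H" and c: "c \<in> carrier H" for y c
  proof -
    have cy: "c \<otimes> y \<otimes> inv c \<in> carrier H" using y c by simp
    obtain n where n: "F (y \<otimes> h n) = A y" "F (y \<otimes> inv (h n)) = B y"
      "F (c \<otimes> y \<otimes> inv c \<otimes> h n) = A (c \<otimes> y \<otimes> inv c)"
      "F (c \<otimes> y \<otimes> inv c \<otimes> inv (h n)) = B (c \<otimes> y \<otimes> inv c)" "inv c \<otimes> h n = h n \<otimes> inv c"
      using eventually_happens'[OF sequentially_bot eventually_conj[OF A[OF y] eventually_conj[OF B[OF y]
        eventually_conj[OF A[OF cy] eventually_conj[OF B[OF cy] comm[OF inv_closed[OF c]]]]]]]
      by blast
    have *: "c \<otimes> y \<otimes> inv c \<otimes> k = c \<otimes> (y \<otimes> k) \<otimes> inv c"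
      if "inv c \<otimes> k = k \<otimes> inv c" "k \<in> carrier H" for k
      using that y c by (simp add: m_assoc)
    show ?thesis
      using n *[of "h n"] *[of "inv (h n)"] commi[of "inv c" n] FK(4)[of "y \<otimes> h n" c]
        FK(4)[of "y \<otimes> inv (h n)" c] y c h by simp
  qed
  define P where "P w y = (F y + (w * A y + cnj w * B y) / 2) / 2" for w y
  have pd: "pos_def_on H (P w)" if w: "w * cnj w = 1" for w
    unfolding pos_def_on_def
  proof (intro allI impI)
    fix n :: nat and g c assume "\<forall>i<n. g i \<in> carrier H"
    then have g: "g i \<in> carrier H" if "i < n" for i using that by blast
    have gg: "inv (g j) \<otimes> g i \<in> carrier H" if "i < n" "j < n" for i j using g that by simp
    have "\<forall>\<^sub>F k in sequentially. \<forall>i\<in>{..<n}. \<forall>j\<in>{..<n}. (inv (g j) \<otimes> g i) \<otimes> h k = h k \<otimes> (inv (g j) \<otimes> g i)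
       \<and> F ((inv (g j) \<otimes> g i) \<otimes> h k) = A (inv (g j) \<otimes> g i)
       \<and> F ((inv (g j) \<otimes> g i) \<otimes> inv (h k)) = B (inv (g j) \<otimes> g i)"
    proof (intro eventually_ball_finite ballI finite_lessThan)
      fix i j assume ij: "i \<in> {..<n}" "j \<in> {..<n}"
      then have gij: "inv (g j) \<otimes> g i \<in> carrier H" using gg by auto
      show "\<forall>\<^sub>F k in sequentially. (inv (g j) \<otimes> g i) \<otimes> h k = h k \<otimes> (inv (g j) \<otimes> g i)
       \<and> F ((inv (g j) \<otimes> g i) \<otimes> h k) = A (inv (g j) \<otimes> g i)
       \<and> F ((inv (g j) \<otimes> g i) \<otimes> inv (h k)) = B (inv (g j) \<otimes> g i)"
        using comm[OF gij] A[OF gij] B[OF gij] by eventually_elim simp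
    qed
    from eventually_happens'[OF sequentially_bot this] obtain k where k:
      "\<And>i j. i < n \<Longrightarrow> j < n \<Longrightarrow> (inv (g j) \<otimes> g i) \<otimes> h k = h k \<otimes> (inv (g j) \<otimes> g i)"
      "\<And>i j. i < n \<Longrightarrow> j < n \<Longrightarrow> F ((inv (g j) \<otimes> g i) \<otimes> h k) = A (inv (g j) \<otimes> g i)"
      "\<And>i j. i < n \<Longrightarrow> j < n \<Longrightarrow> F ((inv (g j) \<otimes> g i) \<otimes> inv (h k)) = B (inv (g j) \<otimes> g i)"
      by (metis lessThan_iff)
    \<comment> \<open>The Gram sum of the vectors \<open>c i (g i + w g i h k)\<close> is four times the one of \<open>P w\<close>.\<close>
    define G where "G = (\<lambda>(i::nat, b). if b then g i \<otimes> h k else g i)"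
    define C where "C = (\<lambda>(i::nat, b). if b then w * c i else c i)"
    let ?I = "{..<n} \<times> (UNIV :: bool set)"
    let ?T = "\<lambda>p q. C p * cnj (C q) * F (inv (G q) \<otimes> G p)"
    have "(\<Sum>p\<in>?I. \<Sum>q\<in>?I. ?T p q) \<in> \<real>\<^sub>\<ge>\<^sub>0"
      by (rule pos_def_on_sum[OF FK(2)]) (use g h in \<open>auto simp: G_def\<close>)
    also have "(\<Sum>p\<in>?I. \<Sum>q\<in>?I. ?T p q)
        = (\<Sum>i<n. \<Sum>j<n. ?T (i, False) (j, False) + ?T (i, False) (j, True)
             + (?T (i, True) (j, False) + ?T (i, True) (j, True)))"
      by (simp add: sum.cartesian_product' UNIV_bool sum.distrib add_ac)
    also have "\<dots> = (\<Sum>i<n. \<Sum>j<n. 4 * (c i * cnj (c j) * P w (inv (g j) \<otimes> g i)))"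
    proof (intro sum.cong HOL.refl)
      fix i j assume "i \<in> {..<n}" "j \<in> {..<n}"
      then have ij: "i < n" "j < n" by auto
      note k' = k[OF ij]
      have 1: "inv (g j) \<otimes> (g i \<otimes> h k) = inv (g j) \<otimes> g i \<otimes> h k"
        using g[OF ij(1)] g[OF ij(2)] h by (simp add: m_assoc)
      have 2: "inv (g j \<otimes> h k) \<otimes> g i = inv (g j) \<otimes> g i \<otimes> inv (h k)"
        using g[OF ij(1)] g[OF ij(2)] h commi[OF k'(1)] by (simp add: m_assoc inv_mult_group)
      have 3: "inv (g j \<otimes> h k) \<otimes> (g i \<otimes> h k) = inv (g j) \<otimes> g i"
      proof -
        have "inv (g j \<otimes> h k) \<otimes> (g i \<otimes> h k) = inv (h k) \<otimes> ((inv (g j) \<otimes> g i) \<otimes> h k)"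
          using g[OF ij(1)] g[OF ij(2)] h by (simp add: m_assoc inv_mult_group)
        also have "\<dots> = inv (g j) \<otimes> g i"
          unfolding k'(1) using g[OF ij(1)] g[OF ij(2)] h by (simp add: m_assoc[symmetric])
        finally show ?thesis .
      qed
      have 4: "w * c i * cnj (w * c j) = c i * cnj (c j)"
        using w by (simp add: mult_ac)
      show "?T (i, False) (j, False) + ?T (i, False) (j, True)
             + (?T (i, True) (j, False) + ?T (i, True) (j, True))
          = 4 * (c i * cnj (c j) * P w (inv (g j) \<otimes> g i))"
        unfolding G_def C_def prod.case if_True if_False 1 2 3 4 k'(2,3) P_def
        by (simp add: field_simps)
    qed
    finally have "of_real (1/4) * (\<Sum>i<n. \<Sum>j<n. 4 * (c i * cnj (c j) * P w (inv (g j) \<otimes> g i))) \<in> \<real>\<^sub>\<ge>\<^sub>0"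
      by (intro nonneg_Reals_mult_I) auto
    then show "(\<Sum>i<n. \<Sum>j<n. c i * cnj (c j) * P w (inv (g j) \<otimes> g i)) \<in> \<real>\<^sub>\<ge>\<^sub>0"
      by (simp add: sum_distrib_left)
  qed
  have dom: "P w x = P w \<one> * F x" if w: "w * cnj w = 1" for w
  proof (rule Ext_dominates[OF assms(1) F pd[OF w] pd[of "- w"] _ _ _ x])
    show "(- w) * cnj (- w) = 1" using w by simp
    show "P w y + P (- w) y = F y" for y by (simp add: P_def field_simps)
  qed (use AB_conj FK(4) in \<open>auto simp: P_def\<close>)
  have "A x = F x * F (h 0)"
    using dom[of 1] dom[of \<i>] by (simp add: P_def FK(3) A1 B1 field_simps) (simp add: complex_eq_iff algebra_simps)
  then show ?thesis using A[OF x] by simp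
qed

text \<open>The vector \<open>k\<^sub>1 + \<dots> + k\<^sub>N - N f h\<close> has a nonnegative square in the seminorm of \<open>f\<close>.\<close>

lemma pos_def_on_mean_bound:
  fixes H (structure)
  assumes "group H" and f: "f \<in> K1 H" and h: "h \<in> carrier H" and "0 < N"
    and k: "\<And>i. i < N \<Longrightarrow> \<exists>c\<in>carrier H. k i = c \<otimes> h \<otimes> inv c"
  shows "(cmod (f h))\<^sup>2 \<le> Re (\<Sum>i<N. \<Sum>j<N. f (inv (k j) \<otimes> k i)) / (real N)\<^sup>2"
proof -
  interpret group H by fact
  note fK = K1D[OF f]
  define a where "a = f h"
  have kc: "k i \<in> carrier H" and fk: "f (k i) = a" and fik: "f (inv (k i)) = cnj a" if "i < N" for i
  proof -
    show "k i \<in> carrier H" "f (k i) = a" using k[OF that] h fK(4) by (auto simp: a_def)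
    then show "f (inv (k i)) = cnj a" by (simp add: pos_def_on_inv[OF assms(1) fK(2)])
  qed
  let ?g = "\<lambda>i. if i < N then k i else \<one>"
  let ?c = "\<lambda>i. if i < N then 1 / of_nat N else - a"
  define S where "S = (\<Sum>i<N. \<Sum>j<N. f (inv (k j) \<otimes> k i))"
  have "(\<Sum>i<Suc N. \<Sum>j<Suc N. ?c i * cnj (?c j) * f (inv (?g j) \<otimes> ?g i)) \<in> \<real>\<^sub>\<ge>\<^sub>0"
    by (rule pos_def_on_sum[OF fK(2)]) (use kc in auto)
  also have "(\<Sum>i<Suc N. \<Sum>j<Suc N. ?c i * cnj (?c j) * f (inv (?g j) \<otimes> ?g i))
      = S / (of_nat N)\<^sup>2 - a * cnj a"
    using \<open>0 < N\<close> by (simp add: sum.distrib sum_subtractf kc fk fik fK(3) S_def sum_divide_distrib power2_eq_square)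
  also have "\<dots> = S / of_real ((real N)\<^sup>2) - of_real ((cmod a)\<^sup>2)"
    by (simp only: complex_norm_square) simp
  finally show ?thesis
    by (simp add: complex_nonneg_Reals_iff a_def S_def Re_divide_of_real del: of_real_power)
qed

lemma convex_cmod_square:
  assumes "b = of_real t * a1 + of_real (1 - t) * a2"
  shows "(cmod b)\<^sup>2 = t * (cmod a1)\<^sup>2 + (1 - t) * (cmod a2)\<^sup>2 - t * (1 - t) * (cmod (a1 - a2))\<^sup>2"
  unfolding assms cmod_power2 by (simp add: power2_eq_square algebra_simps)

text \<open>The vectors \<open>k i - f h\<close> are pairwise orthogonal for the inner product of \<open>f\<close>, so their mean is small
  when there are many of them.  It is then small for every function that \<open>f\<close> dominates, and by the
  preceding bounds such a function takes the same value at \<open>h\<close>.\<close>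

lemma Ext_if_orthogonal_conjugates:
  fixes H (structure)
  assumes "group H" and f: "f \<in> K1 H"
    and conj: "\<And>h N. h \<in> carrier H \<Longrightarrow> \<exists>k. (\<forall>i<N::nat. \<exists>c\<in>carrier H. k i = c \<otimes> h \<otimes> inv c) \<and>
      (\<forall>i<N. \<forall>j<N. i \<noteq> j \<longrightarrow> f (inv (k j) \<otimes> k i) = f h * cnj (f h))"
  shows "f \<in> Ext H"
proof -
  interpret group H by fact
  have main: "f1 h = f2 h"
    if f1: "f1 \<in> K1 H" and f2: "f2 \<in> K1 H" and t: "0 < t" "t < (1::real)"
      and eq: "\<And>x. x \<in> carrier H \<Longrightarrow> f x = of_real t * f1 x + of_real (1 - t) * f2 x"
      and h: "h \<in> carrier H" for f1 f2 t h
  proof -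
    have bound: "t * (1 - t) * (cmod (f1 h - f2 h))\<^sup>2 \<le> 1 / real N" if N: "0 < N" for N :: nat
    proof -
      obtain k where k: "\<And>i. i < N \<Longrightarrow> \<exists>c\<in>carrier H. k i = c \<otimes> h \<otimes> inv c"
        and ort: "\<And>i j. i < N \<Longrightarrow> j < N \<Longrightarrow> i \<noteq> j \<Longrightarrow> f (inv (k j) \<otimes> k i) = f h * cnj (f h)"
        using conj[OF h, of N] by blast
      have kc: "k i \<in> carrier H" if "i < N" for i using k[OF that] h by auto
      let ?S = "\<lambda>f. Re (\<Sum>i<N. \<Sum>j<N. f (inv (k j) \<otimes> k i))"
      let ?b = "(cmod (f h))\<^sup>2"
      have b1: "?b \<le> 1" using K1_norm_le_1[OF assms(1) f h] by (simp add: power_le_one)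
      have "?S f = t * ?S f1 + (1 - t) * ?S f2"
        using kc by (simp add: eq sum.distrib sum_distrib_left)
      moreover have "?S f = (\<Sum>i<N. \<Sum>j<N. if i = j then 1 else ?b)"
      proof -
        have "Re (f (inv (k j) \<otimes> k i)) = (if i = j then 1 else ?b)" if "i < N" "j < N" for i j
          using ort[OF that] kc[OF that(1)] K1D(3)[OF f]
          by (auto simp: complex_norm_square[symmetric] simp del: of_real_power)
        then show ?thesis by simp
      qed
      moreover have "(\<Sum>i<N. \<Sum>j<N. if i = j then 1 else ?b) = (real N)\<^sup>2 * ?b + real N * (1 - ?b)"
      proof -
        have "(\<Sum>j<N. if i = j then 1 else ?b) = real N * ?b + (1 - ?b)" if "i < N" for i
        proof -
          have "(\<Sum>j<N. if i = j then 1 else ?b) = (\<Sum>j<N. ?b + (if i = j then 1 - ?b else 0))"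
            by (intro sum.cong) auto
          also have "\<dots> = real N * ?b + (1 - ?b)" using that by (simp add: sum.distrib)
          finally show ?thesis .
        qed
        then have "(\<Sum>i<N. \<Sum>j<N. if i = j then 1 else ?b) = (\<Sum>i<N. real N * ?b + (1 - ?b))" by simp
        then show ?thesis by (simp add: power2_eq_square algebra_simps)
      qed
      ultimately have "t * ?S f1 + (1 - t) * ?S f2 = (real N)\<^sup>2 * ?b + real N * (1 - ?b)" by linarith
      moreover have "t * (?S f1 / (real N)\<^sup>2) + (1 - t) * (?S f2 / (real N)\<^sup>2)
          = (t * ?S f1 + (1 - t) * ?S f2) / (real N)\<^sup>2"
        by (simp only: add_divide_distrib times_divide_eq_right)
      moreover have "((real N)\<^sup>2 * ?b + real N * (1 - ?b)) / (real N)\<^sup>2 = ?b + (1 - ?b) / real N"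
        using N by (simp add: power2_eq_square field_simps)
      ultimately have S: "t * (?S f1 / (real N)\<^sup>2) + (1 - t) * (?S f2 / (real N)\<^sup>2) = ?b + (1 - ?b) / real N"
        by simp
      have "t * (cmod (f1 h))\<^sup>2 + (1 - t) * (cmod (f2 h))\<^sup>2
          \<le> t * (?S f1 / (real N)\<^sup>2) + (1 - t) * (?S f2 / (real N)\<^sup>2)"
        using t pos_def_on_mean_bound[OF assms(1) f1 h N k] pos_def_on_mean_bound[OF assms(1) f2 h N k]
        by (intro add_mono mult_left_mono) auto
      then have "t * (1 - t) * (cmod (f1 h - f2 h))\<^sup>2 \<le> (1 - ?b) / real N"
        using S convex_cmod_square[OF eq[OF h]] by linarith
      also have "\<dots> \<le> 1 / real N" by (intro divide_right_mono) auto
      finally show ?thesis .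
    qed
    have "t * (1 - t) * (cmod (f1 h - f2 h))\<^sup>2 \<le> 0"
    proof (rule ccontr)
      assume "\<not> ?thesis"
      then obtain n :: nat where "inverse (of_nat (Suc n)) < t * (1 - t) * (cmod (f1 h - f2 h))\<^sup>2"
        using reals_Archimedean[of "t * (1 - t) * (cmod (f1 h - f2 h))\<^sup>2"] by auto
      then show False using bound[of "Suc n"] by (simp add: inverse_eq_divide)
    qed
    then have "(cmod (f1 h - f2 h))\<^sup>2 \<le> 0"
      using t by (simp add: mult_le_0_iff)
    then show ?thesis by simp
  qed
  show ?thesis
    unfolding Ext_def
  proof (intro CollectI conjI[OF f] ballI allI impI)
    fix f1 f2 and t :: real
    assume f12: "f1 \<in> K1 H" "f2 \<in> K1 H" and "0 < t \<and> t < 1 \<and>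
      (\<forall>x\<in>carrier H. f x = of_real t * f1 x + of_real (1 - t) * f2 x)"
    then have t: "0 < t" "t < 1"
      and dec: "\<And>x. x \<in> carrier H \<Longrightarrow> f x = of_real t * f1 x + of_real (1 - t) * f2 x" by auto
    have eq: "f1 x = f2 x \<and> f x = f1 x" if x: "x \<in> carrier H" for x
    proof -
      have "f1 x = f2 x" by (rule main[OF f12 t dec x])
      then show ?thesis using dec[OF x] by (simp add: algebra_simps)
    qed
    have "f1 = f" by (rule K1_eqI[OF f12(1) f]) (use eq in auto)
    moreover have "f2 = f" by (rule K1_eqI[OF f12(2) f]) (use eq in auto)
    ultimately show "f1 = f \<and> f2 = f" ..
  qed
qed

text \<open>Each new conjugate is chosen far away from those already chosen; the reversed products are
  inverses, which have conjugate values.\<close>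

lemma orthogonal_conjugates:
  fixes H (structure)
  assumes "group H" and F: "F \<in> K1 H" and h: "\<And>n::nat. h n \<in> carrier H"
    and mult: "\<And>x. x \<in> carrier H \<Longrightarrow> \<forall>\<^sub>F n in sequentially. F (x \<otimes> h n) = F x * b"
    and b: "\<And>n. F (h n) = b"
  shows "\<exists>k::nat \<Rightarrow> nat. \<forall>i<N. \<forall>j<N. i \<noteq> j \<longrightarrow> F (inv (h (k j)) \<otimes> h (k i)) = b * cnj b"
proof (induction N)
  case (Suc N)
  interpret group H by fact
  note FK = K1D[OF F]
  obtain k where k: "\<And>i j. i < N \<Longrightarrow> j < N \<Longrightarrow> i \<noteq> j \<Longrightarrow> F (inv (h (k j)) \<otimes> h (k i)) = b * cnj b"
    using Suc by blast
  have "\<forall>\<^sub>F n in sequentially. \<forall>j\<in>{..<N}. F (inv (h (k j)) \<otimes> h n) = F (inv (h (k j))) * b"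
    by (intro eventually_ball_finite ballI mult) (use h in auto)
  from eventually_happens'[OF sequentially_bot this] obtain n where n:
    "\<And>j. j < N \<Longrightarrow> F (inv (h (k j)) \<otimes> h n) = b * cnj b"
    using b h by (auto simp: pos_def_on_inv[OF assms(1) FK(2)] mult.commute)
  have n': "F (inv (h n) \<otimes> h (k j)) = b * cnj b" if "j < N" for j
  proof -
    have "inv (h n) \<otimes> h (k j) = inv (inv (h (k j)) \<otimes> h n)" using h by (simp add: inv_mult_group)
    then show ?thesis using pos_def_on_inv[OF assms(1) FK(2), of "inv (h (k j)) \<otimes> h n"] n[OF that] h
      by simp
  qed
  show ?case
    by (rule exI[of _ "k(N := n)"]) (use k n n' in \<open>auto simp: less_Suc_eq\<close>)
qed auto

text \<open>The class functions on \<open>H\<close> that extend \<open>f\<close> form a compact convex set, on which the strictly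
  convex continuous function \<open>F \<mapsto> \<Sum> 2\<^sup>-\<^sup>n \<bar>F (e n)\<bar>\<^sup>2\<close> has a maximum, necessarily at an extreme
  point; since \<open>f\<close> is extremal, this set is a face of \<open>K1 H\<close>.\<close>

lemma Ext_extension:
  fixes H (structure)
  assumes "group H" and count: "countable (carrier H)" and L: "subgroup L H"
    and f: "f \<in> Ext (H\<lparr>carrier := L\<rparr>)" and F0: "F0 \<in> K1 H" "restrict F0 L = f"
  shows "\<exists>F\<in>Ext H. restrict F L = f"
proof -
  interpret group H by fact
  interpret L: subgroup L H by fact
  define V where "V = {F \<in> K1 H. restrict F L = f}"
  \<comment> \<open>Outside the carrier the value is prescribed, so that the product of the sets \<open>S x\<close> over the whole
    type is compact and contains all extensional functions bounded by 1 on the carrier.\<close>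
  define S where "S x = (if x \<in> carrier H then cball (0::complex) 1 else {undefined})" for x
  have "compactin (product_topology (\<lambda>_. euclidean) UNIV) (PiE UNIV S)"
    by (auto simp: compactin_PiE S_def)
  then have compB: "compact (PiE UNIV S)"
    by (simp add: euclidean_product_topology)
  have ev: "continuous_on UNIV (\<lambda>F::'a \<Rightarrow> complex. F x)" for x by simp
  define W where "W = (\<Inter>(n::nat, g, c)\<in>{(n, g, c). \<forall>i<n. g i \<in> carrier H}.
        (\<lambda>F. \<Sum>i<n. \<Sum>j<n. c i * cnj (c j) * F (inv (g j) \<otimes> g i)) -` \<real>\<^sub>\<ge>\<^sub>0)
      \<inter> (\<Inter>x\<in>carrier H. \<Inter>h\<in>carrier H. {F. F (h \<otimes> x \<otimes> inv h) = F x})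
      \<inter> {F. F \<one> = 1} \<inter> (\<Inter>x\<in>L. {F. F x = f x})"
  have VB: "V = PiE UNIV S \<inter> W"
  proof (intro equalityI subsetI)
    fix F assume "F \<in> V"
    then have FK: "F \<in> K1 H" and "restrict F L = f" by (auto simp: V_def)
    then have "F x = f x" if "x \<in> L" for x using that by auto
    then show "F \<in> PiE UNIV S \<inter> W"
      using K1D[OF FK] K1_norm_le_1[OF assms(1) FK]
      by (auto simp: S_def W_def pos_def_on_def extensional_def)
  next
    fix F assume W: "F \<in> PiE UNIV S \<inter> W"
    have "F \<in> extensional (carrier H)"
      unfolding extensional_def
    proof (intro CollectI allI impI)
      fix x assume "x \<notin> carrier H"
      then have "S x = {undefined}" by (simp add: S_def)
      then show "F x = undefined" using W by (auto simp: PiE_iff)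
    qed
    moreover have "restrict F L = f"
    proof (rule extensionalityI[of _ L])
      show "f \<in> extensional L" using K1D(1)[OF Ext_K1[OF f]] by simp
    qed (use W in \<open>auto simp: W_def\<close>)
    ultimately show "F \<in> V"
      using W by (auto simp: V_def K1_def pos_def_on_def W_def)
  qed
  have cont: "continuous_on UNIV (\<lambda>F::'a \<Rightarrow> complex. \<Sum>i<n. \<Sum>j<n. c i * cnj (c j) * F (inv (g j) \<otimes> g i))"
    for n :: nat and g c
    by (intro continuous_on_sum continuous_on_mult continuous_on_const ev)
  have "closed W"
    unfolding W_def using closed_vimage[OF closed_nonneg_Reals_complex cont]
    by (intro closed_Int closed_INT ballI closed_Collect_eq[OF ev ev]
        closed_Collect_eq[OF ev continuous_on_const]) (simp add: case_prod_beta)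
  then have compV: "compact V"
    using compact_Int_closed[OF compB] VB by simp
  have Vne: "V \<noteq> {}" using F0 by (auto simp: V_def)
  define e where "e = from_nat_into (carrier H)"
  have e: "e n \<in> carrier H" for n unfolding e_def by (intro from_nat_into) auto
  have e_surj: "\<exists>n. e n = x" if "x \<in> carrier H" for x
    using from_nat_into_surj[OF count that] by (simp add: e_def)
  define \<phi> where "\<phi> F = (\<Sum>n. (1/2)^n * (cmod (F (e n)))\<^sup>2)" for F :: "'a \<Rightarrow> complex"
  have half: "summable (\<lambda>n. (1/2::real)^n)" by (simp add: summable_geometric)
  have term_le: "(1/2)^n * (cmod (F (e n)))\<^sup>2 \<le> (1/2)^n" if "F \<in> K1 H" for F n
    using K1_norm_le_1[OF assms(1) that e[of n]] by (simp add: power_le_one mult_left_le)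
  have summ: "summable (\<lambda>n. (1/2)^n * (cmod (F (e n)))\<^sup>2)" if "F \<in> K1 H" for F
    by (rule summable_comparison_test'[OF half, of 0]) (use term_le[OF that] in auto)
  have "continuous_on V \<phi>"
  proof (rule uniform_limit_theorem)
    show "uniform_limit V (\<lambda>n F. \<Sum>i<n. (1/2)^i * (cmod (F (e i)))\<^sup>2) \<phi> sequentially"
      unfolding \<phi>_def
      by (rule Weierstrass_m_test[OF _ half]) (use term_le in \<open>auto simp: V_def\<close>)
    show "\<forall>\<^sub>F n in sequentially. continuous_on V (\<lambda>F. \<Sum>i<n. (1/2)^i * (cmod (F (e i)))\<^sup>2)"
      by (intro always_eventually allI continuous_on_sum continuous_on_mult continuous_on_const
          continuous_on_power continuous_on_norm continuous_on_subset[OF ev subset_UNIV])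
  qed auto
  from continuous_attains_sup[OF compV Vne this] obtain F
    where F: "F \<in> V" and Fmax: "\<And>F'. F' \<in> V \<Longrightarrow> \<phi> F' \<le> \<phi> F" by auto
  have FK: "F \<in> K1 H" and FL: "restrict F L = f" using F by (auto simp: V_def)
  have "F \<in> Ext H"
    unfolding Ext_def
  proof (intro CollectI conjI[OF FK] ballI allI impI)
    fix F1 F2 and t :: real
    assume F12: "F1 \<in> K1 H" "F2 \<in> K1 H" and "0 < t \<and> t < 1 \<and>
      (\<forall>x\<in>carrier H. F x = of_real t * F1 x + of_real (1 - t) * F2 x)"
    then have t: "0 < t" "t < 1"
      and eq: "\<And>x. x \<in> carrier H \<Longrightarrow> F x = of_real t * F1 x + of_real (1 - t) * F2 x" by auto
    have "restrict F1 L = f" "restrict F2 L = f"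
      using ExtD[OF f K1_restrict[OF assms(1) L F12(1)] K1_restrict[OF assms(1) L F12(2)] t]
        eq FL by auto
    then have V12: "F1 \<in> V" "F2 \<in> V" using F12 by (auto simp: V_def)
    let ?q = "\<lambda>F n. (1/2)^n * (cmod (F (e n)))\<^sup>2"
    define w where "w n = t * ?q F1 n + (1 - t) * ?q F2 n - ?q F n" for n
    have w: "w n = (1/2)^n * (t * (1 - t) * (cmod (F1 (e n) - F2 (e n)))\<^sup>2)" for n
      unfolding w_def convex_cmod_square[OF eq[OF e]] by (simp add: algebra_simps)
    have q: "?q F' sums \<phi> F'" if "F' \<in> K1 H" for F'
      unfolding \<phi>_def by (rule summable_sums[OF summ[OF that]])
    have "w sums (t * \<phi> F1 + (1 - t) * \<phi> F2 - \<phi> F)"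
      unfolding w_def by (intro sums_diff sums_add sums_mult q F12 FK)
    then have wsum: "summable w" and "(\<Sum>n. w n) = t * \<phi> F1 + (1 - t) * \<phi> F2 - \<phi> F"
      by (auto simp: sums_iff)
    moreover have "t * \<phi> F1 + (1 - t) * \<phi> F2 \<le> t * \<phi> F + (1 - t) * \<phi> F"
      using t Fmax V12 by (intro add_mono mult_left_mono) auto
    ultimately have "(\<Sum>n. w n) \<le> 0" by (simp add: algebra_simps)
    moreover have w0: "0 \<le> w n" for n using t by (simp add: w)
    ultimately have "w n = 0" for n
      using suminf_eq_zero_iff[OF wsum w0] suminf_nonneg[OF wsum w0] by (metis order_antisym)
    then have "F1 (e n) = F2 (e n)" for n using t by (simp add: w)
    have eq12: "F1 x = F2 x \<and> F x = F1 x" if "x \<in> carrier H" for x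
    proof -
      have "F1 x = F2 x" using e_surj[OF that] \<open>\<And>n. F1 (e n) = F2 (e n)\<close> by auto
      then show ?thesis using eq[OF that] by (simp add: algebra_simps)
    qed
    have "F1 = F" by (rule K1_eqI[OF F12(1) FK]) (use eq12 in auto)
    moreover have "F2 = F" by (rule K1_eqI[OF F12(2) FK]) (use eq12 in auto)
    ultimately show "F1 = F \<and> F2 = F" ..
  qed
  then show ?thesis using FL by blast
qed

section \<open>The group $G(m,1,\infty)$\<close>

abbreviation swap :: "nat \<Rightarrow> nat \<Rightarrow> nat \<Rightarrow> nat" where "swap \<equiv> Transposition.transpose"

lemma Sinf_iff: "\<sigma> \<in> Sinf \<longleftrightarrow> bij \<sigma> \<and> \<sigma> 0 = 0 \<and> finite {i. \<sigma> i \<noteq> i}"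
proof -
  have "\<sigma> permutes {1..} \<longleftrightarrow> bij \<sigma> \<and> \<sigma> 0 = 0"
  proof
    assume "\<sigma> permutes {1..}"
    then show "bij \<sigma> \<and> \<sigma> 0 = 0" by (auto simp: permutes_bij permutes_not_in)
  next
    assume "bij \<sigma> \<and> \<sigma> 0 = 0"
    then show "\<sigma> permutes {1..}"
      by (auto simp: permutes_def bij_iff not_le)
  qed
  then show ?thesis by (auto simp: Sinf_def)
qed

lemma Sinf_id [simp]: "id \<in> Sinf"
  by (simp add: Sinf_iff)

lemma Sinf_comp:
  assumes "\<sigma> \<in> Sinf" "\<tau> \<in> Sinf" shows "\<sigma> \<circ> \<tau> \<in> Sinf"
proof -
  have "{i. (\<sigma> \<circ> \<tau>) i \<noteq> i} \<subseteq> {i. \<sigma> i \<noteq> i} \<union> {i. \<tau> i \<noteq> i}" by auto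
  then show ?thesis using assms finite_subset by (auto simp: Sinf_iff intro: bij_comp)
qed

lemma Sinf_inv:
  assumes "\<sigma> \<in> Sinf" shows "Hilbert_Choice.inv \<sigma> \<in> Sinf"
proof -
  have b: "bij \<sigma>" using assms by (simp add: Sinf_iff)
  have eq: "{i. Hilbert_Choice.inv \<sigma> i \<noteq> i} = {i. \<sigma> i \<noteq> i}"
    using b by (metis bij_inv_eq_iff)
  have "Hilbert_Choice.inv \<sigma> 0 = 0"
    using assms b by (metis Sinf_iff bij_inv_eq_iff)
  then show ?thesis using assms b unfolding Sinf_iff eq by (simp add: bij_imp_bij_inv)
qed

lemma Sinf_permutation: "\<sigma> \<in> Sinf \<Longrightarrow> permutation \<sigma>"
  by (simp add: Sinf_iff permutation)

lemma Sinf_pos: "\<sigma> \<in> Sinf \<Longrightarrow> 1 \<le> \<sigma> i \<longleftrightarrow> 1 \<le> i"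
  by (metis Sinf_iff bij_inv_eq_iff less_one not_le)

lemma Sinf_evenperm_comp:
  "\<sigma> \<in> Sinf \<Longrightarrow> \<tau> \<in> Sinf \<Longrightarrow> evenperm (\<sigma> \<circ> \<tau>) \<longleftrightarrow> evenperm \<sigma> = evenperm \<tau>"
  by (simp add: evenperm_comp Sinf_permutation)

lemma carrier_Dinf:
  assumes "m > 0"
  shows "d \<in> carrier (Dinf m) \<longleftrightarrow>
    d \<in> extensional {1..} \<and> (\<forall>i\<ge>1. 0 \<le> d i \<and> d i < int m) \<and> finite {i. 1 \<le> i \<and> d i \<noteq> 0}"
  using assms
  by (auto simp: Dinf_def carrier_sum_group carrier_integer_mod_group PiE_iff)

lemma mult_Dinf: "d \<otimes>\<^bsub>Dinf m\<^esub> d' = (\<lambda>i\<in>{1..}. (d i + d' i) mod int m)"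
  by (simp add: Dinf_def)

lemma one_Dinf: "\<one>\<^bsub>Dinf m\<^esub> = (\<lambda>i\<in>{1..}. 0)"
  by (simp add: Dinf_def)

lemma group_Dinf: "group (Dinf m)"
  by (simp add: Dinf_def)

lemma mult_Ginf: "(d, \<sigma>) \<otimes>\<^bsub>Ginf m\<^esub> (d', \<sigma>') = (d \<otimes>\<^bsub>Dinf m\<^esub> perm_act \<sigma> d', \<sigma> \<circ> \<sigma>')"
  by (simp add: Ginf_def)

lemma one_Ginf: "\<one>\<^bsub>Ginf m\<^esub> = (\<one>\<^bsub>Dinf m\<^esub>, id)"
  by (simp add: Ginf_def)

lemma carrier_Ginf: "carrier (Ginf m) = carrier (Dinf m) \<times> Sinf"
  by (simp add: Ginf_def)

definition gsupp :: "(nat \<Rightarrow> int) \<times> (nat \<Rightarrow> nat) \<Rightarrow> nat set" where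
  "gsupp g = {i. 1 \<le> i \<and> fst g i \<noteq> 0} \<union> {i. snd g i \<noteq> i}"

text \<open>The involution that interchanges the blocks \<open>{n N + 1..n N + N}\<close> and
  \<open>{(n + 1) N + 1..(n + 1) N + N}\<close> of consecutive integers.\<close>

definition block_swap :: "nat \<Rightarrow> nat \<Rightarrow> nat \<Rightarrow> nat" where
  "block_swap N n i =
     (if n * N < i \<and> i \<le> n * N + N then i + N
      else if n * N + N < i \<and> i \<le> n * N + N + N then i - N else i)"

lemma block_swap_Sinf: "block_swap N n \<in> Sinf"
proof -
  have "block_swap N n \<circ> block_swap N n = id"
    by (auto simp: block_swap_def fun_eq_iff)
  then have "bij (block_swap N n)" by (rule o_bij) (auto simp: block_swap_def fun_eq_iff)
  moreover have "{i. block_swap N n i \<noteq> i} \<subseteq> {..n * N + N + N}" by (auto simp: block_swap_def)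
  ultimately show ?thesis
    using finite_subset[OF _ finite_atMost] by (simp add: Sinf_iff) (simp add: block_swap_def)
qed

context
  fixes m :: nat
  assumes m0: "m > 0"
begin

lemma perm_act_closed:
  assumes "\<sigma> \<in> Sinf" "d \<in> carrier (Dinf m)"
  shows "perm_act \<sigma> d \<in> carrier (Dinf m)"
proof -
  note s = Sinf_pos[OF Sinf_inv[OF assms(1)]]
  have "{i. 1 \<le> i \<and> d (Hilbert_Choice.inv \<sigma> i) \<noteq> 0} \<subseteq> \<sigma> ` {i. 1 \<le> i \<and> d i \<noteq> 0}"
  proof
    fix i assume "i \<in> {i. 1 \<le> i \<and> d (Hilbert_Choice.inv \<sigma> i) \<noteq> 0}"
    moreover have "i = \<sigma> (Hilbert_Choice.inv \<sigma> i)" using assms(1) by (simp add: Sinf_iff bij_is_surj surj_f_inv_f)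
    ultimately show "i \<in> \<sigma> ` {i. 1 \<le> i \<and> d i \<noteq> 0}" using s[of i] by auto
  qed
  then have "finite {i. 1 \<le> i \<and> d (Hilbert_Choice.inv \<sigma> i) \<noteq> 0}"
    using assms(2) m0 by (auto simp: carrier_Dinf intro: finite_surj)
  moreover have "{i. 1 \<le> i \<and> perm_act \<sigma> d i \<noteq> 0} = {i. 1 \<le> i \<and> d (Hilbert_Choice.inv \<sigma> i) \<noteq> 0}"
    by (auto simp: perm_act_def)
  ultimately show ?thesis
    using assms(2) m0 s by (simp add: carrier_Dinf perm_act_def)
qed

lemma perm_act_mult:
  assumes "\<sigma> \<in> Sinf"
  shows "perm_act \<sigma> (d \<otimes>\<^bsub>Dinf m\<^esub> d') = perm_act \<sigma> d \<otimes>\<^bsub>Dinf m\<^esub> perm_act \<sigma> d'"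
  using Sinf_pos[OF Sinf_inv[OF assms]] by (auto simp: perm_act_def mult_Dinf restrict_def fun_eq_iff)

lemma perm_act_one: "\<sigma> \<in> Sinf \<Longrightarrow> perm_act \<sigma> \<one>\<^bsub>Dinf m\<^esub> = \<one>\<^bsub>Dinf m\<^esub>"
  using Sinf_pos[OF Sinf_inv] by (auto simp: perm_act_def one_Dinf restrict_def fun_eq_iff)

lemma perm_act_comp:
  assumes "\<sigma> \<in> Sinf" "\<tau> \<in> Sinf"
  shows "perm_act (\<sigma> \<circ> \<tau>) d = perm_act \<sigma> (perm_act \<tau> d)"
  using assms Sinf_pos[OF Sinf_inv[OF assms(1)]]
  by (auto simp: perm_act_def restrict_def fun_eq_iff o_inv_distrib Sinf_iff)

lemma perm_act_id: "d \<in> carrier (Dinf m) \<Longrightarrow> perm_act id d = d"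
  using m0 by (auto simp: perm_act_def carrier_Dinf restrict_def fun_eq_iff extensional_def)

lemma group_Ginf: "group (Ginf m)"
proof -
  interpret D: group "Dinf m" by (rule group_Dinf)
  show ?thesis
  proof (rule groupI)
    fix x y assume "x \<in> carrier (Ginf m)" "y \<in> carrier (Ginf m)"
    then show "x \<otimes>\<^bsub>Ginf m\<^esub> y \<in> carrier (Ginf m)"
      by (auto simp: carrier_Ginf mult_Ginf perm_act_closed Sinf_comp)
  next
    fix x y z assume "x \<in> carrier (Ginf m)" "y \<in> carrier (Ginf m)" "z \<in> carrier (Ginf m)"
    then show "x \<otimes>\<^bsub>Ginf m\<^esub> y \<otimes>\<^bsub>Ginf m\<^esub> z = x \<otimes>\<^bsub>Ginf m\<^esub> (y \<otimes>\<^bsub>Ginf m\<^esub> z)"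
      by (auto simp: carrier_Ginf mult_Ginf perm_act_closed perm_act_mult perm_act_comp D.m_assoc comp_assoc)
  next
    fix x assume x: "x \<in> carrier (Ginf m)"
    then show "\<one>\<^bsub>Ginf m\<^esub> \<otimes>\<^bsub>Ginf m\<^esub> x = x"
      by (auto simp: carrier_Ginf mult_Ginf one_Ginf perm_act_id)
    obtain d \<sigma> where [simp]: "x = (d, \<sigma>)" and d: "d \<in> carrier (Dinf m)" "\<sigma> \<in> Sinf"
      using x by (auto simp: carrier_Ginf)
    let ?i = "Hilbert_Choice.inv \<sigma>"
    have "(perm_act ?i (inv\<^bsub>Dinf m\<^esub> d), ?i) \<otimes>\<^bsub>Ginf m\<^esub> x = \<one>\<^bsub>Ginf m\<^esub>"
      using d by (simp add: mult_Ginf one_Ginf perm_act_mult[symmetric] perm_act_one Sinf_inv)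
         (simp add: Sinf_iff bij_is_inj)
    moreover have "(perm_act ?i (inv\<^bsub>Dinf m\<^esub> d), ?i) \<in> carrier (Ginf m)"
      using d by (simp add: carrier_Ginf perm_act_closed Sinf_inv)
    ultimately show "\<exists>y\<in>carrier (Ginf m). y \<otimes>\<^bsub>Ginf m\<^esub> x = \<one>\<^bsub>Ginf m\<^esub>" by blast
  qed (auto simp: carrier_Ginf one_Ginf)
qed

lemma inv_Ginf_perm:
  assumes "\<sigma> \<in> Sinf"
  shows "inv\<^bsub>Ginf m\<^esub> (\<one>\<^bsub>Dinf m\<^esub>, \<sigma>) = (\<one>\<^bsub>Dinf m\<^esub>, Hilbert_Choice.inv \<sigma>)"
proof -
  interpret group "Ginf m" by (rule group_Ginf)
  interpret D: group "Dinf m" by (rule group_Dinf)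
  have "Hilbert_Choice.inv \<sigma> \<circ> \<sigma> = id" using assms by (simp add: Sinf_iff bij_is_inj)
  then show ?thesis
    by (intro inv_equality)
      (use assms Sinf_inv[OF assms] in \<open>simp_all add: mult_Ginf one_Ginf perm_act_one carrier_Ginf\<close>)
qed

lemma countable_Ginf: "countable (carrier (Ginf m))"
proof -
  have "Sinf \<subseteq> (\<Union>n. {\<sigma>. \<sigma> permutes {..n}})"
  proof
    fix \<sigma> assume s: "\<sigma> \<in> Sinf"
    then have "\<exists>n. {i. \<sigma> i \<noteq> i} \<subseteq> {..n}" by (simp add: Sinf_iff finite_nat_iff_bounded_le)
    then obtain n where n: "{i. \<sigma> i \<noteq> i} \<subseteq> {..n}" by blast
    have "\<sigma> permutes {..n}"
      unfolding permutes_def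
    proof
      show "\<forall>x. x \<notin> {..n} \<longrightarrow> \<sigma> x = x" using n by blast
      show "\<forall>y. \<exists>!x. \<sigma> x = y" using s by (simp add: Sinf_iff bij_iff)
    qed
    then show "\<sigma> \<in> (\<Union>n. {\<sigma>. \<sigma> permutes {..n}})" by auto
  qed
  moreover have "countable (\<Union>n. {\<sigma>. \<sigma> permutes {..n::nat}})"
    by (rule countable_UN) (auto intro: countable_finite finite_permutations)
  ultimately have 1: "countable Sinf" by (rule countable_subset)
  define E where "E n = (\<lambda>e. \<lambda>i\<in>{1..}. if i \<le> n then e i else 0) ` (PiE {..n} (\<lambda>_. {0..<int m}))" for n :: nat
  have "carrier (Dinf m) \<subseteq> (\<Union>n. E n)"
  proof
    fix d assume d: "d \<in> carrier (Dinf m)"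
    then have "finite {i. 1 \<le> i \<and> d i \<noteq> 0}" using m0 by (simp add: carrier_Dinf)
    then obtain n where n: "\<And>i. 1 \<le> i \<Longrightarrow> d i \<noteq> 0 \<Longrightarrow> i \<le> n"
      by (metis (mono_tags, lifting) finite_nat_set_iff_bounded_le mem_Collect_eq)
    define e where "e = (\<lambda>i\<in>{..n}. if i = 0 then 0 else d i)"
    have "e \<in> PiE {..n} (\<lambda>_. {0..<int m})"
      using d m0 by (auto simp: e_def carrier_Dinf)
    moreover have "d = (\<lambda>i\<in>{1..}. if i \<le> n then e i else 0)"
    proof
      fix i
      have "d i = 0" if "n < i" using n[of i] that by fastforce
      then show "d i = (\<lambda>i\<in>{1..}. if i \<le> n then e i else 0) i"
        using d m0 by (auto simp: e_def carrier_Dinf extensional_def)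
    qed
    ultimately show "d \<in> (\<Union>n. E n)" by (auto simp: E_def)
  qed
  moreover have "countable (\<Union>n. E n)"
    unfolding E_def
    by (rule countable_UN) (auto intro!: countable_finite finite_imageI finite_PiE)
  ultimately have 2: "countable (carrier (Dinf m))" by (rule countable_subset)
  show ?thesis using 1 2 by (simp add: carrier_Ginf)
qed

subsection \<open>Supports\<close>

lemma finite_gsupp: "g \<in> carrier (Ginf m) \<Longrightarrow> finite (gsupp g)"
  using m0 by (auto simp: gsupp_def carrier_Ginf carrier_Dinf Sinf_iff)

lemma gsupp_pos: "g \<in> carrier (Ginf m) \<Longrightarrow> gsupp g \<subseteq> {1..}"
  by (auto simp: gsupp_def carrier_Ginf Sinf_iff Suc_le_eq intro: gr0I)

text \<open>Each factor fixes the support of the other one pointwise, and therefore acts trivially on its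
  component in \<open>Dinf m\<close>.\<close>

lemma disjoint_gsupp_commute:
  assumes g: "g \<in> carrier (Ginf m)" and h: "h \<in> carrier (Ginf m)" and disj: "gsupp g \<inter> gsupp h = {}"
  shows "g \<otimes>\<^bsub>Ginf m\<^esub> h = h \<otimes>\<^bsub>Ginf m\<^esub> g"
proof -
  obtain d \<sigma> where g': "g = (d, \<sigma>)" and d: "d \<in> carrier (Dinf m)" "\<sigma> \<in> Sinf"
    using g by (auto simp: carrier_Ginf)
  obtain e \<tau> where h': "h = (e, \<tau>)" and e: "e \<in> carrier (Dinf m)" "\<tau> \<in> Sinf"
    using h by (auto simp: carrier_Ginf)
  have inv_fixed: "b (Hilbert_Choice.inv \<rho> i) = b i"
    if r: "\<rho> \<in> Sinf" and b: "\<And>i. 1 \<le> i \<Longrightarrow> b i \<noteq> 0 \<Longrightarrow> \<rho> i = i" and i: "1 \<le> i"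
    for \<rho> i and b :: "nat \<Rightarrow> int"
  proof (cases "\<rho> i = i")
    case True
    then have "Hilbert_Choice.inv \<rho> i = i" using r by (metis Sinf_iff bij_inv_eq_iff)
    then show ?thesis by simp
  next
    case False
    let ?j = "Hilbert_Choice.inv \<rho> i"
    have j: "\<rho> ?j = i" using r by (simp add: Sinf_iff bij_is_surj surj_f_inv_f)
    then have "\<rho> ?j \<noteq> ?j" using False by auto
    moreover have "1 \<le> ?j" using Sinf_pos[OF Sinf_inv[OF r], of i] i by simp
    ultimately have "b ?j = 0" "b i = 0" using b i False by blast+
    then show ?thesis by simp
  qed
  have 1: "e (Hilbert_Choice.inv \<sigma> i) = e i" if "1 \<le> i" for i
    by (rule inv_fixed[OF d(2) _ that]) (use disj g' h' in \<open>auto simp: gsupp_def\<close>)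
  have 2: "d (Hilbert_Choice.inv \<tau> i) = d i" if "1 \<le> i" for i
    by (rule inv_fixed[OF e(2) _ that]) (use disj g' h' in \<open>auto simp: gsupp_def\<close>)
  have "\<sigma> (\<tau> i) = \<tau> (\<sigma> i)" for i
  proof -
    have dj: "\<sigma> k = k \<or> \<tau> k = k" for k using disj g' h' by (auto simp: gsupp_def)
    have "inj \<sigma>" "inj \<tau>" using d e by (auto simp: Sinf_iff bij_is_inj)
    then show ?thesis using dj[of i] dj[of "\<sigma> i"] dj[of "\<tau> i"] by (metis injD)
  qed
  then have "\<sigma> \<circ> \<tau> = \<tau> \<circ> \<sigma>" by (simp add: fun_eq_iff)
  then show ?thesis
    using 1 2 by (auto simp: g' h' mult_Ginf mult_Dinf perm_act_def restrict_def fun_eq_iff add.commute)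
qed

lemma gsupp_conj:
  assumes "\<sigma> \<in> Sinf" "h \<in> carrier (Ginf m)"
  shows "gsupp ((\<one>\<^bsub>Dinf m\<^esub>, \<sigma>) \<otimes>\<^bsub>Ginf m\<^esub> h \<otimes>\<^bsub>Ginf m\<^esub> inv\<^bsub>Ginf m\<^esub> (\<one>\<^bsub>Dinf m\<^esub>, \<sigma>)) \<subseteq> \<sigma> ` gsupp h"
proof -
  interpret D: group "Dinf m" by (rule group_Dinf)
  obtain e \<tau> where h': "h = (e, \<tau>)" and e: "e \<in> carrier (Dinf m)" "\<tau> \<in> Sinf"
    using assms by (auto simp: carrier_Ginf)
  let ?i = "Hilbert_Choice.inv \<sigma>"
  have "(\<one>\<^bsub>Dinf m\<^esub>, \<sigma>) \<otimes>\<^bsub>Ginf m\<^esub> h \<otimes>\<^bsub>Ginf m\<^esub> inv\<^bsub>Ginf m\<^esub> (\<one>\<^bsub>Dinf m\<^esub>, \<sigma>) = (perm_act \<sigma> e, \<sigma> \<circ> \<tau> \<circ> ?i)"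
    using assms e by (simp add: h' inv_Ginf_perm mult_Ginf perm_act_one Sinf_comp perm_act_closed)
  moreover have "i \<in> \<sigma> ` gsupp h" if "i \<in> gsupp (perm_act \<sigma> e, \<sigma> \<circ> \<tau> \<circ> ?i)" for i
  proof -
    have si: "\<sigma> (?i i) = i" using assms(1) by (simp add: Sinf_iff bij_is_surj surj_f_inv_f)
    have "?i i \<in> gsupp h"
    proof (cases "1 \<le> i \<and> e (?i i) \<noteq> 0")
      case True
      then show ?thesis using Sinf_pos[OF Sinf_inv[OF assms(1)], of i] by (simp add: gsupp_def h')
    next
      case False
      then have "\<sigma> (\<tau> (?i i)) \<noteq> i" using that by (auto simp: gsupp_def perm_act_def)
      then show ?thesis using si by (auto simp: gsupp_def h')
    qed
    then show ?thesis using si by (metis imageI)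
  qed
  ultimately show ?thesis by auto
qed

text \<open>Each element \<open>h\<close> can be moved to infinity by conjugations that successively shift a block
  containing its support.\<close>

lemma conjugates_to_infinity:
  fixes h0
  defines "G \<equiv> Ginf m"
  assumes h0: "h0 \<in> carrier G"
  obtains h u where "h (0::nat) = h0"
    and "\<And>n. h n \<in> carrier G" and "\<And>n. u n \<in> carrier G"
    and "\<And>n. h (Suc n) = u n \<otimes>\<^bsub>G\<^esub> h n \<otimes>\<^bsub>G\<^esub> inv\<^bsub>G\<^esub> (u n)"
    and "\<And>x. x \<in> carrier G \<Longrightarrow>
      \<forall>\<^sub>F n in sequentially. x \<otimes>\<^bsub>G\<^esub> h n = h n \<otimes>\<^bsub>G\<^esub> x \<and> x \<otimes>\<^bsub>G\<^esub> u n = u n \<otimes>\<^bsub>G\<^esub> x"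
proof -
  interpret group G unfolding G_def by (rule group_Ginf)
  interpret D: group "Dinf m" by (rule group_Dinf)
  obtain N' where "gsupp h0 \<subseteq> {..N'}"
    using finite_gsupp[of h0] h0 unfolding G_def finite_nat_iff_bounded_le by blast
  moreover define N where "N = Suc N'"
  ultimately have N: "gsupp h0 \<subseteq> {..N}" "0 < N" by auto
  define u where "u n = (\<one>\<^bsub>Dinf m\<^esub>, block_swap N n)" for n
  define h where "h = rec_nat h0 (\<lambda>n k. u n \<otimes>\<^bsub>G\<^esub> k \<otimes>\<^bsub>G\<^esub> inv\<^bsub>G\<^esub> (u n))"
  have h_0: "h 0 = h0" and h_Suc: "h (Suc n) = u n \<otimes>\<^bsub>G\<^esub> h n \<otimes>\<^bsub>G\<^esub> inv\<^bsub>G\<^esub> (u n)" for n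
    by (auto simp: h_def)
  have u: "u n \<in> carrier G" for n by (simp add: u_def G_def carrier_Ginf block_swap_Sinf)
  have h: "h n \<in> carrier G" for n by (induction n) (auto simp: h_0 h_Suc h0 u)
  have supp_u: "gsupp (u n) \<subseteq> {n * N <..}" for n
    by (auto simp: u_def gsupp_def one_Dinf block_swap_def split: if_splits)
  have supp_h: "gsupp (h n) \<subseteq> {n * N <.. n * N + N}" for n
  proof (induction n)
    case 0
    have "gsupp h0 \<subseteq> {1..}" using gsupp_pos[of h0] h0 by (simp add: G_def)
    with N(1) have "gsupp h0 \<subseteq> {1..} \<inter> {..N}" by blast
    also have "{1..} \<inter> {..N} = {0 * N <.. 0 * N + N}" by auto
    finally show ?case by (simp only: h_0)
  next
    case (Suc n)
    have "gsupp (h (Suc n)) \<subseteq> block_swap N n ` gsupp (h n)"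
      using gsupp_conj[OF block_swap_Sinf, of "h n"] h[of n] by (simp add: h_Suc u_def G_def)
    also have "\<dots> \<subseteq> block_swap N n ` {n * N <.. n * N + N}" using Suc by blast
    also have "\<dots> \<subseteq> {Suc n * N <.. Suc n * N + N}" by (auto simp: block_swap_def)
    finally show ?case .
  qed
  have comm: "\<forall>\<^sub>F n in sequentially. x \<otimes>\<^bsub>G\<^esub> h n = h n \<otimes>\<^bsub>G\<^esub> x \<and> x \<otimes>\<^bsub>G\<^esub> u n = u n \<otimes>\<^bsub>G\<^esub> x"
    if x: "x \<in> carrier G" for x
  proof -
    obtain M where M: "gsupp x \<subseteq> {..M}"
      using finite_gsupp x unfolding G_def by (metis finite_nat_iff_bounded_le)
    have "x \<otimes>\<^bsub>G\<^esub> h n = h n \<otimes>\<^bsub>G\<^esub> x \<and> x \<otimes>\<^bsub>G\<^esub> u n = u n \<otimes>\<^bsub>G\<^esub> x" if "n \<ge> M" for n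
    proof -
      have "M \<le> n * N" using that N(2) by (metis One_nat_def Suc_leI dual_order.trans mult.right_neutral mult_le_mono2)
      then have "gsupp x \<inter> gsupp (h n) = {}" "gsupp x \<inter> gsupp (u n) = {}"
        using M supp_h[of n] supp_u[of n] by fastforce+
      then show ?thesis using disjoint_gsupp_commute x h u unfolding G_def by blast
    qed
    then show ?thesis by (auto simp: eventually_sequentially)
  qed
  show thesis by (rule that[of h u]) (use h_0 h_Suc h u comm in auto)
qed

subsection \<open>The two parities\<close>

lemma even_ord_D_mult:
  assumes "even m" and d: "d \<in> carrier (Dinf m)" and s: "\<sigma> \<in> Sinf" and e: "e \<in> carrier (Dinf m)"
  shows "even (ord_D m (d \<otimes>\<^bsub>Dinf m\<^esub> perm_act \<sigma> e)) \<longleftrightarrow> even (ord_D m d) = even (ord_D m e)"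
proof -
  have ev: "even (ord_D m a) \<longleftrightarrow> even (\<Sum>j\<in>S. a j)" if "{j. 1 \<le> j \<and> a j \<noteq> 0} \<subseteq> S" "finite S" "S \<subseteq> {1..}"
    for a :: "nat \<Rightarrow> int" and S
  proof -
    have "(\<Sum>j | j \<in> {1..} \<and> a j \<noteq> 0. a j) = (\<Sum>j\<in>S. a j)"
      by (rule sum.mono_neutral_left) (use that in auto)
    moreover have "even (x mod int m) \<longleftrightarrow> even x" for x :: int
      using \<open>even m\<close> by (metis dvd_mod_iff even_of_nat)
    ultimately show ?thesis by (simp only: ord_D_def)
  qed
  have evm: "even (x mod int m) \<longleftrightarrow> even x" for x :: int
    using \<open>even m\<close> by (metis dvd_mod_iff even_of_nat)
  let ?e = "perm_act \<sigma> e"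
  have e': "?e \<in> carrier (Dinf m)" using perm_act_closed s e by blast
  define T where "T = {j. 1 \<le> j \<and> e j \<noteq> 0}"
  have T: "finite T" "T \<subseteq> {1..}" using e m0 by (auto simp: carrier_Dinf T_def)
  have b: "bij \<sigma>" using s by (simp add: Sinf_iff)
  have "even (ord_D m ?e) \<longleftrightarrow> even (\<Sum>j\<in>\<sigma> ` T. ?e j)"
  proof (rule ev)
    show "{j. 1 \<le> j \<and> ?e j \<noteq> 0} \<subseteq> \<sigma> ` T"
    proof
      fix j assume "j \<in> {j. 1 \<le> j \<and> ?e j \<noteq> 0}"
      then have "Hilbert_Choice.inv \<sigma> j \<in> T"
        using Sinf_pos[OF Sinf_inv[OF s], of j] by (auto simp: T_def perm_act_def)
      moreover have "j = \<sigma> (Hilbert_Choice.inv \<sigma> j)" using b by (simp add: bij_is_surj surj_f_inv_f)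
      ultimately show "j \<in> \<sigma> ` T" by (rule rev_image_eqI)
    qed
    show "\<sigma> ` T \<subseteq> {1..}"
      using T(2) Sinf_pos[OF s] by (auto simp del: One_nat_def)
  qed (use T in auto)
  also have "(\<Sum>j\<in>\<sigma> ` T. ?e j) = (\<Sum>j\<in>T. e j)"
  proof -
    have "(\<Sum>j\<in>\<sigma> ` T. ?e j) = (\<Sum>j\<in>T. ?e (\<sigma> j))"
    proof -
      have "inj_on \<sigma> T" using bij_is_inj[OF b] by (rule inj_on_subset) simp
      then show ?thesis using sum.reindex[of \<sigma> T ?e] by (simp add: o_def)
    qed
    also have "\<dots> = (\<Sum>j\<in>T. e j)"
    proof (rule sum.cong[OF HOL.refl])
      fix j assume "j \<in> T"
      then have "1 \<le> \<sigma> j" using T(2) Sinf_pos[OF s, of j] by auto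
      then show "?e (\<sigma> j) = e j" using b by (simp add: perm_act_def bij_is_inj)
    qed
    finally show ?thesis .
  qed
  also have "even (\<Sum>j\<in>T. e j) \<longleftrightarrow> even (ord_D m e)" using ev[of e T] T by (simp add: T_def)
  finally have 1: "even (ord_D m ?e) \<longleftrightarrow> even (ord_D m e)" .
  define S where "S = {j. 1 \<le> j \<and> d j \<noteq> 0} \<union> {j. 1 \<le> j \<and> ?e j \<noteq> 0}"
  have S: "finite S" "S \<subseteq> {1..}" using d e' m0 by (auto simp: carrier_Dinf S_def)
  have "even (ord_D m (d \<otimes>\<^bsub>Dinf m\<^esub> ?e)) \<longleftrightarrow> even (\<Sum>j\<in>S. (d \<otimes>\<^bsub>Dinf m\<^esub> ?e) j)"
    by (rule ev) (use S in \<open>auto simp: S_def mult_Dinf\<close>)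
  also have "\<dots> \<longleftrightarrow> even (\<Sum>j\<in>S. d j + ?e j)"
  proof -
    have "even (\<Sum>j\<in>S. (d \<otimes>\<^bsub>Dinf m\<^esub> ?e) j) \<longleftrightarrow> even (card {j\<in>S. odd ((d \<otimes>\<^bsub>Dinf m\<^esub> ?e) j)})"
      using S by (simp add: even_sum_iff)
    also have "{j\<in>S. odd ((d \<otimes>\<^bsub>Dinf m\<^esub> ?e) j)} = {j\<in>S. odd (d j + ?e j)}"
      using S(2) by (auto simp: mult_Dinf evm)
    finally show ?thesis using S by (simp add: even_sum_iff)
  qed
  also have "\<dots> \<longleftrightarrow> even (\<Sum>j\<in>S. d j) = even (\<Sum>j\<in>S. ?e j)" by (simp add: sum.distrib)
  also have "\<dots> \<longleftrightarrow> even (ord_D m d) = even (ord_D m ?e)"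
    using ev[of d S] ev[of ?e S] S by (simp add: S_def)
  finally show ?thesis using 1 by simp
qed

end

section \<open>Groups given by generators and relations\<close>

lemma pres_equiv_words:
  "pres_equiv X R u v \<Longrightarrow> u \<in> words X \<and> v \<in> words X"
  by (induction rule: pres_equiv.induct) auto

lemma word_class_eq_iff:
  assumes "u \<in> words X"
  shows "word_class X R u = word_class X R v \<longleftrightarrow> pres_equiv X R u v"
proof
  assume "word_class X R u = word_class X R v"
  moreover have "u \<in> word_class X R u"
    using assms by (auto simp: word_class_def intro: pres_equiv.refl)
  ultimately show "pres_equiv X R u v"
    by (auto simp: word_class_def intro: pres_equiv.sym)
next
  assume "pres_equiv X R u v"
  then show "word_class X R u = word_class X R v"
    unfolding word_class_def by (blast intro: pres_equiv.sym pres_equiv.trans)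
qed

lemma pres_equiv_append:
  assumes "pres_equiv X R u u'" "pres_equiv X R v v'"
  shows "pres_equiv X R (u @ v) (u' @ v')"
proof -
  note w = pres_equiv_words[OF assms(1)] pres_equiv_words[OF assms(2)]
  have "pres_equiv X R (u @ v) (u' @ v)"
    using pres_equiv.congr[OF assms(1), of "[]" v] w by simp
  moreover have "pres_equiv X R (u' @ v) (u' @ v')"
    using pres_equiv.congr[OF assms(2), of u' "[]"] w by simp
  ultimately show ?thesis by (rule pres_equiv.trans)
qed

lemma presented_group_simps:
  "carrier (presented_group X R) = word_class X R ` words X"
  "\<one>\<^bsub>presented_group X R\<^esub> = word_class X R []"
  by (simp_all add: presented_group_def)

lemma word_class_mult:
  assumes "u \<in> words X" "v \<in> words X"
  shows "word_class X R u \<otimes>\<^bsub>presented_group X R\<^esub> word_class X R v = word_class X R (u @ v)"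
proof (intro equalityI subsetI)
  fix w assume "w \<in> word_class X R u \<otimes>\<^bsub>presented_group X R\<^esub> word_class X R v"
  then show "w \<in> word_class X R (u @ v)"
    by (auto simp: presented_group_def word_class_def intro: pres_equiv_append pres_equiv.trans)
next
  fix w assume "w \<in> word_class X R (u @ v)"
  then show "w \<in> word_class X R u \<otimes>\<^bsub>presented_group X R\<^esub> word_class X R v"
    using assms by (auto simp: presented_group_def word_class_def intro!: bexI[of _ u] bexI[of _ v] pres_equiv.refl)
qed

definition word_inv :: "'a word \<Rightarrow> 'a word" where
  "word_inv w = rev (map (\<lambda>(x, s). (x, \<not> s)) w)"

lemma word_inv_equiv:
  "w \<in> words X \<Longrightarrow> word_inv w \<in> words X \<and> pres_equiv X R (word_inv w @ w) []"
proof (induction w)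
  case Nil
  then show ?case by (simp add: word_inv_def pres_equiv.refl)
next
  case (Cons p w)
  obtain x s where p: "p = (x, s)" by (cases p)
  have x: "x \<in> X" and w: "w \<in> words X" using Cons.prems p by auto
  have iw: "word_inv w \<in> words X" and eq: "pres_equiv X R (word_inv w @ w) []"
    using Cons.IH[OF w] by auto
  have "pres_equiv X R [(x, \<not> s), (x, s)] []"
    using pres_equiv.cancel[OF x, of R "\<not> s"] by simp
  from pres_equiv.congr[OF this iw w] eq
  have "pres_equiv X R (word_inv w @ [(x, \<not> s), (x, s)] @ w) []"
    by (auto intro: pres_equiv.trans)
  then show ?case using iw x by (simp add: word_inv_def p)
qed

lemma group_presented_group: "group (presented_group X R)"
proof (rule groupI)
  let ?G = "presented_group X R"
  fix a b assume "a \<in> carrier ?G" "b \<in> carrier ?G"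
  then obtain u v where w: "u \<in> words X" "v \<in> words X"
    and ab: "a = word_class X R u" "b = word_class X R v"
    unfolding presented_group_simps by blast
  have "u @ v \<in> words X" using w by simp
  then show "a \<otimes>\<^bsub>?G\<^esub> b \<in> carrier ?G"
    unfolding ab word_class_mult[OF w] presented_group_simps by (rule imageI)
next
  let ?G = "presented_group X R"
  fix a b c assume "a \<in> carrier ?G" "b \<in> carrier ?G" "c \<in> carrier ?G"
  then obtain u v w where "u \<in> words X" "v \<in> words X" "w \<in> words X"
    and "a = word_class X R u" "b = word_class X R v" "c = word_class X R w"
    unfolding presented_group_simps by blast
  then show "a \<otimes>\<^bsub>?G\<^esub> b \<otimes>\<^bsub>?G\<^esub> c = a \<otimes>\<^bsub>?G\<^esub> (b \<otimes>\<^bsub>?G\<^esub> c)"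
    by (simp add: word_class_mult)
next
  let ?G = "presented_group X R"
  fix a assume "a \<in> carrier ?G"
  then obtain w where w: "w \<in> words X" "a = word_class X R w" by (auto simp: presented_group_simps)
  have iw: "word_inv w \<in> words X" "pres_equiv X R (word_inv w @ w) []"
    using word_inv_equiv[OF w(1)] by auto
  have "word_class X R (word_inv w) \<otimes>\<^bsub>?G\<^esub> a = word_class X R (word_inv w @ w)"
    using iw w by (simp add: word_class_mult)
  also have "\<dots> = \<one>\<^bsub>?G\<^esub>" using word_class_eq_iff[of "word_inv w @ w" X R "[]"] iw w
    by (simp add: presented_group_simps)
  finally show "\<exists>b\<in>carrier ?G. b \<otimes>\<^bsub>?G\<^esub> a = \<one>\<^bsub>?G\<^esub>"
    using iw by (auto simp: presented_group_simps)
next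
  let ?G = "presented_group X R"
  show "\<one>\<^bsub>?G\<^esub> \<in> carrier ?G"
    unfolding presented_group_simps by (rule imageI) simp
next
  let ?G = "presented_group X R"
  fix a assume "a \<in> carrier ?G"
  then obtain w where "w \<in> words X" "a = word_class X R w"
    unfolding presented_group_simps by blast
  then show "\<one>\<^bsub>?G\<^esub> \<otimes>\<^bsub>?G\<^esub> a = a"
    by (simp add: presented_group_simps word_class_mult)
qed

lemma word_class_inv_letter:
  assumes "x \<in> X"
  shows "word_class X R [(x, True)] = inv\<^bsub>presented_group X R\<^esub> (word_class X R [(x, False)])"
proof -
  interpret group "presented_group X R" by (rule group_presented_group)
  have "word_class X R [(x, True)] \<otimes>\<^bsub>presented_group X R\<^esub> word_class X R [(x, False)] = \<one>\<^bsub>presented_group X R\<^esub>"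
    using assms pres_equiv.cancel[OF assms, of R True]
    by (simp add: word_class_mult presented_group_simps word_class_eq_iff)
  then show ?thesis
    using assms by (intro inv_equality[symmetric]) (auto simp: presented_group_simps)
qed

lemma presented_group_induct:
  fixes X and R
  defines "G \<equiv> presented_group X R"
  assumes g: "g \<in> carrier G" and one: "P \<one>\<^bsub>G\<^esub>"
    and mult: "\<And>g x. g \<in> carrier G \<Longrightarrow> x \<in> X \<Longrightarrow> P g \<Longrightarrow> P (g \<otimes>\<^bsub>G\<^esub> word_class X R [(x, False)])"
    and mult_inv: "\<And>g x. g \<in> carrier G \<Longrightarrow> x \<in> X \<Longrightarrow> P g \<Longrightarrow> P (g \<otimes>\<^bsub>G\<^esub> inv\<^bsub>G\<^esub> (word_class X R [(x, False)]))"
  shows "P g"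
proof -
  have "P (word_class X R w)" if "w \<in> words X" for w
    using that
  proof (induction w rule: rev_induct)
    case Nil
    then show ?case using one by (simp add: G_def presented_group_simps)
  next
    case (snoc p w)
    obtain x s where p: "p = (x, s)" by (cases p)
    have w: "w \<in> words X" and x: "x \<in> X" using snoc.prems p by auto
    have wG: "word_class X R w \<in> carrier G" using w by (simp add: G_def presented_group_simps)
    have "word_class X R (w @ [p]) = word_class X R w \<otimes>\<^bsub>G\<^esub> word_class X R [(x, s)]"
      using w x by (simp add: G_def word_class_mult p)
    then show ?case
      using mult[OF wG x snoc.IH[OF w]] mult_inv[OF wG x snoc.IH[OF w]] word_class_inv_letter[OF x, of R]
      by (cases s) (auto simp: G_def)
  qed
  then show ?thesis using g by (auto simp: G_def presented_group_simps)
qed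

context group
begin

lemma eval_word_Nil [simp]: "eval_word G \<phi> [] = \<one>"
  by (simp add: eval_word_def)

lemma eval_word_Cons [simp]:
  "eval_word G \<phi> ((x, s) # w) = (if s then inv (\<phi> x) else \<phi> x) \<otimes> eval_word G \<phi> w"
  by (simp add: eval_word_def)

lemma eval_word_closed:
  "\<phi> \<in> X \<rightarrow> carrier G \<Longrightarrow> w \<in> words X \<Longrightarrow> eval_word G \<phi> w \<in> carrier G"
  by (induction w) (auto simp: Pi_iff)

lemma eval_word_append:
  assumes "\<phi> \<in> X \<rightarrow> carrier G" "u \<in> words X" "v \<in> words X"
  shows "eval_word G \<phi> (u @ v) = eval_word G \<phi> u \<otimes> eval_word G \<phi> v"
  using assms(2)
proof (induction u)
  case (Cons p u)
  then show ?case
    using assms eval_word_closed[OF assms(1)] by (cases p) (auto simp: m_assoc Pi_iff)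
qed (use eval_word_closed[OF assms(1,3)] in auto)

lemma eval_word_replicate:
  assumes "\<phi> \<in> X \<rightarrow> carrier G" "w \<in> words X"
  shows "eval_word G \<phi> (concat (replicate n w)) = eval_word G \<phi> w [^] n"
proof (induction n)
  case (Suc n)
  have "concat (replicate n w) \<in> words X" using assms(2) by (induction n) auto
  then have "eval_word G \<phi> (concat (replicate (Suc n) w)) = eval_word G \<phi> w \<otimes> (eval_word G \<phi> w [^] n)"
    using Suc eval_word_append[OF assms] by simp
  also have "\<dots> = eval_word G \<phi> w [^] Suc n"
    using eval_word_closed[OF assms] by (rule nat_pow_Suc2[symmetric])
  finally show ?case .
qed simp

lemma eval_word_pres_equiv:
  assumes phi: "\<phi> \<in> X \<rightarrow> carrier G"
    and rels: "\<And>u v. (u, v) \<in> R \<Longrightarrow> u \<in> words X \<Longrightarrow> v \<in> words X \<Longrightarrow> eval_word G \<phi> u = eval_word G \<phi> v"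
    and "pres_equiv X R u v"
  shows "eval_word G \<phi> u = eval_word G \<phi> v"
  using assms(3)
proof (induction rule: pres_equiv.induct)
  case (congr u v a b)
  then show ?case
    using pres_equiv_words[OF congr(1)] by (simp add: eval_word_append[OF phi])
next
  case (cancel x s)
  then show ?case using phi by (auto simp: Pi_iff)
qed (use rels in auto)

end

definition presented_hom ::
  "('g, 'b) monoid_scheme \<Rightarrow> ('a \<Rightarrow> 'g) \<Rightarrow> 'a word set \<Rightarrow> 'g" where
  "presented_hom H \<phi> A = the_elem (eval_word H \<phi> ` A)"

locale presented_group_hom = H: group H for H (structure) +
  fixes X :: "'x set" and R and \<phi>
  assumes phi: "\<phi> \<in> X \<rightarrow> carrier H"
    and rels: "\<And>u v. (u, v) \<in> R \<Longrightarrow> u \<in> words X \<Longrightarrow> v \<in> words X \<Longrightarrow>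
      eval_word H \<phi> u = eval_word H \<phi> v"
begin

lemma presented_hom_class:
  assumes "w \<in> words X"
  shows "presented_hom H \<phi> (word_class X R w) = eval_word H \<phi> w"
proof -
  have "eval_word H \<phi> v = eval_word H \<phi> w" if "v \<in> word_class X R w" for v
  proof -
    have pe: "pres_equiv X R w v" using that by (simp add: word_class_def)
    have "eval_word H \<phi> w = eval_word H \<phi> v"
      by (rule H.eval_word_pres_equiv[OF phi _ pe]) (rule rels)
    then show ?thesis by (rule HOL.sym)
  qed
  note eq = this
  have w: "w \<in> word_class X R w"
    unfolding word_class_def by (rule CollectI, rule pres_equiv.refl, rule assms)
  have "eval_word H \<phi> ` word_class X R w = {eval_word H \<phi> w}"
  proof (intro equalityI subsetI)
    fix y assume "y \<in> eval_word H \<phi> ` word_class X R w"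
    then show "y \<in> {eval_word H \<phi> w}" using eq by auto
  next
    fix y assume "y \<in> {eval_word H \<phi> w}"
    then show "y \<in> eval_word H \<phi> ` word_class X R w" using w by (simp add: rev_image_eqI)
  qed
  then show ?thesis by (simp add: presented_hom_def)
qed

lemma presented_hom_hom: "presented_hom H \<phi> \<in> hom (presented_group X R) H"
proof (rule homI)
  show "presented_hom H \<phi> a \<in> carrier H" if a: "a \<in> carrier (presented_group X R)" for a
  proof -
    from a obtain u where "u \<in> words X" "a = word_class X R u"
      unfolding presented_group_simps by (elim imageE)
    then show ?thesis by (simp only: presented_hom_class H.eval_word_closed[OF phi])
  qed
next
  fix a b assume a: "a \<in> carrier (presented_group X R)" and b: "b \<in> carrier (presented_group X R)"
  from a obtain u where u: "u \<in> words X" "a = word_class X R u"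
    unfolding presented_group_simps by (elim imageE)
  from b obtain v where v: "v \<in> words X" "b = word_class X R v"
    unfolding presented_group_simps by (elim imageE)
  have "u @ v \<in> words X" using u v by simp
  then show "presented_hom H \<phi> (a \<otimes>\<^bsub>presented_group X R\<^esub> b) = presented_hom H \<phi> a \<otimes> presented_hom H \<phi> b"
    unfolding u(2) v(2) word_class_mult[OF u(1) v(1)] presented_hom_class[OF u(1)] presented_hom_class[OF v(1)]
    by (simp only: presented_hom_class H.eval_word_append[OF phi u(1) v(1)])
qed

lemma presented_hom_generator: "x \<in> X \<Longrightarrow> presented_hom H \<phi> (word_class X R [(x, False)]) = \<phi> x"
proof -
  assume x: "x \<in> X"
  then have "[(x, False)] \<in> words X" by simp
  then show ?thesis using funcset_mem[OF phi x] by (simp add: presented_hom_class)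
qed

end

section \<open>The dihedral quotient\<close>

text \<open>The dihedral group of order 8: \<open>(e, a, s)\<close> stands for the product \<open>z\<^sup>e y\<^sup>a r\<^sup>s\<close> of involutions, where
  \<open>r y = z y r\<close> and \<open>z\<close> is central.\<close>

definition D4 :: "(bool \<times> bool \<times> bool) monoid" where
  "D4 = \<lparr>carrier = UNIV,
     monoid.mult = (\<lambda>(e, a, s) (e', a', s'). (e \<noteq> (e' \<noteq> (s \<and> a')), a \<noteq> a', s \<noteq> s')),
     one = (False, False, False)\<rparr>"

lemma D4_simps [simp]:
  "carrier D4 = UNIV" "\<one>\<^bsub>D4\<^esub> = (False, False, False)"
  "(e, a, s) \<otimes>\<^bsub>D4\<^esub> (e', a', s') = (e \<noteq> (e' \<noteq> (s \<and> a')), a \<noteq> a', s \<noteq> s')"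
  by (simp_all add: D4_def)

lemma group_D4: "group D4"
proof (rule groupI)
  fix x :: "bool \<times> bool \<times> bool"
  obtain e a s where "x = (e, a, s)" by (cases x)
  then have "(e \<noteq> (s \<and> a), a, s) \<otimes>\<^bsub>D4\<^esub> x = \<one>\<^bsub>D4\<^esub>" by auto
  then show "\<exists>y\<in>carrier D4. y \<otimes>\<^bsub>D4\<^esub> x = \<one>\<^bsub>D4\<^esub>" by auto
qed auto

lemma inv_D4: "inv\<^bsub>D4\<^esub> (e, a, s) = (e \<noteq> (s \<and> a), a, s)"
  by (rule group.inv_equality[OF group_D4]) auto

primrec dgen :: "gen \<Rightarrow> bool \<times> bool \<times> bool" where
  "dgen (Zgen k) = (k = 3, False, False)"
| "dgen (Rgen i) = (False, False, True)"
| "dgen (Egen j) = (False, True, False)"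

lemma (in group) involution_even_pow:
  assumes "x \<in> carrier G" "x \<otimes> x = \<one>" "even (n::nat)"
  shows "x [^] n = \<one>"
proof -
  obtain k where "n = 2 * k" using assms(3) by blast
  moreover have "x [^] (2::nat) = \<one>" using assms by (simp add: numeral_2_eq_2)
  ultimately show ?thesis using assms(1) by (simp add: nat_pow_pow[symmetric])
qed

lemma gens_simps [simp]:
  "Zgen k \<in> gens \<longleftrightarrow> k \<in> {1, 2, 3}" "Rgen i \<in> gens \<longleftrightarrow> 1 \<le> i" "Egen i \<in> gens \<longleftrightarrow> 1 \<le> i"
  by (auto simp: gens_def)

lemma concat_replicate_words: "w \<in> words X \<Longrightarrow> concat (replicate n w) \<in> words X"
  by (induction n) auto

lemma rels_cases:
  assumes "(u, v) \<in> rels m"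
  obtains (central) k x where "u = zw k @ [(x, False)]" "v = [(x, False)] @ zw k" "k \<in> {1,2,3}" "x \<in> gens"
    | (z_sq) k where "u = zw k @ zw k" "v = []" "k \<in> {1,2,3}"
    | (r_sq) i where "u = rw i @ rw i" "v = []" "1 \<le> i"
    | (braid) i where "u = concat (replicate 3 (rw i @ rw (i + 1)))" "v = []" "1 \<le> i"
    | (r_far) i j where "u = rw i @ rw j" "v = zw 1 @ rw j @ rw i" "1 \<le> i" "1 \<le> j" "i + 2 \<le> j \<or> j + 2 \<le> i"
    | (e_pow) j where "u = concat (replicate m (ew j))" "v = []" "1 \<le> j"
    | (e_far) j k where "u = ew j @ ew k" "v = zw 2 @ ew k @ ew j" "1 \<le> j" "1 \<le> k" "j \<noteq> k"
    | (r_e) i j where "u = rw i @ ew j @ rw_inv i"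
        "v = zw 3 @ ew (swap i (i + 1) j)" "1 \<le> i" "1 \<le> j"
  using assms unfolding rels_def Un_iff mem_Collect_eq prod.inject
  apply (elim disjE exE conjE)
  apply (rule that(1); assumption)
  apply (rule that(2); assumption)
  apply (rule that(3); assumption)
  apply (rule that(4); assumption)
  apply (rule that(5), assumption, assumption, assumption, assumption, rule disjI1, assumption)
  apply (rule that(5), assumption, assumption, assumption, assumption, rule disjI2, assumption)
  apply (rule that(6); assumption)
  apply (rule that(7); assumption)
  apply (rule that(8); assumption)
  done

lemma transpose_Suc_pos: "1 \<le> i \<Longrightarrow> 1 \<le> j \<Longrightarrow> 1 \<le> swap i (i + 1) (j :: nat)"
  by (auto simp: Transposition.transpose_def)

lemma transpose_Suc_Sinf: "1 \<le> i \<Longrightarrow> swap i (Suc i) \<in> Sinf"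
proof -
  assume "1 \<le> i"
  have "{k. swap i (Suc i) k \<noteq> k} \<subseteq> {i, Suc i}"
    by (auto simp: Transposition.transpose_def)
  then have "finite {k. swap i (Suc i) k \<noteq> k}"
    by (rule finite_subset) simp
  moreover have "swap i (Suc i) 0 = 0"
    using \<open>1 \<le> i\<close> by (simp add: Transposition.transpose_def)
  ultimately show ?thesis by (simp add: Sinf_iff)
qed

text \<open>The image of \<open>\<eta>\<^sub>j\<close> is an involution, so the relation \<open>\<eta>\<^sub>j\<^sup>m = e\<close> holds because \<open>m\<close> is even.\<close>

lemma presented_hom_D4:
  assumes "even m"
  shows "presented_group_hom D4 gens (rels m) dgen"
proof -
  interpret group D4 by (rule group_D4)
  have phi: "dgen \<in> gens \<rightarrow> carrier D4" by auto
  show ?thesis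
  proof
    fix u v assume r: "(u, v) \<in> rels m" and uv: "u \<in> words gens" "v \<in> words gens"
    show "eval_word D4 dgen u = eval_word D4 dgen v"
      using r
    proof (cases rule: rels_cases)
      case (central k x)
      then show ?thesis by (cases x) auto
    next
      case (braid i)
      have w: "rw i @ rw (i + 1) \<in> words gens" using braid(3) by simp
      have "eval_word D4 dgen u = eval_word D4 dgen (rw i @ rw (i + 1)) [^]\<^bsub>D4\<^esub> (3::nat)"
        unfolding braid(1) by (rule eval_word_replicate[OF phi w])
      also have "eval_word D4 dgen (rw i @ rw (i + 1)) = \<one>\<^bsub>D4\<^esub>" by simp
      also have "\<one>\<^bsub>D4\<^esub> [^]\<^bsub>D4\<^esub> (3::nat) = \<one>\<^bsub>D4\<^esub>" by (rule nat_pow_one)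
      finally show ?thesis unfolding braid(2) eval_word_Nil .
    next
      case (e_pow j)
      have w: "ew j \<in> words gens" using e_pow(3) by simp
      have "eval_word D4 dgen u = eval_word D4 dgen (ew j) [^]\<^bsub>D4\<^esub> m"
        unfolding e_pow(1) by (rule eval_word_replicate[OF phi w])
      also have "eval_word D4 dgen (ew j) = (False, True, False)" by simp
      also have "(False, True, False) [^]\<^bsub>D4\<^esub> m = \<one>\<^bsub>D4\<^esub>"
        using assms by (intro involution_even_pow) auto
      finally show ?thesis unfolding e_pow(2) eval_word_Nil .
    qed (auto simp: inv_D4)
  qed auto
qed

context
  fixes m :: nat
  assumes pos_m: "0 < m" and even_m: "even m"
begin

interpretation Ginf: group "Ginf m" by (rule group_Ginf[OF pos_m])

lemma sG_closed: "1 \<le> i \<Longrightarrow> sG m i \<in> carrier (Ginf m)"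
  using group.is_monoid[OF group_Dinf, THEN monoid.one_closed]
  by (simp add: sG_def carrier_Ginf transpose_Suc_Sinf)

lemma yG_eq: "yG m j = ((\<lambda>i\<in>{1..}. if i = j then 1 else 0), id)"
  using pos_m even_m by (cases "m = 1") (auto simp: yG_def)

lemma yG_closed: "yG m j \<in> carrier (Ginf m)"
proof -
  have "1 < m" using pos_m even_m by (cases "m = 1") auto
  then show ?thesis
    using pos_m by (auto simp: yG_eq carrier_Ginf carrier_Dinf intro: finite_subset[of _ "{j}"])
qed

lemma yG_pow: "1 \<le> j \<Longrightarrow> yG m j [^]\<^bsub>Ginf m\<^esub> (n::nat) = ((\<lambda>i\<in>{1..}. if i = j then int n mod int m else 0), id)"
proof (induction n)
  case 0
  then show ?case by (auto simp: one_Ginf one_Dinf intro!: restrict_ext)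
next
  case (Suc n)
  then show ?case
    by (auto simp: yG_eq mult_Ginf mult_Dinf perm_act_def fun_eq_iff mod_simps add.commute)
qed

lemma gsupp_sG: "gsupp (sG m i) \<subseteq> {i, Suc i}"
  by (auto simp: gsupp_def sG_def one_Dinf Transposition.transpose_def split: if_splits)

lemma gsupp_yG: "gsupp (yG m j) \<subseteq> {j}"
  by (auto simp: gsupp_def yG_eq split: if_splits)

lemma sG_sq: "1 \<le> i \<Longrightarrow> sG m i \<otimes>\<^bsub>Ginf m\<^esub> sG m i = \<one>\<^bsub>Ginf m\<^esub>"
  using perm_act_one[OF pos_m, of "swap i (Suc i)"] group.is_monoid[OF group_Dinf[of m]]
  by (simp add: sG_def mult_Ginf one_Ginf transpose_Suc_Sinf monoid.l_one monoid.one_closed)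

lemma sG_braid: "1 \<le> i \<Longrightarrow> (sG m i \<otimes>\<^bsub>Ginf m\<^esub> sG m (Suc i)) [^]\<^bsub>Ginf m\<^esub> (3::nat) = \<one>\<^bsub>Ginf m\<^esub>"
proof -
  assume i: "1 \<le> i"
  interpret D: group "Dinf m" by (rule group_Dinf)
  let ?s = "swap i (Suc i) \<circ> swap (Suc i) (Suc (Suc i))"
  have s: "swap i (Suc i) \<in> Sinf" "swap (Suc i) (Suc (Suc i)) \<in> Sinf" "?s \<in> Sinf"
    using i by (auto intro!: Sinf_comp transpose_Suc_Sinf)
  have *: "sG m i \<otimes>\<^bsub>Ginf m\<^esub> sG m (Suc i) = (\<one>\<^bsub>Dinf m\<^esub>, ?s)"
    using s by (simp add: sG_def mult_Ginf perm_act_one[OF pos_m])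
  have "?s \<circ> (?s \<circ> ?s) = id" by (auto simp: fun_eq_iff Transposition.transpose_def)
  then show ?thesis
    using s unfolding * by (simp add: numeral_3_eq_3 mult_Ginf perm_act_one[OF pos_m] one_Ginf Sinf_comp comp_assoc)
qed

lemma sG_yG:
  assumes "1 \<le> i" "1 \<le> j"
  shows "sG m i \<otimes>\<^bsub>Ginf m\<^esub> yG m j = yG m (swap i (Suc i) j) \<otimes>\<^bsub>Ginf m\<^esub> sG m i"
proof -
  let ?t = "swap i (Suc i)"
  have t: "?t \<in> Sinf" using assms by (simp add: transpose_Suc_Sinf)
  have "perm_act ?t (\<lambda>i\<in>{1..}. if i = j then 1 else 0) = (\<lambda>k\<in>{1..}. if k = ?t j then 1 else 0)"
  proof
    fix k
    have "1 \<le> k \<Longrightarrow> 1 \<le> ?t k" using Sinf_pos[OF t] by simp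
    moreover have "?t k = j \<longleftrightarrow> k = ?t j" by (metis transpose_involutory)
    ultimately show "perm_act ?t (\<lambda>i\<in>{1..}. if i = j then 1 else 0) k = (\<lambda>k\<in>{1..}. if k = ?t j then 1 else 0) k"
      by (auto simp: perm_act_def)
  qed
  moreover have "1 < m" using pos_m even_m by (cases "m = 1") auto
  moreover have "perm_act id \<one>\<^bsub>Dinf m\<^esub> = \<one>\<^bsub>Dinf m\<^esub>"
    by (auto simp: perm_act_def one_Dinf)
  ultimately show ?thesis
    unfolding sG_def yG_eq mult_Ginf by (auto simp: mult_Dinf one_Dinf intro!: restrict_ext)
qed

lemma presented_hom_Ginf: "presented_group_hom (Ginf m) gens (rels m) (gen_image m)"
proof -
  have phi: "gen_image m \<in> gens \<rightarrow> carrier (Ginf m)"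
    using sG_closed yG_closed by (auto simp: gens_def)
  have c: "a \<otimes>\<^bsub>Ginf m\<^esub> b = b \<otimes>\<^bsub>Ginf m\<^esub> a"
    if "a \<in> carrier (Ginf m)" "b \<in> carrier (Ginf m)" "gsupp a \<subseteq> A" "gsupp b \<subseteq> B" "A \<inter> B = {}" for a b A B
    using disjoint_gsupp_commute[OF pos_m that(1,2)] that by blast
  show ?thesis
  proof
    fix u v assume r: "(u, v) \<in> rels m" and uv: "u \<in> words gens" "v \<in> words gens"
    show "eval_word (Ginf m) (gen_image m) u = eval_word (Ginf m) (gen_image m) v"
      using r
    proof (cases rule: rels_cases)
      case (central k x)
      then show ?thesis using phi by (auto simp: Pi_iff)
    next
      case (r_sq i)
      then show ?thesis using sG_sq sG_closed by simp
    next
      case (braid i)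
      then show ?thesis
        using sG_braid[of i] sG_closed by (subst braid(1), subst Ginf.eval_word_replicate[OF phi]) auto
    next
      case (r_far i j)
      then show ?thesis
        using c[OF sG_closed sG_closed gsupp_sG gsupp_sG, of i j] sG_closed by auto
    next
      case (e_pow j)
      show ?thesis
      proof -
        have "eval_word (Ginf m) (gen_image m) u = yG m j [^]\<^bsub>Ginf m\<^esub> m"
          using e_pow yG_closed by (subst e_pow(1), subst Ginf.eval_word_replicate[OF phi]) auto
        also have "\<dots> = \<one>\<^bsub>Ginf m\<^esub>"
          unfolding yG_pow[OF e_pow(3)] by (auto simp: one_Ginf one_Dinf intro!: restrict_ext)
        finally show ?thesis using e_pow(2) by simp
      qed
    next
      case (e_far j k)
      then show ?thesis
        using c[OF yG_closed yG_closed gsupp_yG gsupp_yG, of j k] yG_closed by auto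
    next
      case (r_e i j)
      let ?s = "sG m i" and ?y = "yG m j" and ?y' = "yG m (swap i (Suc i) j)"
      note c = sG_closed[OF r_e(3)] yG_closed[of j] yG_closed[of "swap i (Suc i) j"]
      have "?s \<otimes>\<^bsub>Ginf m\<^esub> (?y \<otimes>\<^bsub>Ginf m\<^esub> inv\<^bsub>Ginf m\<^esub> ?s) = (?s \<otimes>\<^bsub>Ginf m\<^esub> ?y) \<otimes>\<^bsub>Ginf m\<^esub> inv\<^bsub>Ginf m\<^esub> ?s"
        using c by (simp add: Ginf.m_assoc)
      also have "\<dots> = ?y'"
        unfolding sG_yG[OF r_e(3,4)] using c by (simp add: Ginf.m_assoc)
      finally show ?thesis
        unfolding r_e(1,2) using c by simp
    qed auto
  qed (use phi in auto)
qed

end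

section \<open>The covering group\<close>

lemma (in group) commute_up_to_mult:
  assumes "c \<in> carrier G" "g \<in> carrier G" "x \<in> carrier G" "u \<in> carrier G" "v \<in> carrier G"
    and "g \<otimes> v = v \<otimes> g"
    and "c \<otimes> g = u \<otimes> (g \<otimes> c)" "c \<otimes> x = v \<otimes> (x \<otimes> c)"
  shows "c \<otimes> (g \<otimes> x) = (u \<otimes> v) \<otimes> ((g \<otimes> x) \<otimes> c)"
proof -
  have "c \<otimes> (g \<otimes> x) = (c \<otimes> g) \<otimes> x"
    using assms(1-5) by (simp add: m_assoc)
  also have "\<dots> = u \<otimes> (g \<otimes> (c \<otimes> x))"
    using assms(1-5) unfolding assms(7) by (simp add: m_assoc)
  also have "\<dots> = u \<otimes> ((g \<otimes> v) \<otimes> (x \<otimes> c))"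
    using assms(1-5) unfolding assms(8) by (simp add: m_assoc)
  also have "\<dots> = (u \<otimes> v) \<otimes> ((g \<otimes> x) \<otimes> c)"
    using assms(1-5) unfolding assms(6) by (simp add: m_assoc)
  finally show ?thesis .
qed

lemma (in group) commute_up_to_inv:
  assumes "c \<in> carrier G" "x \<in> carrier G" "v \<in> carrier G" "v \<otimes> v = \<one>"
    and central: "\<And>g. g \<in> carrier G \<Longrightarrow> v \<otimes> g = g \<otimes> v"
    and "c \<otimes> x = v \<otimes> (x \<otimes> c)"
  shows "c \<otimes> inv x = v \<otimes> (inv x \<otimes> c)"
proof -
  have "inv x \<otimes> c = inv x \<otimes> (c \<otimes> x) \<otimes> inv x"
    using assms(1-3) by (simp add: m_assoc)
  also have "\<dots> = (inv x \<otimes> v) \<otimes> (x \<otimes> (c \<otimes> inv x))"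
    unfolding assms(6) using assms(1-3) by (simp add: m_assoc)
  also have "\<dots> = v \<otimes> (inv x \<otimes> (x \<otimes> (c \<otimes> inv x)))"
    unfolding central[OF inv_closed[OF assms(2)], symmetric]
    using assms(1-3) by (simp only: m_assoc m_closed inv_closed)
  also have "inv x \<otimes> (x \<otimes> (c \<otimes> inv x)) = c \<otimes> inv x"
    using assms(1-3) by (simp add: m_assoc[symmetric])
  finally have "inv x \<otimes> c = v \<otimes> (c \<otimes> inv x)" .
  then have "v \<otimes> (inv x \<otimes> c) = (v \<otimes> v) \<otimes> (c \<otimes> inv x)"
    using assms(1-3) by (simp only: m_assoc m_closed inv_closed)
  then show ?thesis using assms(1-4) by simp
qed

lemma rels_z_x: "k \<in> {1, 2, 3} \<Longrightarrow> x \<in> gens \<Longrightarrow> (zw k @ [(x, False)], [(x, False)] @ zw k) \<in> rels m"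
  unfolding rels_def
  by (rule UnI1, rule UnI1, rule UnI1, rule UnI1, rule UnI1, rule UnI1, rule UnI1, rule CollectI, intro exI conjI, rule HOL.refl, assumption+)

lemma rels_z_sq: "k \<in> {1, 2, 3} \<Longrightarrow> (zw k @ zw k, []) \<in> rels m"
  unfolding rels_def
  by (rule UnI1, rule UnI1, rule UnI1, rule UnI1, rule UnI1, rule UnI1, rule UnI2, rule CollectI, intro exI conjI, rule HOL.refl, assumption+)

lemma rels_r_sq: "i \<ge> 1 \<Longrightarrow> (rw i @ rw i, []) \<in> rels m"
  unfolding rels_def
  by (rule UnI1, rule UnI1, rule UnI1, rule UnI1, rule UnI1, rule UnI2, rule CollectI, intro exI conjI, rule HOL.refl, assumption+)

lemma rels_braid: "i \<ge> 1 \<Longrightarrow> (concat (replicate 3 (rw i @ rw (i + 1))), []) \<in> rels m"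
  unfolding rels_def
  by (rule UnI1, rule UnI1, rule UnI1, rule UnI1, rule UnI2, rule CollectI, intro exI conjI, rule HOL.refl, assumption+)

lemma rels_r_far: "i \<ge> 1 \<Longrightarrow> j \<ge> 1 \<Longrightarrow> i + 2 \<le> j \<or> j + 2 \<le> i \<Longrightarrow> (rw i @ rw j, zw 1 @ rw j @ rw i) \<in> rels m"
  unfolding rels_def
  by (rule UnI1, rule UnI1, rule UnI1, rule UnI2, rule CollectI, intro exI conjI, rule HOL.refl, assumption+)

lemma rels_e_pow: "j \<ge> 1 \<Longrightarrow> (concat (replicate m (ew j)), []) \<in> rels m"
  unfolding rels_def
  by (rule UnI1, rule UnI1, rule UnI2, rule CollectI, intro exI conjI, rule HOL.refl, assumption+)

lemma rels_e_far: "j \<ge> 1 \<Longrightarrow> k \<ge> 1 \<Longrightarrow> j \<noteq> k \<Longrightarrow> (ew j @ ew k, zw 2 @ ew k @ ew j) \<in> rels m"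
  unfolding rels_def
  by (rule UnI1, rule UnI2, rule CollectI, intro exI conjI, rule HOL.refl, assumption+)

lemma rels_r_e: "i \<ge> 1 \<Longrightarrow> j \<ge> 1 \<Longrightarrow> (rw i @ ew j @ rw_inv i, zw 3 @ ew (swap i (i + 1) j)) \<in> rels m"
  unfolding rels_def
  by (rule UnI2, rule CollectI, intro exI conjI, rule HOL.refl, assumption+)

locale spin_cover =
  fixes m :: nat
  assumes even_m: "even m" and pos_m: "0 < m"
begin

abbreviation G' where "G' \<equiv> carrier (Gp m)"
abbreviation mulP (infixl "\<cdot>" 70) where "x \<cdot> y \<equiv> x \<otimes>\<^bsub>Gp m\<^esub> y"
abbreviation invP where "invP x \<equiv> inv\<^bsub>Gp m\<^esub> x"
abbreviation oneP where "oneP \<equiv> \<one>\<^bsub>Gp m\<^esub>"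
abbreviation powP (infixr "\<up>" 75) where "x \<up> n \<equiv> x [^]\<^bsub>Gp m\<^esub> (n::nat)"
abbreviation G where "G \<equiv> carrier (Ginf m)"
abbreviation mulQ (infixl "\<odot>" 70) where "x \<odot> y \<equiv> x \<otimes>\<^bsub>Ginf m\<^esub> y"
abbreviation invQ where "invQ x \<equiv> inv\<^bsub>Ginf m\<^esub> x"
abbreviation oneQ where "oneQ \<equiv> \<one>\<^bsub>Ginf m\<^esub>"

sublocale P: group "Gp m"
  unfolding Gp_def by (rule group_presented_group)

sublocale Q: group "Ginf m"
  by (rule group_Ginf[OF pos_m])

definition dih :: "gen word set \<Rightarrow> bool \<times> bool \<times> bool" where
  "dih = presented_hom D4 dgen"

lemma Phi_eq: "Phi m = presented_hom (Ginf m) (gen_image m)"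
  by (simp add: fun_eq_iff Phi_def presented_hom_def)

sublocale F: group_hom "Gp m" "Ginf m" "Phi m"
  using presented_group_hom.presented_hom_hom[OF presented_hom_Ginf[OF pos_m even_m]]
  by (unfold_locales) (simp add: Phi_eq Gp_def)

sublocale D: group_hom "Gp m" D4 dih
  using presented_group_hom.presented_hom_hom[OF presented_hom_D4[OF even_m]] group_D4
  by (intro group_hom.intro group_hom_axioms.intro P.group_axioms) (simp_all add: dih_def Gp_def)

definition gcl :: "gen \<Rightarrow> gen word set" where
  "gcl x = word_class gens (rels m) [(x, False)]"

lemma gcl_simps: "gcl (Zgen k) = zp m k" "gcl (Rgen i) = rp m i" "gcl (Egen j) = ep m j"
  by (simp_all add: gcl_def zp_def rp_def ep_def)

lemma gcl_closed: "x \<in> gens \<Longrightarrow> gcl x \<in> G'"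
  by (auto simp: gcl_def Gp_def presented_group_simps)

lemma gen_closed [simp]:
  "k \<in> {1, 2, 3} \<Longrightarrow> zp m k \<in> G'"
  "1 \<le> i \<Longrightarrow> rp m i \<in> G'" "1 \<le> j \<Longrightarrow> ep m j \<in> G'"
  using gcl_closed[of "Zgen k"] gcl_closed[of "Rgen i"] gcl_closed[of "Egen j"]
  by (simp_all add: gcl_simps)

lemma zp_closed [simp]:
  "zp m (Suc 0) \<in> G'" "zp m 2 \<in> G'" "zp m 3 \<in> G'"
  using gen_closed(1)[of 1] gen_closed(1)[of 2] gen_closed(1)[of 3] by simp_all

lemma Phi_gcl: "x \<in> gens \<Longrightarrow> Phi m (gcl x) = gen_image m x"
  unfolding Phi_eq gcl_def
  by (rule presented_group_hom.presented_hom_generator[OF presented_hom_Ginf[OF pos_m even_m]])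

lemma dih_gcl: "x \<in> gens \<Longrightarrow> dih (gcl x) = dgen x"
  unfolding dih_def gcl_def
  by (rule presented_group_hom.presented_hom_generator[OF presented_hom_D4[OF even_m]])

lemma Phi_gens:
  "k \<in> {1, 2, 3} \<Longrightarrow> Phi m (zp m k) = oneQ"
  "1 \<le> i \<Longrightarrow> Phi m (rp m i) = sG m i" "1 \<le> j \<Longrightarrow> Phi m (ep m j) = yG m j"
  using Phi_gcl[of "Zgen k"] Phi_gcl[of "Rgen i"] Phi_gcl[of "Egen j"]
  by (simp_all add: gcl_simps)

lemma dih_gens:
  "k \<in> {1, 2, 3} \<Longrightarrow> dih (zp m k) = (k = 3, False, False)"
  "1 \<le> i \<Longrightarrow> dih (rp m i) = (False, False, True)" "1 \<le> j \<Longrightarrow> dih (ep m j) = (False, True, False)"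
  using dih_gcl[of "Zgen k"] dih_gcl[of "Rgen i"] dih_gcl[of "Egen j"]
  by (simp_all add: gcl_simps)

lemma Gp_induct [consumes 1, case_names one gen inv]:
  assumes "g \<in> G'" and "P oneP"
    and "\<And>g x. g \<in> G' \<Longrightarrow> x \<in> gens \<Longrightarrow> P g \<Longrightarrow> P (g \<cdot> gcl x)"
    and "\<And>g x. g \<in> G' \<Longrightarrow> x \<in> gens \<Longrightarrow> P g \<Longrightarrow> P (g \<cdot> invP (gcl x))"
  shows "P g"
  using assms unfolding Gp_def gcl_def by (rule presented_group_induct)

lemma word_rel:
  assumes "(u, v) \<in> rels m" "u \<in> words gens" "v \<in> words gens"
  shows "word_class gens (rels m) u = word_class gens (rels m) v"
  using assms by (simp add: word_class_eq_iff pres_equiv.rel)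

lemma word_class_Cons:
  assumes "x \<in> gens" "w \<in> words gens"
  shows "word_class gens (rels m) ((x, False) # w) = gcl x \<cdot> word_class gens (rels m) w"
    "word_class gens (rels m) ((x, True) # w) = invP (gcl x) \<cdot> word_class gens (rels m) w"
  using assms word_class_mult[of "[(x, False)]" gens w "rels m"] word_class_mult[of "[(x, True)]" gens w "rels m"]
    word_class_inv_letter[of x gens "rels m"]
  by (simp_all add: gcl_def Gp_def)

lemma word_class_Nil: "word_class gens (rels m) [] = oneP"
  by (simp add: Gp_def presented_group_simps)

lemmas word_class_simps = word_class_Cons word_class_Nil gcl_simps

lemma zp_sq: assumes "k \<in> {1, 2, 3}" shows "zp m k \<cdot> zp m k = oneP"
proof -
  have "(zw k @ zw k, []) \<in> rels m" by (rule rels_z_sq[OF assms])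
  from word_rel[OF this] show ?thesis using assms by (simp add: word_class_simps)
qed

lemma zp_inv: "k \<in> {1, 2, 3} \<Longrightarrow> invP (zp m k) = zp m k"
  by (rule P.inv_equality[OF zp_sq]) auto

lemma zp_gen: assumes "k \<in> {1, 2, 3}" "x \<in> gens" shows "zp m k \<cdot> gcl x = gcl x \<cdot> zp m k"
proof -
  have "(zw k @ [(x, False)], [(x, False)] @ zw k) \<in> rels m" by (rule rels_z_x[OF assms])
  from word_rel[OF this] show ?thesis using assms gcl_closed[OF assms(2)] by (simp add: word_class_simps)
qed

lemma rp_sq: assumes "1 \<le> i" shows "rp m i \<cdot> rp m i = oneP"
proof -
  have "(rw i @ rw i, []) \<in> rels m" by (rule rels_r_sq[OF assms])
  from word_rel[OF this] show ?thesis using assms by (simp add: word_class_simps)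
qed

lemma rp_inv: "1 \<le> i \<Longrightarrow> invP (rp m i) = rp m i"
  by (rule P.inv_equality) (auto simp: rp_sq)

lemma rp_braid:
  assumes "1 \<le> i"
  shows "rp m i \<cdot> (rp m (Suc i) \<cdot> rp m i) = rp m (Suc i) \<cdot> (rp m i \<cdot> rp m (Suc i))"
proof -
  let ?a = "rp m i" and ?b = "rp m (Suc i)"
  have c: "?a \<in> G'" "?b \<in> G'" using assms by auto
  have "(concat (replicate 3 (rw i @ rw (i + 1))), []) \<in> rels m" by (rule rels_braid[OF assms])
  from word_rel[OF this] have "?a \<cdot> (?b \<cdot> (?a \<cdot> (?b \<cdot> (?a \<cdot> ?b)))) = oneP"
    using assms by (simp add: word_class_simps numeral_3_eq_3)
  then have "(?a \<cdot> (?b \<cdot> ?a)) \<cdot> (?b \<cdot> (?a \<cdot> ?b)) = oneP" using c by (simp add: P.m_assoc)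
  then have "invP (?b \<cdot> (?a \<cdot> ?b)) = ?a \<cdot> (?b \<cdot> ?a)"
    using c by (intro P.inv_equality) auto
  then show ?thesis using c assms by (simp add: P.inv_mult_group rp_inv P.m_assoc)
qed

lemma rp_far:
  assumes "1 \<le> i" "1 \<le> j" "i + 2 \<le> j \<or> j + 2 \<le> i"
  shows "rp m i \<cdot> rp m j = zp m 1 \<cdot> (rp m j \<cdot> rp m i)"
proof -
  have "(rw i @ rw j, zw 1 @ rw j @ rw i) \<in> rels m" by (rule rels_r_far[OF assms])
  from word_rel[OF this] show ?thesis using assms by (simp add: word_class_simps)
qed

lemma ep_pow: assumes "1 \<le> j" shows "ep m j \<up> m = oneP"
proof -
  have "word_class gens (rels m) (concat (replicate n (ew j))) = ep m j \<up> n" for n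
  proof (induction n)
    case (Suc n)
    have "concat (replicate n (ew j)) \<in> words gens" using assms by (intro concat_replicate_words) simp
    then have "word_class gens (rels m) (concat (replicate (Suc n) (ew j))) = ep m j \<cdot> (ep m j \<up> n)"
      using Suc assms by (simp add: word_class_simps)
    also have "\<dots> = ep m j \<up> Suc n" using assms by (intro P.nat_pow_Suc2[symmetric]) simp
    finally show ?case .
  qed (simp add: word_class_simps)
  moreover have "(concat (replicate m (ew j)), []) \<in> rels m" by (rule rels_e_pow[OF assms])
  from word_rel[OF this] have "word_class gens (rels m) (concat (replicate m (ew j))) = oneP"
    using assms concat_replicate_words[of "ew j" gens m] by (simp add: word_class_simps)
  ultimately show ?thesis by simp
qed

lemma ep_far:
  assumes "1 \<le> j" "1 \<le> k" "j \<noteq> k"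
  shows "ep m j \<cdot> ep m k = zp m 2 \<cdot> (ep m k \<cdot> ep m j)"
proof -
  have "(ew j @ ew k, zw 2 @ ew k @ ew j) \<in> rels m" by (rule rels_e_far[OF assms])
  from word_rel[OF this] show ?thesis using assms by (simp add: word_class_simps)
qed

lemma rp_ep:
  assumes "1 \<le> i" "1 \<le> j"
  shows "rp m i \<cdot> ep m j = zp m 3 \<cdot> (ep m (swap i (i + 1) j) \<cdot> rp m i)"
proof -
  let ?j = "swap i (i + 1) j"
  have j: "1 \<le> ?j" using transpose_Suc_pos[OF assms] .
  have "(rw i @ ew j @ rw_inv i, zw 3 @ ew ?j) \<in> rels m" by (rule rels_r_e[OF assms])
  from word_rel[OF this] have "rp m i \<cdot> (ep m j \<cdot> invP (rp m i)) = zp m 3 \<cdot> ep m ?j"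
    using assms j by (simp add: word_class_simps)
  then have "rp m i \<cdot> (ep m j \<cdot> invP (rp m i)) \<cdot> rp m i = zp m 3 \<cdot> ep m ?j \<cdot> rp m i" by simp
  then show ?thesis using assms j by (simp add: P.m_assoc)
qed

lemma zp_central:
  assumes "k \<in> {1, 2, 3}" and g: "g \<in> G'"
  shows "zp m k \<cdot> g = g \<cdot> zp m k"
  using g
proof (induction g rule: Gp_induct)
  case one
  then show ?case using assms(1) by simp
next
  case (gen g x)
  have c: "zp m k \<in> G'" "gcl x \<in> G'"
    using assms(1) gcl_closed gen by simp_all
  have "zp m k \<cdot> (g \<cdot> gcl x) = (zp m k \<cdot> g) \<cdot> gcl x" using c gen(1) by (simp add: P.m_assoc)
  also have "\<dots> = g \<cdot> (zp m k \<cdot> gcl x)" unfolding gen(3) using c gen(1) by (simp add: P.m_assoc)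
  also have "\<dots> = g \<cdot> gcl x \<cdot> zp m k"
    unfolding zp_gen[OF assms(1) gen(2)] using c gen(1) by (simp add: P.m_assoc)
  finally show ?case .
next
  case (inv g x)
  have c: "zp m k \<in> G'" "gcl x \<in> G'"
    using assms(1) gcl_closed inv by simp_all
  have i: "zp m k \<cdot> invP (gcl x) = invP (gcl x) \<cdot> zp m k"
    using P.commute_up_to_inv[of "zp m k" "gcl x" "oneP"] c zp_gen[OF assms(1) inv(2)] by simp
  have "zp m k \<cdot> (g \<cdot> invP (gcl x)) = (zp m k \<cdot> g) \<cdot> invP (gcl x)" using c inv(1) by (simp add: P.m_assoc)
  also have "\<dots> = g \<cdot> (zp m k \<cdot> invP (gcl x))" unfolding inv(3) using c inv(1) by (simp add: P.m_assoc)
  also have "\<dots> = g \<cdot> invP (gcl x) \<cdot> zp m k"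
    unfolding i using c inv(1) by (simp add: P.m_assoc)
  finally show ?case .
qed

lemma Zp_central:
  assumes "z \<in> Zp m"
  shows "z \<in> G'" "g \<in> G' \<Longrightarrow> z \<cdot> g = g \<cdot> z"
proof -
  have "z \<in> G' \<and> (\<forall>g\<in>G'. z \<cdot> g = g \<cdot> z)"
    using assms unfolding Zp_def
  proof (induction z rule: generate.induct)
    case (incl h)
    then show ?case using zp_central by auto
  next
    case (inv h)
    then obtain k where "k \<in> {1, 2, 3}" "h = zp m k" by auto
    then show ?case using zp_central[of k] gen_closed(1)[of k] zp_inv[of k] by (simp only:) blast
  next
    case (eng h1 h2)
    have "h1 \<cdot> h2 \<cdot> g = g \<cdot> (h1 \<cdot> h2)" if g: "g \<in> G'" for g
    proof -
      have c: "h1 \<in> G'" "h2 \<in> G'" "h1 \<cdot> g = g \<cdot> h1" "h2 \<cdot> g = g \<cdot> h2"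
        using eng g by blast+
      have "h1 \<cdot> h2 \<cdot> g = (h1 \<cdot> g) \<cdot> h2" using c(1,2) g by (simp add: P.m_assoc c(4))
      also have "\<dots> = g \<cdot> (h1 \<cdot> h2)" unfolding c(3) using c(1,2) g by (simp add: P.m_assoc)
      finally show ?thesis .
    qed
    moreover have "h1 \<cdot> h2 \<in> G'" using eng P.m_closed by blast
    ultimately show ?case by blast
  qed auto
  then show "z \<in> G'" "g \<in> G' \<Longrightarrow> z \<cdot> g = g \<cdot> z" by blast+
qed

lemma zp_Zp: "k \<in> {1, 2, 3} \<Longrightarrow> zp m k \<in> Zp m"
  unfolding Zp_def by (auto intro: generate.incl)

lemma subgroup_Zp: "subgroup (Zp m) (Gp m)"
  unfolding Zp_def by (rule P.generate_is_subgroup) auto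

definition zpow :: "nat \<Rightarrow> bool \<Rightarrow> gen word set" where
  "zpow k b = (if b then zp m k else oneP)"

lemma zpow_Zp: "k \<in> {1, 2, 3} \<Longrightarrow> zpow k b \<in> Zp m"
  using zp_Zp subgroup.one_closed[OF subgroup_Zp] by (simp add: zpow_def)

lemma zpow_mult: "k \<in> {1, 2, 3} \<Longrightarrow> zpow k a \<cdot> zpow k b = zpow k (a \<noteq> b)"
  using zp_sq[of k] by (auto simp: zpow_def)

lemma dih_one: "dih oneP = (False, False, False)"
  using D.hom_one by simp

subsection \<open>Commutators with generators of large index\<close>

text \<open>\<open>odd_ord\<close> and \<open>odd_perm\<close> are the images of \<open>g\<close> in the two factors of
  \<open>D4 / center = Z2 \<times> Z2\<close>.\<close>

definition odd_ord :: "gen word set \<Rightarrow> bool" where "odd_ord g = fst (snd (dih g))"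
definition odd_perm :: "gen word set \<Rightarrow> bool" where "odd_perm g = snd (snd (dih g))"

lemma odd_simps:
  assumes "g \<in> G'"
  shows "h \<in> G' \<Longrightarrow> odd_ord (g \<cdot> h) \<longleftrightarrow> odd_ord g \<noteq> odd_ord h"
    "h \<in> G' \<Longrightarrow> odd_perm (g \<cdot> h) \<longleftrightarrow> odd_perm g \<noteq> odd_perm h"
    "odd_ord (invP g) \<longleftrightarrow> odd_ord g" "odd_perm (invP g) \<longleftrightarrow> odd_perm g"
proof -
  show "odd_ord (g \<cdot> h) \<longleftrightarrow> odd_ord g \<noteq> odd_ord h" if "h \<in> G'"
    using assms that by (cases "dih g"; cases "dih h") (simp add: odd_ord_def)
  show "odd_perm (g \<cdot> h) \<longleftrightarrow> odd_perm g \<noteq> odd_perm h" if "h \<in> G'"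
    using assms that by (cases "dih g"; cases "dih h") (simp add: odd_perm_def)
  show "odd_ord (invP g) \<longleftrightarrow> odd_ord g" "odd_perm (invP g) \<longleftrightarrow> odd_perm g"
    using assms by (cases "dih g"; simp add: odd_ord_def odd_perm_def inv_D4)+
qed

lemma odd_gens:
  "\<not> odd_ord oneP" "\<not> odd_perm oneP"
  "k \<in> {1, 2, 3} \<Longrightarrow> \<not> odd_ord (zp m k)" "k \<in> {1, 2, 3} \<Longrightarrow> \<not> odd_perm (zp m k)"
  "1 \<le> i \<Longrightarrow> \<not> odd_ord (rp m i)" "1 \<le> i \<Longrightarrow> odd_perm (rp m i)"
  "1 \<le> j \<Longrightarrow> odd_ord (ep m j)" "1 \<le> j \<Longrightarrow> \<not> odd_perm (ep m j)"
  by (simp_all only: odd_ord_def odd_perm_def dih_gens dih_one fst_conv snd_conv not_False_eq_True)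

text \<open>The central factors by which \<open>r\<^sub>i\<close> and \<open>\<eta>\<^sub>i\<close>, for large \<open>i\<close>, commute with \<open>g\<close>.\<close>

definition r_comm :: "gen word set \<Rightarrow> gen word set" where
  "r_comm g = zpow 1 (odd_perm g) \<cdot> zpow 3 (odd_ord g)"

definition e_comm :: "gen word set \<Rightarrow> gen word set" where
  "e_comm g = zpow 2 (odd_ord g) \<cdot> zpow 3 (odd_perm g)"

lemma zpow_closed: "k \<in> {1, 2, 3} \<Longrightarrow> zpow k b \<in> G'"
  by (rule Zp_central(1)[OF zpow_Zp])

lemma zpow_central: "k \<in> {1, 2, 3} \<Longrightarrow> g \<in> G' \<Longrightarrow> zpow k b \<cdot> g = g \<cdot> zpow k b"
  by (rule Zp_central(2)[OF zpow_Zp])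

lemma zpow_pair:
  assumes "k \<in> {1, 2, 3}" "l \<in> {1, 2, 3}"
  shows "zpow k a \<cdot> zpow l b \<cdot> (zpow k a' \<cdot> zpow l b') = zpow k (a \<noteq> a') \<cdot> zpow l (b \<noteq> b')"
proof -
  note c = zpow_closed[OF assms(1)] zpow_closed[OF assms(2)]
  have "zpow k a \<cdot> zpow l b \<cdot> (zpow k a' \<cdot> zpow l b') = zpow k a \<cdot> (zpow l b \<cdot> zpow k a') \<cdot> zpow l b'"
    using c by (simp add: P.m_assoc)
  also have "\<dots> = (zpow k a \<cdot> zpow k a') \<cdot> (zpow l b \<cdot> zpow l b')"
    unfolding zpow_central[OF assms(2) c(1)] using c by (simp add: P.m_assoc)
  finally show ?thesis by (simp only: zpow_mult[OF assms(1)] zpow_mult[OF assms(2)])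
qed

lemma comm_Zp: "r_comm g \<in> Zp m" "e_comm g \<in> Zp m"
  using subgroup.m_closed[OF subgroup_Zp] zpow_Zp by (simp_all add: r_comm_def e_comm_def)

lemma comm_mult:
  assumes "g \<in> G'" "h \<in> G'"
  shows "r_comm (g \<cdot> h) = r_comm g \<cdot> r_comm h" "e_comm (g \<cdot> h) = e_comm g \<cdot> e_comm h"
  unfolding r_comm_def e_comm_def odd_simps(1,2)[OF assms] by (simp_all add: zpow_pair)

lemma comm_sq: "r_comm g \<cdot> r_comm g = oneP" "e_comm g \<cdot> e_comm g = oneP"
  unfolding r_comm_def e_comm_def by (simp_all add: zpow_pair) (simp_all add: zpow_def)

lemma comm_inv:
  "g \<in> G' \<Longrightarrow> r_comm (invP g) = r_comm g"
  "g \<in> G' \<Longrightarrow> e_comm (invP g) = e_comm g"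
  by (simp_all add: r_comm_def e_comm_def odd_simps)

lemma comm_trivial:
  "\<not> odd_ord g \<Longrightarrow> \<not> odd_perm g \<Longrightarrow> r_comm g = oneP \<and> e_comm g = oneP"
  by (simp add: r_comm_def e_comm_def zpow_def)

lemma far_commutators_gen:
  assumes x: "x \<in> gens"
  shows "\<forall>\<^sub>F i in sequentially. 1 \<le> i \<and> rp m i \<cdot> gcl x = r_comm (gcl x) \<cdot> (gcl x \<cdot> rp m i)
     \<and> ep m i \<cdot> gcl x = e_comm (gcl x) \<cdot> (gcl x \<cdot> ep m i)"
proof (cases x)
  case (Zgen k)
  then have k: "k \<in> {1, 2, 3}" using x by simp
  then have t: "r_comm (zp m k) = oneP" "e_comm (zp m k) = oneP"
    using comm_trivial[OF odd_gens(3)[OF k] odd_gens(4)[OF k]] by auto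
  have "1 \<le> i \<and> rp m i \<cdot> gcl x = r_comm (gcl x) \<cdot> (gcl x \<cdot> rp m i)
     \<and> ep m i \<cdot> gcl x = e_comm (gcl x) \<cdot> (gcl x \<cdot> ep m i)" if i: "i \<ge> 1" for i
    unfolding Zgen gcl_simps t using i k gen_closed(1)[OF k] zp_central[OF k gen_closed(2)[OF i]] zp_central[OF k gen_closed(3)[OF i]]
    by simp
  then show ?thesis unfolding eventually_sequentially by blast
next
  case (Rgen j)
  then have j: "1 \<le> j" using x by simp
  have r: "r_comm (rp m j) = zp m 1" "e_comm (rp m j) = zp m 3"
    using odd_gens(5,6)[OF j] by (simp_all add: r_comm_def e_comm_def zpow_def)
  have "1 \<le> i \<and> rp m i \<cdot> gcl x = r_comm (gcl x) \<cdot> (gcl x \<cdot> rp m i)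
     \<and> ep m i \<cdot> gcl x = e_comm (gcl x) \<cdot> (gcl x \<cdot> ep m i)" if i: "i \<ge> j + 2" for i
  proof -
    have i1: "1 \<le> i" using i by simp
    have "swap j (j + 1) i = i" using i by (simp add: Transposition.transpose_def)
    then have "zp m 3 \<cdot> (rp m j \<cdot> ep m i) = (zp m 3 \<cdot> zp m 3) \<cdot> (ep m i \<cdot> rp m j)"
      using rp_ep[OF j i1] i1 j by (simp add: P.m_assoc)
    then have "ep m i \<cdot> rp m j = zp m 3 \<cdot> (rp m j \<cdot> ep m i)"
      using zp_sq[of 3] i1 j by simp
    then show ?thesis
      unfolding Rgen gcl_simps r using rp_far[OF i1 j] i i1 by auto
  qed
  then show ?thesis unfolding eventually_sequentially by blast
next
  case (Egen j)
  then have j: "1 \<le> j" using x by simp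
  have r: "r_comm (ep m j) = zp m 3" "e_comm (ep m j) = zp m 2"
    using odd_gens(7,8)[OF j] by (simp_all add: r_comm_def e_comm_def zpow_def)
  have "1 \<le> i \<and> rp m i \<cdot> gcl x = r_comm (gcl x) \<cdot> (gcl x \<cdot> rp m i)
     \<and> ep m i \<cdot> gcl x = e_comm (gcl x) \<cdot> (gcl x \<cdot> ep m i)" if i: "i \<ge> j + 2" for i
  proof -
    have i1: "1 \<le> i" "i \<noteq> j" using i by simp_all
    have "swap i (i + 1) j = j" using i by (simp add: Transposition.transpose_def)
    then show ?thesis
      unfolding Egen gcl_simps r using rp_ep[OF i1(1) j] ep_far[OF i1(1) j i1(2)] i1 by simp
  qed
  then show ?thesis unfolding eventually_sequentially by blast
qed

text \<open>The commutator of \<open>r\<^sub>i\<close> or \<open>\<eta>\<^sub>i\<close> with an element of small support is central, and as a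
  function of that element it is a homomorphism, determined by its values on generators.\<close>

lemma far_commutators:
  assumes "g \<in> G'"
  shows "\<forall>\<^sub>F i in sequentially. 1 \<le> i \<and> rp m i \<cdot> g = r_comm g \<cdot> (g \<cdot> rp m i)
     \<and> ep m i \<cdot> g = e_comm g \<cdot> (g \<cdot> ep m i)"
  using assms
proof (induction g rule: Gp_induct)
  case one
  have "1 \<le> i \<and> rp m i \<cdot> oneP = r_comm oneP \<cdot> (oneP \<cdot> rp m i)
     \<and> ep m i \<cdot> oneP = e_comm oneP \<cdot> (oneP \<cdot> ep m i)" if "1 \<le> i" for i
    using that comm_trivial[OF odd_gens(1) odd_gens(2)] by simp
  then show ?case unfolding eventually_sequentially by blast
next
  case (gen g x)
  have c: "gcl x \<in> G'" using gen gcl_closed by blast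
  show ?case
    using gen(3) far_commutators_gen[OF gen(2)]
  proof eventually_elim
    case (elim i)
    have i: "rp m i \<in> G'" "ep m i \<in> G'" using elim by auto
    note z = Zp_central[OF comm_Zp(1)] Zp_central[OF comm_Zp(2)]
    show ?case
      unfolding comm_mult[OF gen(1) c]
      using elim P.commute_up_to_mult[OF i(1) gen(1) c z(1) z(1) z(2)[OF gen(1), symmetric]]
        P.commute_up_to_mult[OF i(2) gen(1) c z(3) z(3) z(4)[OF gen(1), symmetric]] by blast
  qed
next
  case (inv g x)
  have c: "gcl x \<in> G'" "invP (gcl x) \<in> G'" using inv gcl_closed by auto
  show ?case
    using inv(3) far_commutators_gen[OF inv(2)]
  proof eventually_elim
    case (elim i)
    have i: "rp m i \<in> G'" "ep m i \<in> G'" using elim by auto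
    note z = Zp_central[OF comm_Zp(1)] Zp_central[OF comm_Zp(2)]
    have "rp m i \<cdot> invP (gcl x) = r_comm (invP (gcl x)) \<cdot> (invP (gcl x) \<cdot> rp m i)"
      unfolding comm_inv[OF c(1)]
      using elim by (intro P.commute_up_to_inv[OF i(1) c(1) z(1) comm_sq(1) z(2)]) auto
    moreover have "ep m i \<cdot> invP (gcl x) = e_comm (invP (gcl x)) \<cdot> (invP (gcl x) \<cdot> ep m i)"
      unfolding comm_inv[OF c(1)]
      using elim by (intro P.commute_up_to_inv[OF i(2) c(1) z(3) comm_sq(2) z(4)]) auto
    ultimately show ?case
      unfolding comm_mult[OF inv(1) c(2)]
      using elim P.commute_up_to_mult[OF i(1) inv(1) c(2) z(1) z(1) z(2)[OF inv(1), symmetric]]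
        P.commute_up_to_mult[OF i(2) inv(1) c(2) z(3) z(3) z(4)[OF inv(1), symmetric]] by blast
  qed
qed

text \<open>Multiplying the conjugating element by generators of large index, which commute with \<open>g\<close>,
  adjusts its parities.\<close>

lemma conjugate_by_even:
  assumes g: "g \<in> G'" "\<not> odd_ord g" "\<not> odd_perm g" and h: "h \<in> G'"
  obtains k where "k \<in> G'" "\<not> odd_ord k" "\<not> odd_perm k"
    "k \<cdot> g \<cdot> invP k = h \<cdot> g \<cdot> invP h"
proof -
  obtain i where i: "1 \<le> i" "rp m i \<cdot> g = g \<cdot> rp m i" "ep m i \<cdot> g = g \<cdot> ep m i"
    using eventually_happens'[OF sequentially_bot far_commutators[OF g(1)]] comm_trivial[OF g(2) g(3)] g(1)
    by auto
  define a where "a = (if odd_ord h then ep m i else oneP)"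
  define b where "b = (if odd_perm h then rp m i else oneP)"
  have c: "a \<in> G'" "b \<in> G'" using i by (auto simp: a_def b_def)
  have ag: "a \<cdot> g = g \<cdot> a" "b \<cdot> g = g \<cdot> b" using i g(1) by (auto simp: a_def b_def)
  have "(h \<cdot> (a \<cdot> b)) \<cdot> g = h \<cdot> (a \<cdot> (b \<cdot> g))" using c g(1) h by (simp add: P.m_assoc)
  also have "\<dots> = h \<cdot> ((a \<cdot> g) \<cdot> b)" unfolding ag(2) using c g(1) h by (simp add: P.m_assoc)
  also have "\<dots> = h \<cdot> g \<cdot> (a \<cdot> b)" unfolding ag(1) using c g(1) h by (simp add: P.m_assoc)
  finally have "(h \<cdot> (a \<cdot> b)) \<cdot> g \<cdot> invP (h \<cdot> (a \<cdot> b)) = h \<cdot> g \<cdot> (a \<cdot> b) \<cdot> invP (h \<cdot> (a \<cdot> b))"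
    by simp
  also have "\<dots> = h \<cdot> g \<cdot> ((a \<cdot> b) \<cdot> invP (a \<cdot> b)) \<cdot> invP h"
    using c g(1) h P.inv_mult_group[OF h P.m_closed[OF c]] by (simp only: P.m_assoc P.m_closed P.inv_closed)
  also have "\<dots> = h \<cdot> g \<cdot> invP h" using c g(1) h by simp
  finally have conj: "(h \<cdot> (a \<cdot> b)) \<cdot> g \<cdot> invP (h \<cdot> (a \<cdot> b)) = h \<cdot> g \<cdot> invP h" .
  have "odd_ord a = odd_ord h" "\<not> odd_perm a" "\<not> odd_ord b" "odd_perm b = odd_perm h"
    using odd_gens i(1) by (auto simp: a_def b_def)
  then show thesis
    using c h conj by (intro that[of "h \<cdot> (a \<cdot> b)"]) (simp_all add: odd_simps)
qed

text \<open>An element outside \<open>Kp m\<close> is conjugate to its product with an element of \<open>Z\<close> on which the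
  character is \<open>-1\<close>.\<close>

lemma typed_vanish:
  assumes f: "f \<in> K1 (Gp m)"
    and typed: "\<And>z h. z \<in> Zp m \<Longrightarrow> h \<in> G' \<Longrightarrow> f (z \<cdot> h) = c z * f h"
    and c: "c (zp m 1) = 1" "c (zp m 2) = 1" "c (zp m 3) = -1"
    and g: "g \<in> G'" "odd_ord g \<or> odd_perm g"
  shows "f g = 0"
proof -
  obtain i where i: "1 \<le> i" "rp m i \<cdot> g = r_comm g \<cdot> (g \<cdot> rp m i)" "ep m i \<cdot> g = e_comm g \<cdot> (g \<cdot> ep m i)"
    using eventually_happens'[OF sequentially_bot far_commutators[OF g(1)]] by blast
  have tz: "f (zpow k b \<cdot> h) = (if b then c (zp m k) else 1) * f h" if "k \<in> {1, 2, 3}" "h \<in> G'" for k b h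
    using typed[OF zp_Zp[OF that(1)] that(2)] that(2) by (simp add: zpow_def)
  have conj: "f g = f (v \<cdot> g)"
    if "x \<in> G'" "v \<in> G'" "x \<cdot> g = v \<cdot> (g \<cdot> x)" for x v
  proof -
    have "x \<cdot> g \<cdot> invP x = v \<cdot> g"
      unfolding that(3) using that(1,2) g(1) by (simp add: P.m_assoc)
    then show ?thesis using K1D(4)[OF f g(1) that(1)] by simp
  qed
  have r: "f g = (if odd_ord g then -1 else 1) * f g"
  proof -
    have "f g = f (zpow 1 (odd_perm g) \<cdot> (zpow 3 (odd_ord g) \<cdot> g))"
      using conj[OF gen_closed(2)[OF i(1)] Zp_central(1)[OF comm_Zp(1)] i(2)] g(1)
        zpow_closed[of 1] zpow_closed[of 3] by (simp add: r_comm_def P.m_assoc)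
    also have "\<dots> = (if odd_ord g then -1 else 1) * f g"
      using g(1) zpow_closed[of 3] c by (simp add: tz)
    finally show ?thesis .
  qed
  have e: "f g = (if odd_perm g then -1 else 1) * f g"
  proof -
    have "f g = f (zpow 2 (odd_ord g) \<cdot> (zpow 3 (odd_perm g) \<cdot> g))"
      using conj[OF gen_closed(3)[OF i(1)] Zp_central(1)[OF comm_Zp(2)] i(3)] g(1)
        zpow_closed[of 2] zpow_closed[of 3] by (simp add: e_comm_def P.m_assoc)
    also have "\<dots> = (if odd_perm g then -1 else 1) * f g"
      using g(1) zpow_closed[of 3] c by (simp add: tz)
    finally show ?thesis .
  qed
  show ?thesis
  proof (cases "odd_ord g")
    case True
    then have "f g = - f g" using r by simp
    then show ?thesis by simp
  next
    case False
    then have "f g = - f g" using e g(2) by simp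
    then show ?thesis by simp
  qed
qed

section \<open>Normal forms and the kernel of $\Phi$\<close>

subsection \<open>The subgroup generated by the lifts of the transpositions\<close>

lemma Phi_Zp: "z \<in> Zp m \<Longrightarrow> Phi m z = oneQ"
  unfolding Zp_def
proof (induction z rule: generate.induct)
  case (incl h)
  then show ?case using Phi_gens(1) by auto
next
  case (inv h)
  then obtain k where "k \<in> {1, 2, 3}" "h = zp m k" by auto
  then show ?case using Phi_gens(1) by (simp only: zp_inv)
next
  case (eng h1 h2)
  then have "h1 \<in> G'" "h2 \<in> G'"
    using Zp_central(1) unfolding Zp_def by auto
  then show ?case using eng by simp
qed simp

lemma Zp_mult: "z \<in> Zp m \<Longrightarrow> w \<in> Zp m \<Longrightarrow> z \<cdot> w \<in> Zp m"
  by (rule subgroup.m_closed[OF subgroup_Zp])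

lemma Zp_left_commute:
  assumes "z \<in> Zp m" "g \<in> G'" "h \<in> G'"
  shows "g \<cdot> (z \<cdot> h) = z \<cdot> (g \<cdot> h)"
proof -
  note z = Zp_central(1)[OF assms(1)]
  have "g \<cdot> (z \<cdot> h) = (g \<cdot> z) \<cdot> h" using z assms(2,3) by (simp add: P.m_assoc)
  also have "\<dots> = z \<cdot> (g \<cdot> h)"
    unfolding Zp_central(2)[OF assms(1,2), symmetric] using z assms(2,3) by (simp add: P.m_assoc)
  finally show ?thesis .
qed

text \<open>For \<open>1 \<le> k \<le> n + 1\<close> this is the descending product \<open>r\<^sub>n r\<^sub>n\<^sub>-\<^sub>1 \<dots> r\<^sub>k\<close>, which lifts a cycle that takes
  \<open>k\<close> to \<open>n + 1\<close>.\<close>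

primrec cyc :: "nat \<Rightarrow> nat \<Rightarrow> gen word set" where
  "cyc k 0 = oneP"
| "cyc k (Suc n) = (if k \<le> Suc n then rp m (Suc n) \<cdot> cyc k n else oneP)"

lemma cyc_closed [simp]: "cyc k n \<in> G'"
  by (induction n) auto

lemma cyc_trivial: "n < k \<Longrightarrow> cyc k n = oneP"
  by (cases n) auto

lemma cyc_far:
  assumes "1 \<le> j" "1 \<le> k" "n + 2 \<le> j \<or> j + 2 \<le> k"
  shows "\<exists>z\<in>Zp m. cyc k n \<cdot> rp m j = z \<cdot> (rp m j \<cdot> cyc k n)"
  using assms(3)
proof (induction n)
  case 0
  then show ?case
    using assms by (intro bexI[of _ "oneP"] subgroup.one_closed[OF subgroup_Zp]) auto
next
  case (Suc n)
  show ?case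
  proof (cases "k \<le> Suc n")
    case True
    obtain z where z: "z \<in> Zp m" "cyc k n \<cdot> rp m j = z \<cdot> (rp m j \<cdot> cyc k n)"
      using Suc by auto
    have z1: "zp m 1 \<in> Zp m" by (rule zp_Zp) simp
    note c = Zp_central(1)[OF z(1)] Zp_central(1)[OF z1] gen_closed(2)[OF assms(1)] gen_closed(2)[of "Suc n"]
    have far: "rp m (Suc n) \<cdot> rp m j = zp m 1 \<cdot> (rp m j \<cdot> rp m (Suc n))"
      using Suc.prems assms True by (intro rp_far) auto
    have "cyc k (Suc n) \<cdot> rp m j = rp m (Suc n) \<cdot> (cyc k n \<cdot> rp m j)"
      using True c by (simp add: P.m_assoc)
    also have "\<dots> = z \<cdot> ((rp m (Suc n) \<cdot> rp m j) \<cdot> cyc k n)"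
      unfolding z(2) using c by (simp add: P.m_assoc Zp_left_commute[OF z(1)])
    also have "\<dots> = (z \<cdot> zp m 1) \<cdot> (rp m j \<cdot> cyc k (Suc n))"
      unfolding far using True c by (simp add: P.m_assoc)
    finally show ?thesis using Zp_mult[OF z(1) z1] by blast
  next
    case False
    then show ?thesis
      using assms by (intro bexI[of _ "oneP"] subgroup.one_closed[OF subgroup_Zp]) auto
  qed
qed

lemma cyc_extend:
  assumes "1 \<le> k" "k \<le> n"
  shows "cyc (Suc k) n \<cdot> rp m k = cyc k n"
  using assms(2)
proof (induction n)
  case (Suc n)
  show ?case
  proof (cases "k \<le> n")
    case True
    then have "cyc (Suc k) (Suc n) \<cdot> rp m k = rp m (Suc n) \<cdot> (cyc (Suc k) n \<cdot> rp m k)"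
      using assms by (simp add: P.m_assoc)
    then show ?thesis using Suc True by simp
  next
    case False
    then have "k = Suc n" using Suc by simp
    then show ?thesis by (simp add: cyc_trivial)
  qed
qed (use assms in auto)

lemma cyc_cut:
  assumes "1 \<le> k" "k \<le> n"
  shows "cyc k n \<cdot> rp m k = cyc (Suc k) n"
proof -
  have "cyc k n \<cdot> rp m k = cyc (Suc k) n \<cdot> (rp m k \<cdot> rp m k)"
    unfolding cyc_extend[OF assms, symmetric] using assms by (simp add: P.m_assoc)
  then show ?thesis using assms by (simp add: rp_sq)
qed

text \<open>For \<open>k < i + 1 \<le> n\<close>, moving \<open>r\<^sub>i\<^sub>+\<^sub>1\<close> to the left through the descending product, past the factors of
  smaller index, produces \<open>r\<^sub>i\<^sub>+\<^sub>1 r\<^sub>i r\<^sub>i\<^sub>+\<^sub>1\<close>; the braid relation turns it into \<open>r\<^sub>i r\<^sub>i\<^sub>+\<^sub>1 r\<^sub>i\<close>.\<close>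

lemma cyc_slide:
  assumes "1 \<le> k" "k \<le> i" "Suc i \<le> n"
  shows "\<exists>z\<in>Zp m. cyc k n \<cdot> rp m (Suc i) = z \<cdot> (rp m i \<cdot> cyc k n)"
  using assms(3)
proof (induction n)
  case (Suc n)
  have i1: "1 \<le> i" using assms by simp
  note r = gen_closed(2)[OF i1] gen_closed(2)[of "Suc i"] gen_closed(2)[of "Suc n"]
  show ?case
  proof (cases "i = n")
    case True
    obtain i' where i': "i = Suc i'" using i1 by (cases i) auto
    obtain z where z: "z \<in> Zp m" "cyc k i' \<cdot> rp m (Suc i) = z \<cdot> (rp m (Suc i) \<cdot> cyc k i')"
      using cyc_far[of "Suc i" k i'] assms i' by auto
    note c = r Zp_central(1)[OF z(1)]
    have cyc: "cyc k (Suc n) = rp m (Suc i) \<cdot> (rp m i \<cdot> cyc k i')"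
      using assms i' True by simp
    have "cyc k (Suc n) \<cdot> rp m (Suc i) = rp m (Suc i) \<cdot> (rp m i \<cdot> (cyc k i' \<cdot> rp m (Suc i)))"
      unfolding cyc using c by (simp add: P.m_assoc)
    also have "\<dots> = z \<cdot> ((rp m (Suc i) \<cdot> (rp m i \<cdot> rp m (Suc i))) \<cdot> cyc k i')"
      unfolding z(2) using c by (simp add: P.m_assoc Zp_left_commute[OF z(1)])
    also have "\<dots> = z \<cdot> (rp m i \<cdot> cyc k (Suc n))"
      unfolding rp_braid[OF i1, symmetric] cyc using c by (simp add: P.m_assoc)
    finally show ?thesis using z(1) by blast
  next
    case False
    then have le: "Suc i \<le> n" using Suc.prems by simp
    obtain z where z: "z \<in> Zp m" "cyc k n \<cdot> rp m (Suc i) = z \<cdot> (rp m i \<cdot> cyc k n)"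
      using Suc.IH[OF le] by blast
    have z1: "zp m 1 \<in> Zp m" by (rule zp_Zp) simp
    note c = r Zp_central(1)[OF z(1)] Zp_central(1)[OF z1]
    have far: "rp m (Suc n) \<cdot> rp m i = zp m 1 \<cdot> (rp m i \<cdot> rp m (Suc n))"
      using le i1 by (intro rp_far) auto
    have cyc: "cyc k (Suc n) = rp m (Suc n) \<cdot> cyc k n" using assms le by simp
    have "cyc k (Suc n) \<cdot> rp m (Suc i) = rp m (Suc n) \<cdot> (cyc k n \<cdot> rp m (Suc i))"
      unfolding cyc using c by (simp add: P.m_assoc)
    also have "\<dots> = z \<cdot> ((rp m (Suc n) \<cdot> rp m i) \<cdot> cyc k n)"
      unfolding z(2) using c by (simp add: P.m_assoc Zp_left_commute[OF z(1)])
    also have "\<dots> = (z \<cdot> zp m 1) \<cdot> (rp m i \<cdot> cyc k (Suc n))"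
      unfolding far cyc using c by (simp add: P.m_assoc)
    finally show ?thesis using Zp_mult[OF z(1) z1] by blast
  qed
qed (use assms in auto)

text \<open>Modulo \<open>Z\<close>, these are normal forms for the symmetric group of degree \<open>n + 1\<close> along its chain of
  point stabilizers: the \<open>i\<close>-th factor \<open>cyc k i\<close> represents one of the \<open>i + 1\<close> cosets of the
  group of degree \<open>i\<close> in the group of degree \<open>i + 1\<close>.\<close>

primrec coset_form :: "nat \<Rightarrow> gen word set set" where
  "coset_form 0 = Zp m"
| "coset_form (Suc n) = {t \<cdot> cyc k (Suc n) | t k. t \<in> coset_form n \<and> 1 \<le> k \<and> k \<le> n + 2}"

lemma coset_form_closed: "t \<in> coset_form n \<Longrightarrow> t \<in> G'"
  by (induction n arbitrary: t) (auto simp: Zp_central(1) simp del: cyc.simps)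

lemma coset_form_SucI:
  "t \<in> coset_form n \<Longrightarrow> 1 \<le> k \<Longrightarrow> k \<le> n + 2 \<Longrightarrow> t \<cdot> cyc k (Suc n) \<in> coset_form (Suc n)"
  unfolding coset_form.simps by (rule CollectI, intro exI conjI, rule HOL.refl)

lemma coset_form_Zp: "z \<in> Zp m \<Longrightarrow> t \<in> coset_form n \<Longrightarrow> z \<cdot> t \<in> coset_form n"
proof (induction n arbitrary: t)
  case (Suc n)
  then obtain t' k where t: "t = t' \<cdot> cyc k (Suc n)" "t' \<in> coset_form n" "1 \<le> k" "k \<le> n + 2"
    by (auto simp del: cyc.simps)
  have "z \<cdot> t = (z \<cdot> t') \<cdot> cyc k (Suc n)"
    using Zp_central(1)[OF Suc.prems(1)] coset_form_closed[OF t(2)]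
    by (simp add: t(1) P.m_assoc del: cyc.simps)
  then show ?case
    using coset_form_SucI[OF Suc.IH[OF Suc.prems(1) t(2)] t(3,4)] by (simp del: cyc.simps coset_form.simps)
qed (auto intro: Zp_mult)

lemma coset_form_one: "oneP \<in> coset_form n"
proof (induction n)
  case (Suc n)
  then show ?case using coset_form_SucI[OF Suc, of "n + 2"] by (simp del: coset_form.simps)
qed (auto intro: subgroup.one_closed[OF subgroup_Zp])

text \<open>Right multiplication by \<open>r\<^sub>j\<close> either changes the last cycle \<open>cyc k (Suc n)\<close> by one step, when
  \<open>j\<close> is \<open>k - 1\<close> or \<open>k\<close>, or passes through it and multiplies the
  previous factors by \<open>r\<^sub>j\<close> or \<open>r\<^sub>j\<^sub>-\<^sub>1\<close>.\<close>

lemma coset_form_rp: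
  "t \<in> coset_form n \<Longrightarrow> 1 \<le> j \<Longrightarrow> j \<le> n \<Longrightarrow> t \<cdot> rp m j \<in> coset_form n"
proof (induction n arbitrary: t j)
  case (Suc n)
  obtain t' k where t: "t = t' \<cdot> cyc k (Suc n)" "t' \<in> coset_form n" "1 \<le> k" "k \<le> n + 2"
    using Suc.prems(1) by (auto simp del: cyc.simps)
  note c = coset_form_closed[OF t(2)] gen_closed(2)[OF Suc.prems(2)]
  have tr: "t \<cdot> rp m j = t' \<cdot> (cyc k (Suc n) \<cdot> rp m j)"
    unfolding t(1) using c by (simp add: P.m_assoc del: cyc.simps)
  have slide: "t \<cdot> rp m j \<in> coset_form (Suc n)"
    if "z \<in> Zp m" "cyc k (Suc n) \<cdot> rp m j = z \<cdot> (rp m i \<cdot> cyc k (Suc n))" "1 \<le> i" "i \<le> n" for z i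
  proof -
    have "t \<cdot> rp m j = (z \<cdot> (t' \<cdot> rp m i)) \<cdot> cyc k (Suc n)"
      unfolding tr that(2) using c Zp_central(1)[OF that(1)] gen_closed(2)[OF that(3)]
      by (simp add: P.m_assoc Zp_left_commute[OF that(1)] del: cyc.simps)
    then show ?thesis
      using coset_form_SucI[OF coset_form_Zp[OF that(1) Suc.IH[OF t(2) that(3,4)]] t(3,4)] by (simp del: coset_form.simps cyc.simps)
  qed
  obtain i where i: "j = Suc i" using Suc.prems(2) by (cases j) auto
  consider "j + 2 \<le> k" | "k = Suc j" | "k = j" | "k \<le> i" using i by linarith
  then show ?case
  proof cases
    case 1
    then obtain z where "z \<in> Zp m" "cyc k (Suc n) \<cdot> rp m j = z \<cdot> (rp m j \<cdot> cyc k (Suc n))"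
      using cyc_far[OF Suc.prems(2) t(3), of "Suc n"] by blast
    then show ?thesis using slide[of z j] Suc.prems 1 t(4) by (simp del: coset_form.simps)
  next
    case 2
    have "cyc k (Suc n) \<cdot> rp m j = cyc j (Suc n)"
      unfolding 2 by (rule cyc_extend) (use Suc.prems in auto)
    then show ?thesis using coset_form_SucI[OF t(2), of j] Suc.prems tr by (simp del: coset_form.simps)
  next
    case 3
    have "cyc k (Suc n) \<cdot> rp m j = cyc (Suc j) (Suc n)"
      unfolding 3 by (rule cyc_cut) (use Suc.prems in auto)
    then show ?thesis using coset_form_SucI[OF t(2), of "Suc j"] Suc.prems tr by (simp del: coset_form.simps)
  next
    case 4
    then obtain z where "z \<in> Zp m" "cyc k (Suc n) \<cdot> rp m j = z \<cdot> (rp m i \<cdot> cyc k (Suc n))"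
      using cyc_slide[OF t(3) 4, of "Suc n"] Suc.prems unfolding i by blast
    then show ?thesis using slide[of z i] Suc.prems 4 i t(3) by (simp del: coset_form.simps)
  qed
qed auto

lemma Sp_closed: "\<sigma> \<in> Sp m \<Longrightarrow> \<sigma> \<in> G'"
  unfolding Sp_def by (rule P.generate_in_carrier) auto

lemma Sp_gen_cases:
  assumes "h \<in> {zp m 1} \<union> rp m ` {1..}"
  obtains "h = zp m 1" "invP h = h" | i where "1 \<le> i" "h = rp m i" "invP h = h"
  using assms zp_inv[of 1] rp_inv by auto

lemma coset_form_Sp:
  assumes "\<sigma> \<in> Sp m"
  shows "\<forall>\<^sub>F n in sequentially. \<forall>t\<in>coset_form n. t \<cdot> \<sigma> \<in> coset_form n"
proof -
  have gen: "\<forall>\<^sub>F n in sequentially. \<forall>t\<in>coset_form n. t \<cdot> h \<in> coset_form n"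
    if "h \<in> {zp m 1} \<union> rp m ` {1..}" for h
    using that
  proof (cases rule: Sp_gen_cases)
    case 1
    have z1: "zp m 1 \<in> Zp m" by (rule zp_Zp) simp
    then have "t \<cdot> h \<in> coset_form n" if "t \<in> coset_form n" for t n
      using coset_form_Zp[OF z1 that] Zp_central(2)[OF z1 coset_form_closed[OF that]] 1 by simp
    then show ?thesis by simp
  next
    case (2 i)
    then show ?thesis
      unfolding eventually_sequentially using coset_form_rp by blast
  qed
  show ?thesis
    using assms unfolding Sp_def
  proof (induction \<sigma> rule: generate.induct)
    case one
    then show ?case using coset_form_closed by simp
  next
    case (incl h)
    then show ?case by (rule gen)
  next
    case (inv h)
    have "invP h = h" using inv by (cases rule: Sp_gen_cases) auto
    then show ?case using gen[OF inv] by simp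
  next
    case (eng h1 h2)
    have c: "h1 \<in> G'" "h2 \<in> G'"
      using eng(1,2) Sp_closed by (simp_all add: Sp_def)
    show ?case
      using eng(3,4)
    proof eventually_elim
      case (elim n)
      then show ?case using c coset_form_closed by (auto simp: P.m_assoc[symmetric])
    qed
  qed
qed

definition perm_of :: "gen word set \<Rightarrow> nat \<Rightarrow> nat" where
  "perm_of g = snd (Phi m g)"

lemma perm_of_mult:
  assumes "g \<in> G'" "h \<in> G'"
  shows "perm_of (g \<cdot> h) = perm_of g \<circ> perm_of h"
  unfolding perm_of_def F.hom_mult[OF assms]
  by (cases "Phi m g"; cases "Phi m h") (simp add: mult_Ginf)

lemma perm_of_simps:
  "z \<in> Zp m \<Longrightarrow> perm_of z = id" "perm_of oneP = id"
  "1 \<le> i \<Longrightarrow> perm_of (rp m i) = swap i (Suc i)"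
  using Phi_Zp[of z] F.hom_one Phi_gens(2)[of i] by (simp_all add: perm_of_def one_Ginf sG_def)

lemma perm_of_cyc_first: "1 \<le> k \<Longrightarrow> k \<le> Suc n \<Longrightarrow> perm_of (cyc k n) k = Suc n"
proof (induction n)
  case (Suc n)
  show ?case
  proof (cases "k \<le> Suc n")
    case True
    then have "perm_of (cyc k (Suc n)) k = perm_of (rp m (Suc n)) (perm_of (cyc k n) k)"
      by (simp add: perm_of_mult)
    then show ?thesis using Suc.IH[OF Suc.prems(1) True] by (simp add: perm_of_simps)
  next
    case False
    then show ?thesis using Suc.prems by (simp add: perm_of_simps)
  qed
qed (simp add: perm_of_simps)

lemma perm_of_cyc_fixed: "Suc n < i \<Longrightarrow> perm_of (cyc k n) i = i"
  by (induction n) (auto simp: perm_of_mult perm_of_simps Transposition.transpose_def)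

lemma perm_of_coset_form: "t \<in> coset_form n \<Longrightarrow> Suc n < i \<Longrightarrow> perm_of t i = i"
proof (induction n arbitrary: t)
  case (Suc n)
  then obtain t' k where t: "t = t' \<cdot> cyc k (Suc n)" "t' \<in> coset_form n"
    by (auto simp del: cyc.simps)
  then show ?case
    using Suc.IH[OF t(2)] perm_of_cyc_fixed[OF Suc.prems(2), of k] Suc.prems(2) coset_form_closed[OF t(2)]
    by (simp add: perm_of_mult del: cyc.simps)
qed (simp add: perm_of_simps)

text \<open>In the step from \<open>n\<close> to \<open>n + 1\<close> the earlier factors fix the point \<open>n + 2\<close>, so the cycle \<open>cyc k (Suc n)\<close>, which sends \<open>k\<close> to this point,
  is trivial when the permutation is.\<close>

lemma coset_form_kernel: "t \<in> coset_form n \<Longrightarrow> perm_of t = id \<Longrightarrow> t \<in> Zp m"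
proof (induction n arbitrary: t)
  case (Suc n)
  then obtain t' k where t: "t = t' \<cdot> cyc k (Suc n)" "t' \<in> coset_form n" "1 \<le> k" "k \<le> n + 2"
    by (auto simp del: cyc.simps)
  note c = coset_form_closed[OF t(2)]
  have "perm_of t k = perm_of t' (perm_of (cyc k (Suc n)) k)"
    using c by (simp add: t(1) perm_of_mult del: cyc.simps)
  also have "\<dots> = Suc (Suc n)"
    using perm_of_cyc_first[OF t(3), of "Suc n"] t(4) perm_of_coset_form[OF t(2)]
    by (simp del: cyc.simps)
  finally have "k = Suc (Suc n)" using Suc.prems(2) by simp
  then have "t = t'" using t(1) c by simp
  then show ?case using Suc t(2) by blast
qed auto

lemma Sp_kernel:
  assumes "\<sigma> \<in> Sp m" "perm_of \<sigma> = id"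
  shows "\<sigma> \<in> Zp m"
proof -
  obtain n where "\<forall>t\<in>coset_form n. t \<cdot> \<sigma> \<in> coset_form n"
    using eventually_happens'[OF sequentially_bot coset_form_Sp[OF assms(1)]] by blast
  then have "oneP \<cdot> \<sigma> \<in> coset_form n" using coset_form_one by blast
  then show ?thesis using coset_form_kernel assms Sp_closed by simp
qed

subsection \<open>Normal forms\<close>

lemma eta_prod_closed [simp]: "eta_prod m as n \<in> G'"
  by (induction n) auto

lemma eta_prod_cong: "(\<And>j. 1 \<le> j \<Longrightarrow> j \<le> n \<Longrightarrow> as j = bs j) \<Longrightarrow> eta_prod m as n = eta_prod m bs n"
  by (induction n) auto

lemma eta_prod_pad:
  assumes "n \<le> N"
  obtains bs where "eta_prod m bs N = eta_prod m as n"
proof -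
  let ?bs = "\<lambda>j. if j \<le> n then as j else 0"
  have "eta_prod m ?bs N = eta_prod m ?bs n"
    using assms by (induction N rule: dec_induct) auto
  moreover have "eta_prod m ?bs n = eta_prod m as n" by (rule eta_prod_cong) simp
  ultimately show thesis using that by simp
qed

lemma zpow_left_commute:
  assumes "k \<in> {1, 2, 3}" "g \<in> G'" "h \<in> G'"
  shows "g \<cdot> (zpow k b \<cdot> h) = zpow k b \<cdot> (g \<cdot> h)"
  by (rule Zp_left_commute[OF zpow_Zp[OF assms(1)] assms(2,3)])

lemma zpow_absorb:
  assumes "k \<in> {1, 2, 3}" "g \<in> G'"
  shows "zpow k a \<cdot> (zpow k b \<cdot> g) = zpow k (a \<noteq> b) \<cdot> g"
  using assms by (simp add: P.m_assoc[symmetric] zpow_closed zpow_mult)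

lemma ep_pow_ep:
  assumes "1 \<le> j" "1 \<le> k" "j \<noteq> k"
  shows "\<exists>c. ep m j \<up> (n::nat) \<cdot> ep m k = zpow 2 c \<cdot> (ep m k \<cdot> ep m j \<up> n)"
proof (induction n)
  case 0
  then show ?case using assms by (intro exI[of _ False]) (simp add: zpow_def)
next
  case (Suc n)
  then obtain c where c: "ep m j \<up> n \<cdot> ep m k = zpow 2 c \<cdot> (ep m k \<cdot> ep m j \<up> n)"
    by blast
  have k2: "(2::nat) \<in> {1, 2, 3}" by simp
  have e: "ep m j \<cdot> ep m k = zpow 2 True \<cdot> (ep m k \<cdot> ep m j)"
    using ep_far[OF assms] by (simp add: zpow_def)
  note cl = gen_closed(3)[OF assms(1)] gen_closed(3)[OF assms(2)] P.nat_pow_closed[OF gen_closed(3)[OF assms(1)], of n]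
    zpow_closed[OF k2]
  have "ep m j \<up> Suc n \<cdot> ep m k = ep m j \<up> n \<cdot> (ep m j \<cdot> ep m k)"
    using cl by (simp add: P.m_assoc)
  also have "\<dots> = zpow 2 True \<cdot> ((ep m j \<up> n \<cdot> ep m k) \<cdot> ep m j)"
    unfolding e using cl by (simp add: P.m_assoc zpow_left_commute)
  also have "\<dots> = zpow 2 (True \<noteq> c) \<cdot> (ep m k \<cdot> ep m j \<up> Suc n)"
    unfolding c using cl by (simp add: P.m_assoc zpow_absorb)
  finally show ?case by blast
qed

text \<open>Moving \<open>\<eta>\<^sub>k\<close> to its place among the ordered factors costs only powers of \<open>z\<^sub>2\<close>.\<close>

lemma eta_prod_ep:
  "1 \<le> k \<Longrightarrow> k \<le> n \<Longrightarrow> \<exists>c bs. eta_prod m as n \<cdot> ep m k = zpow 2 c \<cdot> eta_prod m bs n"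
proof (induction n)
  case (Suc n)
  let ?e = "ep m (Suc n) \<up> as (Suc n)"
  have ec: "ep m (Suc n) \<in> G'" "?e \<in> G'" "ep m k \<in> G'"
    using Suc.prems by simp_all
  show ?case
  proof (cases "k = Suc n")
    case True
    let ?bs = "as(Suc n := Suc (as (Suc n)))"
    have "eta_prod m ?bs n = eta_prod m as n" by (rule eta_prod_cong) simp
    then have "eta_prod m as (Suc n) \<cdot> ep m k = zpow 2 False \<cdot> eta_prod m ?bs (Suc n)"
      using True ec by (simp add: zpow_def P.m_assoc)
    then show ?thesis by blast
  next
    case False
    then obtain c bs where IH: "eta_prod m as n \<cdot> ep m k = zpow 2 c \<cdot> eta_prod m bs n"
      using Suc by auto
    obtain d where d: "?e \<cdot> ep m k = zpow 2 d \<cdot> (ep m k \<cdot> ?e)"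
      using ep_pow_ep[of "Suc n" k "as (Suc n)"] Suc.prems False by auto
    let ?bs = "bs(Suc n := as (Suc n))"
    have bs: "eta_prod m ?bs n = eta_prod m bs n" by (rule eta_prod_cong) simp
    have z: "zpow 2 b \<in> G'" for b by (rule zpow_closed) simp
    have "eta_prod m as (Suc n) \<cdot> ep m k = eta_prod m as n \<cdot> (?e \<cdot> ep m k)"
      using ec by (simp add: P.m_assoc)
    also have "\<dots> = zpow 2 d \<cdot> ((eta_prod m as n \<cdot> ep m k) \<cdot> ?e)"
      unfolding d using ec z by (simp add: P.m_assoc zpow_left_commute)
    also have "\<dots> = zpow 2 (d \<noteq> c) \<cdot> eta_prod m ?bs (Suc n)"
      unfolding IH using ec z bs by (simp add: P.m_assoc zpow_absorb)
    finally show ?thesis by blast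
  qed
qed simp

text \<open>Conjugation by a product of the \<open>r\<^sub>i\<close> permutes the \<open>\<eta>\<^sub>k\<close> up to powers of \<open>z\<^sub>3\<close>.\<close>

lemma Sp_ep:
  assumes "\<sigma> \<in> Sp m"
  shows "1 \<le> k \<Longrightarrow> \<exists>c l. 1 \<le> l \<and> \<sigma> \<cdot> ep m k = zpow 3 c \<cdot> (ep m l \<cdot> \<sigma>)"
proof -
  have gen: "\<exists>c l. 1 \<le> l \<and> h \<cdot> ep m k = zpow 3 c \<cdot> (ep m l \<cdot> h)"
    if "h \<in> {zp m 1} \<union> rp m ` {1..}" "1 \<le> k" for h k
    using that(1)
  proof (cases rule: Sp_gen_cases)
    case 1
    have "h \<cdot> ep m k = zpow 3 False \<cdot> (ep m k \<cdot> h)"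
      using zp_central[of 1 "ep m k"] that 1 by (simp add: zpow_def)
    then show ?thesis using that by blast
  next
    case (2 i)
    have "h \<cdot> ep m k = zpow 3 True \<cdot> (ep m (swap i (i + 1) k) \<cdot> h)"
      using rp_ep[OF 2(1) that(2)] 2 by (simp add: zpow_def)
    then show ?thesis using transpose_Suc_pos[OF 2(1) that(2)] by blast
  qed
  show "1 \<le> k \<Longrightarrow> \<exists>c l. 1 \<le> l \<and> \<sigma> \<cdot> ep m k = zpow 3 c \<cdot> (ep m l \<cdot> \<sigma>)"
    using assms unfolding Sp_def
  proof (induction \<sigma> arbitrary: k rule: generate.induct)
    case one
    then have "oneP \<cdot> ep m k = zpow 3 False \<cdot> (ep m k \<cdot> oneP)" by (simp add: zpow_def)
    then show ?case using one by blast
  next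
    case (incl h)
    then show ?case using gen by blast
  next
    case (inv h)
    have "invP h = h" using inv(1) by (cases rule: Sp_gen_cases) auto
    then show ?case using gen[OF inv(1) inv(2)] by simp
  next
    case (eng h1 h2)
    have c: "h1 \<in> G'" "h2 \<in> G'"
      using eng(1,2) Sp_closed by (simp_all add: Sp_def)
    obtain b l where l: "1 \<le> l" "h2 \<cdot> ep m k = zpow 3 b \<cdot> (ep m l \<cdot> h2)" using eng(4)[OF eng(5)] by blast
    obtain d l' where l': "1 \<le> l'" "h1 \<cdot> ep m l = zpow 3 d \<cdot> (ep m l' \<cdot> h1)" using eng(3)[OF l(1)] by blast
    have z: "zpow 3 b \<in> G'" for b by (rule zpow_closed) simp
    note cl = c z gen_closed(3)[OF l(1)] gen_closed(3)[OF l'(1)] gen_closed(3)[OF eng(5)]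
    have "h1 \<cdot> h2 \<cdot> ep m k = h1 \<cdot> (h2 \<cdot> ep m k)" using cl by (simp add: P.m_assoc)
    also have "\<dots> = zpow 3 b \<cdot> ((h1 \<cdot> ep m l) \<cdot> h2)"
      unfolding l(2) using cl by (simp add: P.m_assoc zpow_left_commute)
    also have "\<dots> = zpow 3 (b \<noteq> d) \<cdot> (ep m l' \<cdot> (h1 \<cdot> h2))"
      unfolding l'(2) using cl by (simp add: P.m_assoc zpow_absorb)
    finally show ?case using l'(1) by blast
  qed
qed

lemma Sp_intros:
  "oneP \<in> Sp m" "zp m 1 \<in> Sp m" "1 \<le> i \<Longrightarrow> rp m i \<in> Sp m"
  "\<sigma> \<in> Sp m \<Longrightarrow> \<tau> \<in> Sp m \<Longrightarrow> \<sigma> \<cdot> \<tau> \<in> Sp m"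
  unfolding Sp_def by (auto intro: generate.intros)

definition normal_form :: "gen word set \<Rightarrow> bool" where
  "normal_form g \<longleftrightarrow> (\<exists>a b as n. \<exists>\<sigma>\<in>Sp m. g = zpow 2 a \<cdot> (zpow 3 b \<cdot> (eta_prod m as n \<cdot> \<sigma>)))"

lemma normal_formI:
  "\<sigma> \<in> Sp m \<Longrightarrow> normal_form (zpow 2 a \<cdot> (zpow 3 b \<cdot> (eta_prod m as n \<cdot> \<sigma>)))"
  unfolding normal_form_def by blast

lemma normal_form_Sp: "normal_form g \<Longrightarrow> \<tau> \<in> Sp m \<Longrightarrow> normal_form (g \<cdot> \<tau>)"
proof -
  assume g: "normal_form g" and t: "\<tau> \<in> Sp m"
  obtain a b as n \<sigma> where g: "g = zpow 2 a \<cdot> (zpow 3 b \<cdot> (eta_prod m as n \<cdot> \<sigma>))" and s: "\<sigma> \<in> Sp m"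
    using g unfolding normal_form_def by blast
  have z: "zpow 2 a \<in> G'" "zpow 3 b \<in> G'" by (rule zpow_closed, simp)+
  have "g \<cdot> \<tau> = zpow 2 a \<cdot> (zpow 3 b \<cdot> (eta_prod m as n \<cdot> (\<sigma> \<cdot> \<tau>)))"
    using z Sp_closed[OF s] Sp_closed[OF t] by (simp add: g P.m_assoc)
  then show ?thesis using normal_formI[OF Sp_intros(4)[OF s t]] by simp
qed

lemma normal_form_zpow:
  assumes "normal_form g" "k \<in> {2, 3}"
  shows "normal_form (g \<cdot> zpow k c)"
proof -
  obtain a b as n \<sigma> where g: "g = zpow 2 a \<cdot> (zpow 3 b \<cdot> (eta_prod m as n \<cdot> \<sigma>))" and s: "\<sigma> \<in> Sp m"
    using assms unfolding normal_form_def by blast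
  have z: "zpow 2 a \<in> G'" "zpow 3 b \<in> G'" "zpow k c \<in> G'"
    using assms(2) by (auto intro: zpow_closed)
  have gc: "g \<in> G'" using z Sp_closed[OF s] by (simp add: g)
  have "g \<cdot> zpow k c = zpow k c \<cdot> g" using assms(2) gc by (intro zpow_central[symmetric]) auto
  also have "\<dots> = (if k = 2 then zpow 2 (c \<noteq> a) \<cdot> (zpow 3 b \<cdot> (eta_prod m as n \<cdot> \<sigma>))
      else zpow 2 a \<cdot> (zpow 3 (c \<noteq> b) \<cdot> (eta_prod m as n \<cdot> \<sigma>)))"
  proof (cases "k = 2")
    case True
    then show ?thesis using z Sp_closed[OF s] by (simp add: g zpow_absorb)
  next
    case False
    then have k: "k = 3" using assms(2) by simp
    have "zpow 3 c \<cdot> g = zpow 2 a \<cdot> (zpow 3 c \<cdot> (zpow 3 b \<cdot> (eta_prod m as n \<cdot> \<sigma>)))"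
      unfolding g using z Sp_closed[OF s] k by (intro zpow_left_commute) auto
    then show ?thesis using z Sp_closed[OF s] k by (simp add: zpow_absorb)
  qed
  finally show ?thesis using normal_formI[OF s] by (cases "k = 2") simp_all
qed

lemma normal_form_ep:
  assumes "normal_form g" "1 \<le> k"
  shows "normal_form (g \<cdot> ep m k)"
proof -
  obtain a b as n \<sigma> where g: "g = zpow 2 a \<cdot> (zpow 3 b \<cdot> (eta_prod m as n \<cdot> \<sigma>))" and s: "\<sigma> \<in> Sp m"
    using assms unfolding normal_form_def by blast
  have z: "zpow 2 b \<in> G'" "zpow 3 b \<in> G'" for b by (rule zpow_closed, simp)+
  obtain c l where l: "1 \<le> l" "\<sigma> \<cdot> ep m k = zpow 3 c \<cdot> (ep m l \<cdot> \<sigma>)"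
    using Sp_ep[OF s assms(2)] by blast
  obtain as' where as': "eta_prod m as' (max n l) = eta_prod m as n"
    using eta_prod_pad[of n "max n l"] by auto
  obtain d bs where d: "eta_prod m as n \<cdot> ep m l = zpow 2 d \<cdot> eta_prod m bs (max n l)"
    using eta_prod_ep[OF l(1), of "max n l" as'] as' by auto
  note cl = z Sp_closed[OF s] gen_closed(3)[OF l(1)] gen_closed(3)[OF assms(2)]
  have "g \<cdot> ep m k = zpow 2 a \<cdot> (zpow 3 b \<cdot> (eta_prod m as n \<cdot> (\<sigma> \<cdot> ep m k)))"
    unfolding g using cl by (simp add: P.m_assoc)
  also have "\<dots> = zpow 2 a \<cdot> (zpow 3 (b \<noteq> c) \<cdot> ((eta_prod m as n \<cdot> ep m l) \<cdot> \<sigma>))"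
  proof -
    have "eta_prod m as n \<cdot> (zpow 3 c \<cdot> (ep m l \<cdot> \<sigma>)) = zpow 3 c \<cdot> (eta_prod m as n \<cdot> (ep m l \<cdot> \<sigma>))"
      using cl by (intro zpow_left_commute) auto
    then show ?thesis unfolding l(2) using cl by (simp add: P.m_assoc zpow_absorb)
  qed
  also have "\<dots> = zpow 2 (a \<noteq> d) \<cdot> (zpow 3 (b \<noteq> c) \<cdot> (eta_prod m bs (max n l) \<cdot> \<sigma>))"
  proof -
    have "zpow 3 (b \<noteq> c) \<cdot> (zpow 2 d \<cdot> (eta_prod m bs (max n l) \<cdot> \<sigma>))
        = zpow 2 d \<cdot> (zpow 3 (b \<noteq> c) \<cdot> (eta_prod m bs (max n l) \<cdot> \<sigma>))"
      using cl by (intro zpow_left_commute) auto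
    then show ?thesis unfolding d using cl by (simp add: P.m_assoc zpow_absorb)
  qed
  finally show ?thesis using normal_formI[OF s] by simp
qed

text \<open>The set of normal forms contains the identity and is closed under right multiplication by each
  generator; the inverse of a generator is one of its powers.\<close>

lemma normal_form:
  assumes "g \<in> G'"
  shows "normal_form g"
proof -
  have pos: "normal_form (g \<cdot> gcl x)" if g: "g \<in> G'" and x: "x \<in> gens" and nf: "normal_form g" for g x
  proof (cases x)
    case (Zgen k)
    then consider "k = 1" | "k \<in> {2, 3}" using x by auto
    then show ?thesis
    proof cases
      case 1
      then show ?thesis using normal_form_Sp[OF nf Sp_intros(2)] Zgen by (simp add: gcl_simps)
    next
      case 2
      then show ?thesis using normal_form_zpow[OF nf 2, of True] Zgen by (simp add: gcl_simps zpow_def)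
    qed
  next
    case (Rgen i)
    then show ?thesis using normal_form_Sp[OF nf Sp_intros(3)] x by (simp add: gcl_simps)
  next
    case (Egen j)
    then show ?thesis using normal_form_ep[OF nf] x by (simp add: gcl_simps)
  qed
  have pow: "normal_form (g \<cdot> gcl x \<up> (n::nat))"
    if g: "g \<in> G'" and x: "x \<in> gens" and nf: "normal_form g" for g x n
  proof (induction n)
    case (Suc n)
    have "g \<cdot> gcl x \<up> n \<in> G'" using g gcl_closed[OF x] by simp
    from pos[OF this x Suc] show ?case using g gcl_closed[OF x] by (simp add: P.m_assoc)
  qed (use g nf in simp)
  have inv_pow: "\<exists>n::nat. invP (gcl x) = gcl x \<up> n" if x: "x \<in> gens" for x
  proof (cases x)
    case (Zgen k)
    then show ?thesis using zp_inv[of k] x gcl_closed[OF x] by (intro exI[of _ 1]) (simp add: gcl_simps)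
  next
    case (Rgen i)
    then show ?thesis using rp_inv[of i] x gcl_closed[OF x] by (intro exI[of _ 1]) (simp add: gcl_simps)
  next
    case (Egen j)
    then have j: "1 \<le> j" using x by simp
    have "ep m j \<up> (m - 1) \<cdot> ep m j = ep m j \<up> Suc (m - 1)" by simp
    also have "\<dots> = oneP" using ep_pow[OF j] pos_m by simp
    finally have "invP (ep m j) = ep m j \<up> (m - 1)"
      using j by (intro P.inv_equality) auto
    then show ?thesis unfolding Egen gcl_simps by blast
  qed
  show ?thesis
    using assms
  proof (induction g rule: Gp_induct)
    case one
    have "oneP = zpow 2 False \<cdot> (zpow 3 False \<cdot> (eta_prod m as 0 \<cdot> oneP))" for as
      by (simp add: zpow_def)
    then show ?case using normal_formI[OF Sp_intros(1)] by metis
  next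
    case (gen g x)
    then show ?case by (rule pos)
  next
    case (inv g x)
    then show ?case using inv_pow[OF inv(2)] pow by metis
  qed
qed

lemma dih_eta_prod: "\<exists>a. dih (eta_prod m as n) = (False, a, False)"
proof (induction n)
  case 0
  then show ?case using dih_one by (intro exI[of _ False]) simp
next
  case (Suc n)
  have "\<exists>a. dih (ep m (Suc n) \<up> k) = (False, a, False)" for k :: nat
  proof (induction k)
    case 0
    then show ?case using dih_one by (intro exI[of _ False]) simp
  next
    case (Suc k)
    then obtain a where "dih (ep m (Suc n) \<up> k) = (False, a, False)" by blast
    then show ?case using dih_gens(3)[of "Suc n"] by (intro exI[of _ "\<not> a"]) simp
  qed
  then obtain b where "dih (ep m (Suc n) \<up> as (Suc n)) = (False, b, False)" by blast
  moreover obtain a where "dih (eta_prod m as n) = (False, a, False)" using Suc by blast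
  ultimately show ?case by (intro exI[of _ "a \<noteq> b"]) simp
qed

lemma dih_Sp:
  assumes "\<sigma> \<in> Sp m" shows "\<exists>s. dih \<sigma> = (False, False, s)"
  using assms unfolding Sp_def
proof (induction \<sigma> rule: generate.induct)
  case one
  then show ?case using dih_one by (intro exI[of _ False]) simp
next
  case (incl h)
  then show ?case by (cases rule: Sp_gen_cases) (auto simp: dih_gens)
next
  case (inv h)
  then show ?case by (cases rule: Sp_gen_cases) (auto simp: dih_gens)
next
  case (eng h1 h2)
  have "h1 \<in> G'" "h2 \<in> G'"
    using eng(1,2) Sp_closed by (simp_all add: Sp_def)
  moreover obtain s t where "dih h1 = (False, False, s)" "dih h2 = (False, False, t)"
    using eng(3,4) by blast
  ultimately show ?case by (intro exI[of _ "s \<noteq> t"]) simp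
qed

lemma dih_zpow: "k \<in> {1, 2, 3} \<Longrightarrow> dih (zpow k b) = (b \<and> k = 3, False, False)"
  using dih_gens(1)[of k] dih_one by (auto simp: zpow_def)

lemma dih_normal_form:
  assumes "\<sigma> \<in> Sp m"
  shows "fst (dih (zpow 2 a \<cdot> (zpow 3 b \<cdot> (eta_prod m as n \<cdot> \<sigma>)))) = b"
proof -
  have z: "zpow 2 a \<in> G'" "zpow 3 b \<in> G'" by (rule zpow_closed, simp)+
  show ?thesis
  proof -
    obtain c s where "dih (eta_prod m as n) = (False, c, False)" "dih \<sigma> = (False, False, s)"
      using dih_eta_prod[of as n] dih_Sp[OF assms] by blast
    then show ?thesis using z Sp_closed[OF assms] dih_zpow[of 2 a] dih_zpow[of 3 b] by simp
  qed
qed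

lemma zp_nat_pow:
  assumes "k \<in> {1, 2, 3}"
  shows "zp m k \<up> (n::nat) = zpow k (odd n)"
proof (induction n)
  case (Suc n)
  then show ?case using zpow_mult[OF assms, of "odd n" True] by (simp add: zpow_def[of k True] del: One_nat_def)
qed (simp add: zpow_def)

text \<open>The central component of the dihedral image of a normal form is the exponent of \<open>z\<^sub>3\<close>, so this
  exponent is the same for all normal forms of \<open>g\<close>.\<close>

lemma z3_exp_eq:
  assumes "g \<in> G'"
  shows "z3_exp m g = of_bool (fst (dih g))"
proof -
  have eq: "zp m 2 \<up> (a::nat) \<cdot> zp m 3 \<up> (b::nat) \<cdot> eta_prod m as n \<cdot> \<sigma>
      = zpow 2 (odd a) \<cdot> (zpow 3 (odd b) \<cdot> (eta_prod m as n \<cdot> \<sigma>))" if "\<sigma> \<in> Sp m" for a b as n \<sigma>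
  proof -
    have z: "zpow 2 (odd a) \<in> G'" "zpow 3 (odd b) \<in> G'" by (rule zpow_closed, simp)+
    show ?thesis using z Sp_closed[OF that] by (simp add: zp_nat_pow P.m_assoc)
  qed
  obtain a b as n \<sigma> where g: "g = zpow 2 a \<cdot> (zpow 3 b \<cdot> (eta_prod m as n \<cdot> \<sigma>))" and s: "\<sigma> \<in> Sp m"
    using normal_form[OF assms] unfolding normal_form_def by blast
  show ?thesis
    unfolding z3_exp_def
  proof (rule the_equality)
    have "b = fst (dih g)" unfolding g by (rule dih_normal_form[OF s, symmetric])
    then have "g = zp m 2 \<up> (of_bool a :: nat) \<cdot> zp m 3 \<up> (of_bool (fst (dih g)) :: nat) \<cdot> eta_prod m as n \<cdot> \<sigma>"
      unfolding eq[OF s] using g by simp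
    then show "of_bool (fst (dih g)) \<in> {0, 1::nat} \<and> (\<exists>a as n. \<exists>\<sigma>\<in>Sp m. g = zp m 2 \<up> (a::nat) \<cdot>
        zp m 3 \<up> (of_bool (fst (dih g)) :: nat) \<cdot> eta_prod m as n \<cdot> \<sigma>)"
      using s by (intro conjI) (simp, blast)
  next
    fix b' :: nat
    assume "b' \<in> {0, 1} \<and> (\<exists>a as n. \<exists>\<sigma>\<in>Sp m. g = zp m 2 \<up> (a::nat) \<cdot>
        zp m 3 \<up> b' \<cdot> eta_prod m as n \<cdot> \<sigma>)"
    then obtain a' as' n' \<sigma>' where b': "b' \<in> {0, 1}" and s': "\<sigma>' \<in> Sp m"
      and "g = zp m 2 \<up> (a'::nat) \<cdot> zp m 3 \<up> b' \<cdot> eta_prod m as' n' \<cdot> \<sigma>'"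
      by blast
    then have "fst (dih g) = odd b'" using eq[OF s'] dih_normal_form[OF s'] by simp
    then show "b' = of_bool (fst (dih g))" using b' by auto
  qed
qed

lemma Phi_eta_prod:
  "Phi m (eta_prod m as n) = ((\<lambda>j\<in>{1..}. if j \<le> n then int (as j) mod int m else 0), id)"
proof (induction n)
  case 0
  then show ?case using F.hom_one by (auto simp: one_Ginf one_Dinf intro!: restrict_ext)
next
  case (Suc n)
  have pw: "Phi m (ep m (Suc n) \<up> k) = yG m (Suc n) [^]\<^bsub>Ginf m\<^esub> k" for k :: nat
    by (induction k) (simp_all add: Phi_gens)
  have "Phi m (eta_prod m as (Suc n)) = Phi m (eta_prod m as n) \<odot> (yG m (Suc n) [^]\<^bsub>Ginf m\<^esub> as (Suc n))"
    using pw by simp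
  also have "\<dots> = ((\<lambda>j\<in>{1..}. if j \<le> Suc n then int (as j) mod int m else 0), id)"
    unfolding Suc yG_pow[OF pos_m even_m, of "Suc n", simplified]
    by (auto simp: mult_Ginf mult_Dinf perm_act_def fun_eq_iff)
  finally show ?case .
qed

lemma Phi_Sp: "\<sigma> \<in> Sp m \<Longrightarrow> Phi m \<sigma> = (\<one>\<^bsub>Dinf m\<^esub>, perm_of \<sigma>)"
proof -
  assume s: "\<sigma> \<in> Sp m"
  interpret D: group "Dinf m" by (rule group_Dinf)
  have "fst (Phi m \<sigma>) = \<one>\<^bsub>Dinf m\<^esub>"
    using s unfolding Sp_def
  proof (induction \<sigma> rule: generate.induct)
    case one
    then show ?case using F.hom_one by (simp add: one_Ginf)
  next
    case (incl h)
    then show ?case by (cases rule: Sp_gen_cases) (auto simp: Phi_gens one_Ginf sG_def)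
  next
    case (inv h)
    then show ?case by (cases rule: Sp_gen_cases) (auto simp: Phi_gens one_Ginf sG_def)
  next
    case (eng h1 h2)
    have c: "h1 \<in> G'" "h2 \<in> G'"
      using eng(1,2) Sp_closed by (simp_all add: Sp_def)
    have "snd (Phi m h1) \<in> Sinf" using F.hom_closed[OF c(1)] by (auto simp: carrier_Ginf)
    then show ?case
      using eng(3,4) unfolding F.hom_mult[OF c]
      by (cases "Phi m h1"; cases "Phi m h2") (simp add: mult_Ginf perm_act_one[OF pos_m])
  qed
  then show ?thesis by (simp add: perm_of_def prod_eq_iff)
qed

text \<open>In a normal form of an element of the kernel the exponents of the \<open>\<eta>\<^sub>j\<close> are divisible by \<open>m\<close> and
  the factor in \<open>Sp m\<close> lies over the identity permutation.\<close>

lemma Phi_kernel: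
  assumes g: "g \<in> G'" and "Phi m g = oneQ"
  shows "g \<in> Zp m"
proof -
  obtain a b as n \<sigma> where nf: "g = zpow 2 a \<cdot> (zpow 3 b \<cdot> (eta_prod m as n \<cdot> \<sigma>))" and s: "\<sigma> \<in> Sp m"
    using normal_form[OF g] unfolding normal_form_def by blast
  have zZ: "zpow 2 a \<in> Zp m" "zpow 3 b \<in> Zp m" by (rule zpow_Zp, simp)+
  note z = Zp_central(1)[OF zZ(1)] Zp_central(1)[OF zZ(2)]
  have ps: "perm_of \<sigma> \<in> Sinf"
    using F.hom_closed[OF Sp_closed[OF s]] by (auto simp: carrier_Ginf perm_of_def)
  have "Phi m g = Phi m (eta_prod m as n) \<odot> Phi m \<sigma>"
    unfolding nf using z Sp_closed[OF s] Phi_Zp[OF zZ(1)] Phi_Zp[OF zZ(2)] by simp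
  then have eq: "((\<lambda>j\<in>{1..}. if j \<le> n then int (as j) mod int m else 0), perm_of \<sigma>) = (\<one>\<^bsub>Dinf m\<^esub>, id)"
    unfolding assms(2) one_Ginf Phi_eta_prod Phi_Sp[OF s] mult_Ginf
    by (auto simp: mult_Dinf one_Dinf perm_act_def fun_eq_iff split: if_splits)
  have "int (as j) mod int m = 0" if "1 \<le> j" "j \<le> n" for j
    using fun_cong[of _ _ j, OF arg_cong[OF eq, of fst]] that by (simp add: one_Dinf)
  then have dv: "m dvd as j" if "1 \<le> j" "j \<le> n" for j
    using that by (metis dvd_eq_mod_eq_0 int_dvd_int_iff)
  have "eta_prod m as n = oneP"
    using dv
  proof (induction n)
    case (Suc n)
    obtain q where "as (Suc n) = m * q" using Suc.prems[of "Suc n"] by auto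
    then have "ep m (Suc n) \<up> as (Suc n) = oneP"
      using ep_pow[of "Suc n"] P.nat_pow_pow[of "ep m (Suc n)" m q] by simp
    moreover have "eta_prod m as n = oneP" using Suc by simp
    ultimately show ?case by simp
  qed simp
  moreover have "\<sigma> \<in> Zp m" using Sp_kernel[OF s] eq by simp
  ultimately show ?thesis unfolding nf using Zp_mult zZ Sp_closed[OF s] by simp
qed

subsection \<open>Surjectivity of $\Phi$\<close>

text \<open>Adjacent transpositions generate the finite permutations, and \<open>eta_prod\<close> reaches every element of
  \<open>Dinf m\<close>.\<close>

lemma Phi_surj: "Phi m ` G' = G"
proof (intro equalityI subsetI)
  fix x assume "x \<in> Phi m ` G'"
  then show "x \<in> G" using F.hom_closed by auto
next
  interpret D: group "Dinf m" by (rule group_Dinf)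
  define R where "R \<tau> \<longleftrightarrow> \<tau> \<in> Sinf \<and> (\<exists>g\<in>G'. Phi m g = (\<one>\<^bsub>Dinf m\<^esub>, \<tau>))" for \<tau>
  have R_comp: "R (\<sigma> \<circ> \<tau>)" if st: "R \<sigma>" "R \<tau>" for \<sigma> \<tau>
  proof -
    obtain g h where gh: "g \<in> G'" "h \<in> G'"
      "Phi m g = (\<one>\<^bsub>Dinf m\<^esub>, \<sigma>)" "Phi m h = (\<one>\<^bsub>Dinf m\<^esub>, \<tau>)"
      using st unfolding R_def by blast
    have "Phi m (g \<cdot> h) = (\<one>\<^bsub>Dinf m\<^esub>, \<sigma> \<circ> \<tau>)"
      unfolding F.hom_mult[OF gh(1,2)] gh(3,4) mult_Ginf
      using st by (simp add: R_def perm_act_one[OF pos_m])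
    then show ?thesis
      using st Sinf_comp P.m_closed[OF gh(1,2)] unfolding R_def by blast
  qed
  have R_adj: "R (swap i (Suc i))" if "1 \<le> i" for i
    using that Phi_gens(2)[OF that] transpose_Suc_Sinf[OF that]
    by (auto simp: R_def sG_def intro!: bexI[of _ "rp m i"])
  have R_less: "R (swap a b)" if a: "1 \<le> a" and ab: "a < b" for a b
    using ab
  proof (induction b)
    case (Suc b)
    show ?case
    proof (cases "a = b")
      case True
      then show ?thesis using R_adj a by simp
    next
      case False
      then have "R (swap a b)" "1 \<le> b" using Suc a by auto
      then have "R (swap b (Suc b) \<circ> (swap a b \<circ> swap b (Suc b)))"
        using R_comp R_adj by blast
      moreover have "swap b (Suc b) \<circ> (swap a b \<circ> swap b (Suc b))
          = swap a (Suc b)"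
        using Suc.prems False by (auto simp: fun_eq_iff Transposition.transpose_def)
      ultimately show ?thesis by simp
    qed
  qed simp
  have R_transp: "R (swap a b)" if "1 \<le> a" "1 \<le> b" "a \<noteq> b" for a b
    using R_less[of a b] R_less[of b a] that by (cases "a < b") (auto simp: transpose_commute)
  have R_all: "R \<sigma>" if s: "\<sigma> \<in> Sinf" for \<sigma>
  proof -
    let ?S = "{i. \<sigma> i \<noteq> i}"
    have "\<sigma> permutes ?S" unfolding permutes_def using s by (auto simp: Sinf_iff bij_iff)
    moreover have "finite ?S" using s by (simp add: Sinf_iff)
    ultimately show ?thesis
    proof (induction rule: permutes_induct)
      case id
      show ?case
        unfolding R_def by (intro conjI Sinf_id bexI[of _ "oneP"]) (simp_all only: F.hom_one one_Ginf P.one_closed)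
    next
      case (swap a b p)
      have "1 \<le> i" if "i \<in> ?S" for i using that s by (cases i) (auto simp: Sinf_iff)
      then show ?case using swap R_comp R_transp by blast
    qed
  qed
  fix x assume "x \<in> G"
  then obtain d \<sigma> where x: "x = (d, \<sigma>)" and d: "d \<in> carrier (Dinf m)" and s: "\<sigma> \<in> Sinf"
    by (auto simp: carrier_Ginf)
  have "\<exists>n. {i. 1 \<le> i \<and> d i \<noteq> 0} \<subseteq> {..n}"
    using d by (simp add: carrier_Dinf[OF pos_m] finite_nat_iff_bounded_le)
  then obtain n where n: "\<And>i. 1 \<le> i \<Longrightarrow> d i \<noteq> 0 \<Longrightarrow> i \<le> n" by blast
  have "Phi m (eta_prod m (\<lambda>j. nat (d j)) n) = (d, id)"
    unfolding Phi_eta_prod prod.inject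
  proof (intro conjI HOL.refl ext)
    fix j
    have "d j = 0" if "n < j" using n[of j] that by fastforce
    then show "(\<lambda>j\<in>{1..}. if j \<le> n then int (nat (d j)) mod int m else 0) j = d j"
      using d by (auto simp: carrier_Dinf[OF pos_m] extensional_def)
  qed
  moreover obtain h where h: "h \<in> G'" "Phi m h = (\<one>\<^bsub>Dinf m\<^esub>, \<sigma>)"
    using R_all[OF s] unfolding R_def by blast
  ultimately have "Phi m (eta_prod m (\<lambda>j. nat (d j)) n \<cdot> h) = x"
    using d by (simp add: x mult_Ginf perm_act_one[OF pos_m])
  then show "x \<in> Phi m ` G'"
    by (rule image_eqI[OF HOL.sym]) (use h(1) in simp)
qed

end

section \<open>Twisting by a sign character\<close>

text \<open>The Gram matrices of \<open>f\<close> and \<open>F\<close> differ by conjugation with a diagonal matrix of signs.\<close>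

lemma K1_twist_iff:
  fixes H (structure) and \<epsilon> :: "'a \<Rightarrow> complex"
  assumes "group_hom H H' \<Phi>" and surj: "\<Phi> ` carrier H = carrier H'"
    and mult: "\<And>x y. x \<in> carrier H \<Longrightarrow> y \<in> carrier H \<Longrightarrow> \<epsilon> (x \<otimes> y) = \<epsilon> x * \<epsilon> y"
    and sign: "\<And>x. x \<in> carrier H \<Longrightarrow> \<epsilon> x = 1 \<or> \<epsilon> x = -1"
    and ext: "f \<in> extensional (carrier H)" "F \<in> extensional (carrier H')"
    and fF: "\<And>x. x \<in> carrier H \<Longrightarrow> f x = \<epsilon> x * F (\<Phi> x)"
  shows "f \<in> K1 H \<longleftrightarrow> F \<in> K1 H'"
proof -
  interpret group_hom H H' \<Phi> by fact
  have sq: "\<epsilon> x * \<epsilon> x = 1" and cnj: "cnj (\<epsilon> x) = \<epsilon> x" if "x \<in> carrier H" for x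
    using sign[OF that] by auto
  have one: "\<epsilon> \<one> = 1" using mult[of \<one> \<one>] sq[of \<one>] by simp
  have inv: "\<epsilon> (inv x) = \<epsilon> x" if "x \<in> carrier H" for x
  proof -
    have "\<epsilon> (inv x) * \<epsilon> x = 1" using mult[of "inv x" x] that one by simp
    then have "\<epsilon> (inv x) * (\<epsilon> x * \<epsilon> x) = \<epsilon> x" by (simp add: mult.assoc[symmetric])
    then show ?thesis using sq[OF that] by simp
  qed
  have gram: "(\<Sum>i<n. \<Sum>j<n. c i * cnj (c j) * f (inv (g j) \<otimes> g i))
      = (\<Sum>i<n. \<Sum>j<n. (c i * \<epsilon> (g i)) * cnj (c j * \<epsilon> (g j)) *
          F (inv\<^bsub>H'\<^esub> (\<Phi> (g j)) \<otimes>\<^bsub>H'\<^esub> \<Phi> (g i)))"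
    if "\<And>i. i < n \<Longrightarrow> g i \<in> carrier H" for n :: nat and g c
    using that by (intro sum.cong HOL.refl) (simp add: fF mult inv cnj mult_ac)
  have "pos_def_on H f \<longleftrightarrow> pos_def_on H' F"
  proof
    assume f: "pos_def_on H f"
    show "pos_def_on H' F"
      unfolding pos_def_on_def
    proof (intro allI impI)
      fix n :: nat and p c assume p: "\<forall>i<n. p i \<in> carrier H'"
      then have "\<forall>i. \<exists>x. i < n \<longrightarrow> x \<in> carrier H \<and> p i = \<Phi> x" using surj by blast
      then obtain g where g: "\<And>i. i < n \<Longrightarrow> g i \<in> carrier H" "\<And>i. i < n \<Longrightarrow> p i = \<Phi> (g i)"
        by metis
      have "(\<Sum>i<n. \<Sum>j<n. (c i * \<epsilon> (g i)) * cnj (c j * \<epsilon> (g j)) * f (inv (g j) \<otimes> g i)) \<in> \<real>\<^sub>\<ge>\<^sub>0"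
        by (rule pos_def_on_sum[OF f]) (use g in auto)
      also have "(\<Sum>i<n. \<Sum>j<n. (c i * \<epsilon> (g i)) * cnj (c j * \<epsilon> (g j)) * f (inv (g j) \<otimes> g i))
          = (\<Sum>i<n. \<Sum>j<n. c i * cnj (c j) * F (inv\<^bsub>H'\<^esub> (p j) \<otimes>\<^bsub>H'\<^esub> p i))"
      proof (intro sum.cong HOL.refl)
        fix i j assume "i \<in> {..<n}" "j \<in> {..<n}"
        then have ij: "g i \<in> carrier H" "g j \<in> carrier H" "p i = \<Phi> (g i)" "p j = \<Phi> (g j)"
          using g by auto
        then have "f (inv (g j) \<otimes> g i) = \<epsilon> (g j) * \<epsilon> (g i) * F (inv\<^bsub>H'\<^esub> (p j) \<otimes>\<^bsub>H'\<^esub> p i)"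
          by (simp add: fF mult inv)
        then show "(c i * \<epsilon> (g i)) * cnj (c j * \<epsilon> (g j)) * f (inv (g j) \<otimes> g i)
            = c i * cnj (c j) * F (inv\<^bsub>H'\<^esub> (p j) \<otimes>\<^bsub>H'\<^esub> p i)"
          using sign[OF ij(1)] sign[OF ij(2)] by auto
      qed
      finally show "(\<Sum>i<n. \<Sum>j<n. c i * cnj (c j) * F (inv\<^bsub>H'\<^esub> (p j) \<otimes>\<^bsub>H'\<^esub> p i)) \<in> \<real>\<^sub>\<ge>\<^sub>0" .
    qed
  next
    assume F: "pos_def_on H' F"
    show "pos_def_on H f"
      unfolding pos_def_on_def
    proof (intro allI impI)
      fix n :: nat and g c assume "\<forall>i<n. g i \<in> carrier H"
      then have g: "g i \<in> carrier H" if "i < n" for i using that by blast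
      show "(\<Sum>i<n. \<Sum>j<n. c i * cnj (c j) * f (inv (g j) \<otimes> g i)) \<in> \<real>\<^sub>\<ge>\<^sub>0"
        by (subst gram, rule g, assumption) (rule pos_def_on_sum[OF F], use g in auto)
    qed
  qed
  moreover have "f (h \<otimes> x \<otimes> inv h) = f x \<longleftrightarrow>
      F (\<Phi> h \<otimes>\<^bsub>H'\<^esub> \<Phi> x \<otimes>\<^bsub>H'\<^esub> inv\<^bsub>H'\<^esub> (\<Phi> h)) = F (\<Phi> x)"
    if x: "x \<in> carrier H" and h: "h \<in> carrier H" for x h
  proof -
    have "\<epsilon> (h \<otimes> x \<otimes> inv h) = \<epsilon> x" using x h sq[OF h] by (simp add: mult inv mult_ac)
    then show ?thesis using sign[OF x] x h by (auto simp: fF)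
  qed
  moreover have "f \<one> = F \<one>\<^bsub>H'\<^esub>" using fF[of \<one>] one by simp
  moreover have "(\<forall>x\<in>carrier H'. \<forall>h\<in>carrier H'. F (h \<otimes>\<^bsub>H'\<^esub> x \<otimes>\<^bsub>H'\<^esub> inv\<^bsub>H'\<^esub> h) = F x) \<longleftrightarrow>
      (\<forall>x\<in>carrier H. \<forall>h\<in>carrier H.
        F (\<Phi> h \<otimes>\<^bsub>H'\<^esub> \<Phi> x \<otimes>\<^bsub>H'\<^esub> inv\<^bsub>H'\<^esub> (\<Phi> h)) = F (\<Phi> x))"
    unfolding surj[symmetric] by simp
  ultimately show ?thesis
    unfolding K1_def using ext by simp
qed

section \<open>Transport of extremality\<close>

text \<open>A number of modulus one is an extreme point of the unit disc, which contains the values of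
  \<open>f1\<close> and \<open>f2\<close>.\<close>

lemma K1_face_value:
  assumes "group H" and f1: "f1 \<in> K1 H" and f2: "f2 \<in> K1 H" and t: "0 < t" "t < (1::real)"
    and z: "z \<in> carrier H" and eq: "f z = of_real t * f1 z + of_real (1 - t) * f2 z"
    and fz: "f z = of_real \<epsilon>" and eps: "\<epsilon> = 1 \<or> \<epsilon> = -1"
  shows "f1 z = of_real \<epsilon>"
proof -
  have n: "cmod (f1 z) \<le> 1" "cmod (f2 z) \<le> 1"
    using K1_norm_le_1[OF assms(1) f1 z] K1_norm_le_1[OF assms(1) f2 z] by auto
  have ee: "\<epsilon> * \<epsilon> = 1" using eps by auto
  have r: "\<epsilon> * Re (f1 z) \<le> 1" "\<epsilon> * Re (f2 z) \<le> 1"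
    using eps n abs_Re_le_cmod[of "f1 z"] abs_Re_le_cmod[of "f2 z"] by auto
  have "Re (f z) = t * Re (f1 z) + (1 - t) * Re (f2 z)" by (simp add: eq)
  then have "\<epsilon> * \<epsilon> = \<epsilon> * (t * Re (f1 z) + (1 - t) * Re (f2 z))" by (simp add: fz)
  then have "1 = t * (\<epsilon> * Re (f1 z)) + (1 - t) * (\<epsilon> * Re (f2 z))"
    unfolding ee by (simp add: algebra_simps)
  also have "\<dots> \<le> t * (\<epsilon> * Re (f1 z)) + (1 - t) * 1"
    using r(2) t by (intro add_left_mono mult_left_mono) auto
  finally have "t * 1 \<le> t * (\<epsilon> * Re (f1 z))" by simp
  then have "1 \<le> \<epsilon> * Re (f1 z)" using t by simp
  then have "\<epsilon> * Re (f1 z) = 1" using r(1) by simp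
  then have re: "Re (f1 z) = \<epsilon>" using eps by auto
  have "(Re (f1 z))\<^sup>2 + (Im (f1 z))\<^sup>2 \<le> 1"
    using n(1) by (simp add: cmod_power2[symmetric] power_le_one)
  then have "Im (f1 z) = 0" using re ee by (simp add: power2_eq_square[of \<epsilon>])
  then show ?thesis using re by (simp add: complex_eq_iff)
qed

definition typed :: "('a, 'b) monoid_scheme \<Rightarrow> 'a set \<Rightarrow> ('a \<Rightarrow> complex) \<Rightarrow> ('a \<Rightarrow> complex) set" where
  "typed H Z c = {f \<in> K1 H. \<forall>z\<in>Z. \<forall>h\<in>carrier H. f (z \<otimes>\<^bsub>H\<^esub> h) = c z * f h}"

lemma Ext_type_eq: "Ext_type H Z c = typed H Z c \<inter> Ext H"
  by (auto simp: Ext_type_def typed_def Ext_def)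

text \<open>Since \<open>f\<close> takes extreme values on \<open>Z\<close>, the summands take the same values there, and these
  determine the behaviour of a positive-definite function under translation.\<close>

lemma typed_face:
  fixes H (structure)
  assumes "group H" and Z: "\<And>z. z \<in> Z \<Longrightarrow> z \<in> carrier H"
    and central: "\<And>z h. z \<in> Z \<Longrightarrow> h \<in> carrier H \<Longrightarrow> z \<otimes> h = h \<otimes> z"
    and c: "\<And>z. z \<in> Z \<Longrightarrow> c z = 1 \<or> c z = -1"
    and f: "f \<in> typed H Z c" and f1: "f1 \<in> K1 H" and f2: "f2 \<in> K1 H" and t: "0 < t" "t < (1::real)"
    and eq: "\<And>x. x \<in> carrier H \<Longrightarrow> f x = of_real t * f1 x + of_real (1 - t) * f2 x"
  shows "f1 \<in> typed H Z c"
  unfolding typed_def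
proof (intro CollectI conjI f1 ballI)
  interpret group H by fact
  fix z h assume z: "z \<in> Z" and h: "h \<in> carrier H"
  obtain \<epsilon> :: real where e: "c z = of_real \<epsilon>" "\<epsilon> = 1 \<or> \<epsilon> = -1"
    using c[OF z] by (metis of_real_1 of_real_minus)
  have "f (z \<otimes> \<one>) = c z * f \<one>" using f z by (simp add: typed_def)
  moreover have "f \<one> = 1" using f by (simp add: typed_def K1D(3))
  ultimately have fz: "f z = of_real \<epsilon>" using Z[OF z] e by simp
  have "f1 z = of_real \<epsilon>"
    by (rule K1_face_value[where f = f, OF assms(1) f1 f2 t Z[OF z] eq[OF Z[OF z]] fz e(2)])
  then have "f1 (h \<otimes> z) = of_real \<epsilon> * f1 h"
    by (rule pos_def_on_translate[OF assms(1) K1D(2)[OF f1] K1D(3)[OF f1] Z[OF z] h _ e(2)])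
  then show "f1 (z \<otimes> h) = c z * f1 h" using central[OF z h] e by simp
qed

text \<open>The inverse map \<open>\<kappa>\<close> carries a decomposition of \<open>\<theta> f\<close> back to one of \<open>f\<close>; the face property keeps the
  two parts inside the domain of \<open>\<kappa>\<close>.\<close>

lemma Ext_transport:
  assumes sub: "A \<subseteq> K1 H" and sub': "A' \<subseteq> K1 H'"
    and \<theta>: "\<And>f. f \<in> A \<Longrightarrow> \<theta> f \<in> A'" and \<kappa>: "\<And>f. f \<in> A' \<Longrightarrow> \<kappa> f \<in> A"
    and \<kappa>\<theta>: "\<And>f. f \<in> A \<Longrightarrow> \<kappa> (\<theta> f) = f" and \<theta>\<kappa>: "\<And>f. f \<in> A' \<Longrightarrow> \<theta> (\<kappa> f) = f"
    and face: "\<And>f f1 f2 t. f \<in> A' \<Longrightarrow> f1 \<in> K1 H' \<Longrightarrow> f2 \<in> K1 H' \<Longrightarrow> 0 < t \<Longrightarrow> t < 1 \<Longrightarrow>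
      (\<And>x. x \<in> carrier H' \<Longrightarrow> f x = of_real t * f1 x + of_real (1 - t) * f2 x) \<Longrightarrow> f1 \<in> A'"
    and affine: "\<And>f f1 f2 t. f \<in> A' \<Longrightarrow> f1 \<in> A' \<Longrightarrow> f2 \<in> A' \<Longrightarrow>
      (\<And>x. x \<in> carrier H' \<Longrightarrow> f x = of_real t * f1 x + of_real (1 - t) * f2 x) \<Longrightarrow>
      \<forall>x\<in>carrier H. \<kappa> f x = of_real t * \<kappa> f1 x + of_real (1 - t) * \<kappa> f2 x"
    and f: "f \<in> A \<inter> Ext H"
  shows "\<theta> f \<in> A' \<inter> Ext H'"
proof -
  have fA: "f \<in> A" "f \<in> Ext H" using f by auto
  have "f1 = \<theta> f \<and> f2 = \<theta> f"
    if f12: "f1 \<in> K1 H'" "f2 \<in> K1 H'" and t: "0 < t" "t < (1::real)"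
      and eq: "\<forall>x\<in>carrier H'. \<theta> f x = of_real t * f1 x + of_real (1 - t) * f2 x" for f1 f2 t
  proof -
    have A1: "f1 \<in> A'" by (rule face[OF \<theta>[OF fA(1)] f12 t]) (use eq in blast)
    have A2: "f2 \<in> A'"
    proof (rule face[OF \<theta>[OF fA(1)] f12(2,1), of "1 - t"])
      fix x assume "x \<in> carrier H'"
      then have "\<theta> f x = of_real t * f1 x + of_real (1 - t) * f2 x" using eq by blast
      then show "\<theta> f x = of_real (1 - t) * f2 x + of_real (1 - (1 - t)) * f1 x" by simp
    qed (use t in auto)
    have "\<forall>x\<in>carrier H. \<kappa> (\<theta> f) x = of_real t * \<kappa> f1 x + of_real (1 - t) * \<kappa> f2 x"
      by (rule affine[OF \<theta>[OF fA(1)] A1 A2]) (use eq in blast)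
    then have dec: "\<forall>x\<in>carrier H. f x = of_real t * \<kappa> f1 x + of_real (1 - t) * \<kappa> f2 x"
      unfolding \<kappa>\<theta>[OF fA(1)] .
    have k: "\<kappa> f1 \<in> K1 H" "\<kappa> f2 \<in> K1 H" using \<kappa> A1 A2 sub by auto
    have "\<kappa> f1 = f" by (rule ExtD(1)[OF fA(2) k t]) (use dec in blast)
    moreover have "\<kappa> f2 = f" by (rule ExtD(2)[OF fA(2) k t]) (use dec in blast)
    ultimately have "\<kappa> f1 = f" "\<kappa> f2 = f" .
    then show ?thesis using \<theta>\<kappa>[OF A1] \<theta>\<kappa>[OF A2] by simp
  qed
  then show ?thesis using \<theta>[OF fA(1)] sub' unfolding Ext_def by blast
qed

context spin_cover
begin

section \<open>The subgroups of index four\<close>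

lemma even_ord_D_one: "even (ord_D m \<one>\<^bsub>Dinf m\<^esub>)"
proof -
  have "{j. j \<in> {1..} \<and> \<one>\<^bsub>Dinf m\<^esub> j \<noteq> 0} = {}" by (auto simp: one_Dinf)
  then show ?thesis unfolding ord_D_def by simp
qed

lemma odd_ord_D_yG: "1 \<le> j \<Longrightarrow> odd (ord_D m (fst (yG m j)))"
proof -
  assume "1 \<le> j"
  then have "{i. i \<in> {1..} \<and> fst (yG m j) i \<noteq> 0} = {j}"
    by (auto simp: yG_eq[OF pos_m even_m] split: if_splits)
  moreover have "fst (yG m j) j = 1" using \<open>1 \<le> j\<close> by (simp add: yG_eq[OF pos_m even_m])
  moreover have "1 < m" using pos_m even_m by (cases "m = 1") auto
  ultimately show ?thesis unfolding ord_D_def by simp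
qed

lemma parity_mult:
  assumes "p \<in> G" "q \<in> G"
  shows "even (ord_D m (fst (p \<odot> q))) \<longleftrightarrow> even (ord_D m (fst p)) = even (ord_D m (fst q))"
    "evenperm (snd (p \<odot> q)) \<longleftrightarrow> evenperm (snd p) = evenperm (snd q)"
  using assms even_ord_D_mult[OF pos_m even_m] Sinf_evenperm_comp
  by (auto simp: carrier_Ginf mult_Ginf)

lemma parity_one: "even (ord_D m (fst oneQ))" "evenperm (snd oneQ)"
  using even_ord_D_one by (simp_all add: one_Ginf evenperm_id)

lemma parity_inv:
  assumes "p \<in> G"
  shows "even (ord_D m (fst (invQ p))) \<longleftrightarrow> even (ord_D m (fst p))"
    "evenperm (snd (invQ p)) \<longleftrightarrow> evenperm (snd p)"
  using parity_mult[OF assms Q.inv_closed[OF assms]] parity_one Q.r_inv[OF assms] by simp_all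

lemma parity_Phi:
  assumes "g \<in> G'"
  shows "(even (ord_D m (fst (Phi m g))) \<longleftrightarrow> \<not> odd_ord g) \<and> (evenperm (snd (Phi m g)) \<longleftrightarrow> \<not> odd_perm g)"
proof -
  have gen_parity: "(even (ord_D m (fst (Phi m (gcl x)))) \<longleftrightarrow> \<not> odd_ord (gcl x)) \<and>
      (evenperm (snd (Phi m (gcl x))) \<longleftrightarrow> \<not> odd_perm (gcl x))" if x: "x \<in> gens" for x
  proof (cases x)
    case (Zgen k)
    then show ?thesis using x parity_one odd_gens(3,4)[of k] Phi_gens(1)[of k] by (simp add: gcl_simps)
  next
    case (Rgen i)
    then have i: "1 \<le> i" using x by simp
    then show ?thesis
      using odd_gens(5,6)[OF i] even_ord_D_one evenperm_swap[of i "Suc i"]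
      by (simp add: Rgen gcl_simps Phi_gens sG_def)
  next
    case (Egen j)
    then have j: "1 \<le> j" using x by simp
    have "evenperm (snd (yG m j))" by (simp add: yG_eq[OF pos_m even_m] evenperm_id)
    then show ?thesis
      using odd_gens(7,8)[OF j] odd_ord_D_yG[OF j] j by (simp add: Egen gcl_simps Phi_gens)
  qed
  show ?thesis
    using assms
  proof (induction g rule: Gp_induct)
    case one
    then show ?case using parity_one odd_gens(1,2) F.hom_one by simp
  next
    case (gen g x)
    have c: "gcl x \<in> G'" by (rule gcl_closed[OF gen(2)])
    show ?case
      using gen(3) gen_parity[OF gen(2)] parity_mult[OF F.hom_closed[OF gen(1)] F.hom_closed[OF c]]
        odd_simps(1,2)[OF gen(1) c] by (simp only: F.hom_mult[OF gen(1) c]) blast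
  next
    case (inv g x)
    have c: "gcl x \<in> G'" "invP (gcl x) \<in> G'"
      using gcl_closed[OF inv(2)] by auto
    show ?case
      using inv(3) gen_parity[OF inv(2)] parity_mult[OF F.hom_closed[OF inv(1)] F.hom_closed[OF c(2)]]
        odd_simps(1,2)[OF inv(1) c(2)] odd_simps(3,4)[OF c(1)] parity_inv[OF F.hom_closed[OF c(1)]]
      by (simp only: F.hom_mult[OF inv(1) c(2)] F.hom_inv[OF c(1)]) blast
  qed
qed

lemma preim_Ginf: "preim m (G) = G'"
  using F.hom_closed by (auto simp: preim_def)

lemma Kinf_iff:
  "p \<in> Kinf m \<longleftrightarrow> p \<in> G \<and> even (ord_D m (fst p)) \<and> evenperm (snd p)"
  by (auto simp: Kinf_def Ainf_def carrier_Ginf)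

lemma Kp_iff: "g \<in> Kp m \<longleftrightarrow> g \<in> G' \<and> \<not> odd_ord g \<and> \<not> odd_perm g"
  using parity_Phi[of g] F.hom_closed[of g] by (auto simp: Kp_def preim_def Kinf_iff)

lemma Kp_Phi_iff: "g \<in> G' \<Longrightarrow> Phi m g \<in> Kinf m \<longleftrightarrow> g \<in> Kp m"
  by (simp add: Kp_def preim_def)

lemma Kp_normal: "Kp m \<lhd> Gp m"
proof -
  have "oneP \<in> Kp m" using odd_gens(1,2) by (simp add: Kp_iff)
  then have "Kp m \<noteq> {}" by blast
  then have "subgroup (Kp m) (Gp m)"
    by (intro P.subgroupI) (auto simp: Kp_iff odd_simps)
  then show ?thesis
    unfolding P.normal_inv_iff by (auto simp: Kp_iff odd_simps)
qed

lemma Kp_subgroup: "subgroup (Kp m) (Gp m)"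
  using Kp_normal by (simp add: P.normal_inv_iff)

lemma Kinf_normal: "Kinf m \<lhd> Ginf m"
proof -
  have "oneQ \<in> Kinf m" using parity_one by (simp add: Kinf_iff)
  then have "Kinf m \<noteq> {}" by blast
  then have "subgroup (Kinf m) (Ginf m)"
    by (intro Q.subgroupI) (auto simp: Kinf_iff parity_mult parity_inv)
  then show ?thesis
    unfolding Q.normal_inv_iff by (auto simp: Kinf_iff parity_mult parity_inv)
qed

lemma Kinf_subgroup: "subgroup (Kinf m) (Ginf m)"
  using Kinf_normal by (simp add: Q.normal_inv_iff)

lemma Phi_Kp: "Phi m ` Kp m = Kinf m"
proof (intro equalityI subsetI)
  fix p assume "p \<in> Kinf m"
  then have "p \<in> Phi m ` G'" by (simp add: Phi_surj Kinf_iff)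
  then show "p \<in> Phi m ` Kp m" using \<open>p \<in> Kinf m\<close> Kp_Phi_iff by blast
qed (auto simp: Kp_def preim_def)

lemma Kp_conj:
  assumes "g \<in> Kp m" "h \<in> G'"
  shows "\<exists>k\<in>Kp m. k \<cdot> g \<cdot> invP k = h \<cdot> g \<cdot> invP h"
  using conjugate_by_even[of g h] assms by (metis Kp_iff)

lemma Kinf_conj:
  assumes "p \<in> Kinf m" "q \<in> G"
  shows "\<exists>k\<in>Kinf m. k \<odot> p \<odot> invQ k = q \<odot> p \<odot> invQ q"
proof -
  have "p \<in> Phi m ` Kp m" "q \<in> Phi m ` G'" using assms by (simp_all add: Phi_Kp Phi_surj)
  then obtain g h where g: "g \<in> Kp m" "p = Phi m g" and h: "h \<in> G'" "q = Phi m h" by blast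
  obtain k where k: "k \<in> Kp m" "k \<cdot> g \<cdot> invP k = h \<cdot> g \<cdot> invP h"
    using Kp_conj[OF g(1) h(1)] by blast
  have c: "g \<in> G'" "k \<in> G'" using g k by (simp_all add: Kp_iff)
  have "Phi m k \<in> Kinf m" using k(1) Phi_Kp by blast
  moreover have "Phi m (k \<cdot> g \<cdot> invP k) = Phi m (h \<cdot> g \<cdot> invP h)" by (simp only: k(2))
  ultimately show ?thesis
    using c h(1) by (auto simp: g(2) h(2))
qed

section \<open>The character of $K'_\infty$\<close>

lemma f0_Kp: "g \<in> Kp m \<Longrightarrow> f0VII m g = (if fst (dih g) then -1 else 1)"
  using z3_exp_eq[of g] by (simp add: f0VII_def Kp_iff)

lemma f0_not_Kp: "g \<notin> Kp m \<Longrightarrow> f0VII m g = 0"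
  by (simp add: f0VII_def)

lemma dih_Kp: "g \<in> Kp m \<Longrightarrow> \<exists>e. dih g = (e, False, False)"
  by (cases "dih g") (auto simp: Kp_iff odd_ord_def odd_perm_def)

lemma f0_mult:
  assumes "g \<in> Kp m" "h \<in> Kp m"
  shows "f0VII m (g \<cdot> h) = f0VII m g * f0VII m h"
proof -
  have "g \<cdot> h \<in> Kp m" using subgroup.m_closed[OF Kp_subgroup assms] .
  moreover have "g \<in> G'" "h \<in> G'" using assms by (simp_all add: Kp_iff)
  ultimately show ?thesis
    using dih_Kp[OF assms(1)] dih_Kp[OF assms(2)] f0_Kp assms by auto
qed

lemma f0_sq: "g \<in> Kp m \<Longrightarrow> f0VII m g * f0VII m g = 1"
  by (simp add: f0_Kp)

lemma f0_values: "g \<in> Kp m \<Longrightarrow> f0VII m g = 1 \<or> f0VII m g = -1"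
  by (simp add: f0_Kp)

lemma f0_one: "f0VII m oneP = 1"
  using f0_Kp[OF subgroup.one_closed[OF Kp_subgroup]] dih_one by simp

lemma Zp_Kp: "z \<in> Zp m \<Longrightarrow> z \<in> Kp m"
proof -
  assume "z \<in> Zp m"
  then have "z \<in> G'" "Phi m z = oneQ" by (simp_all add: Zp_central Phi_Zp)
  then show "z \<in> Kp m" using parity_one Kp_Phi_iff[of z] by (simp add: Kinf_iff)
qed

text \<open>The conditions that define \<open>chiVII\<close> determine it on the generators of \<open>Z\<close>, and the restriction of
  \<open>f0VII\<close> satisfies them.\<close>

lemma chiVII_eq:
  assumes "z \<in> Zp m" shows "chiVII m z = f0VII m z"
proof -
  have f0z: "f0VII m (zp m k) = (if k = 3 then -1 else 1)" if "k \<in> {1, 2, 3}" for k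
    using f0_Kp[OF Zp_Kp[OF zp_Zp[OF that]]] dih_gens(1)[OF that] by simp
  define P where "P c \<longleftrightarrow> c \<in> extensional (Zp m) \<and>
     (\<forall>z\<in>Zp m. \<forall>w\<in>Zp m. c (z \<cdot> w) = c z * c w) \<and>
     c (zp m 1) = 1 \<and> c (zp m 2) = 1 \<and> c (zp m 3) = -1" for c :: "gen word set \<Rightarrow> complex"
  have 1: "P (restrict (f0VII m) (Zp m))"
    unfolding P_def using f0_mult Zp_Kp zp_Zp f0z Zp_mult by (auto simp del: One_nat_def)
  have 2: "c = restrict (f0VII m) (Zp m)" if c: "P c" for c
  proof (rule extensionalityI[of _ "Zp m"])
    show "c \<in> extensional (Zp m)" using c by (simp add: P_def)
    fix z assume "z \<in> Zp m"
    moreover have mult: "c (z \<cdot> w) = c z * c w" if "z \<in> Zp m" "w \<in> Zp m" for z w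
      using c that by (simp add: P_def)
    have ck: "c (zp m k) = f0VII m (zp m k)" if "k \<in> {1, 2, 3}" for k
      using c that f0z[OF that] by (auto simp: P_def)
    have "c z = f0VII m z" if "z \<in> Zp m"
      using that unfolding Zp_def
    proof (induction z rule: generate.induct)
      case one
      have "c (zp m 1 \<cdot> zp m 1) = c (zp m 1) * c (zp m 1)" by (rule mult) (rule zp_Zp, simp)+
      then show ?case using zp_sq[of 1] c f0_one by (simp add: P_def)
    next
      case (incl h)
      then show ?case using ck by auto
    next
      case (inv h)
      then obtain k where "k \<in> {1, 2, 3}" "h = zp m k" by auto
      then show ?case using ck by (simp only: zp_inv)
    next
      case (eng h1 h2)
      then show ?case using mult[of h1 h2] f0_mult[of h1 h2] Zp_Kp by (simp add: Zp_def)
    qed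
    ultimately show "c z = restrict (f0VII m) (Zp m) z" by simp
  qed simp
  have "chiVII m = restrict (f0VII m) (Zp m)"
    unfolding chiVII_def P_def[symmetric] using 1 2 by (rule the_equality)
  then show ?thesis using assms by simp
qed

section \<open>The correspondences\<close>

abbreviation TG :: "(gen word set \<Rightarrow> complex) set" where "TG \<equiv> typed (Gp m) (Zp m) (chiVII m)"
abbreviation TK :: "(gen word set \<Rightarrow> complex) set" where "TK \<equiv> typed (KpG m) (Zp m) (chiVII m)"

lemma chi_values: "z \<in> Zp m \<Longrightarrow> chiVII m z = 1 \<or> chiVII m z = -1"
  using chiVII_eq f0_values Zp_Kp by simp

lemma group_KpG: "group (KpG m)"
  by (rule subgroup.subgroup_is_group[OF Kp_subgroup P.group_axioms])

lemma group_KinfG: "group (KinfG m)"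
  by (rule subgroup.subgroup_is_group[OF Kinf_subgroup Q.group_axioms])

lemma Kp_carrier: "g \<in> Kp m \<Longrightarrow> g \<in> G'"
  by (simp add: Kp_iff)

lemma TG_face:
  assumes "f \<in> TG" "f1 \<in> K1 (Gp m)" "f2 \<in> K1 (Gp m)" "0 < t" "t < 1"
    "\<And>x. x \<in> G' \<Longrightarrow> f x = of_real t * f1 x + of_real (1 - t) * f2 x"
  shows "f1 \<in> TG"
  by (rule typed_face[OF P.group_axioms Zp_central(1) Zp_central(2) chi_values assms])

lemma TK_face:
  assumes "f \<in> TK" "f1 \<in> K1 (KpG m)" "f2 \<in> K1 (KpG m)" "0 < t" "t < 1"
    "\<And>x. x \<in> carrier (KpG m) \<Longrightarrow> f x = of_real t * f1 x + of_real (1 - t) * f2 x"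
  shows "f1 \<in> TK"
proof (rule typed_face[OF group_KpG _ _ chi_values assms])
  fix z assume "z \<in> Zp m"
  then show "z \<in> carrier (KpG m)" by (simp add: Zp_Kp)
next
  fix z h assume "z \<in> Zp m" "h \<in> carrier (KpG m)"
  then show "z \<otimes>\<^bsub>KpG m\<^esub> h = h \<otimes>\<^bsub>KpG m\<^esub> z" using Zp_central(2) Kp_carrier by simp
qed

subsection \<open>Restriction from $G'_\infty$ to $K'_\infty$\<close>

lemma TG_vanish: "f \<in> TG \<Longrightarrow> g \<in> G' \<Longrightarrow> g \<notin> Kp m \<Longrightarrow> f g = 0"
proof -
  assume f: "f \<in> TG" and g: "g \<in> G'" "g \<notin> Kp m"
  have c: "chiVII m (zp m k) = (if k = 3 then -1 else 1)" if "k \<in> {1, 2, 3}" for k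
    using chiVII_eq[OF zp_Zp[OF that]] f0_Kp[OF Zp_Kp[OF zp_Zp[OF that]]] dih_gens(1)[OF that] by simp
  show ?thesis
  proof (rule typed_vanish[where c = "chiVII m"])
    show "f \<in> K1 (Gp m)" using f by (simp add: typed_def)
    show "f (z \<cdot> h) = chiVII m z * f h" if "z \<in> Zp m" "h \<in> G'" for z h
      using f that by (simp add: typed_def)
    show "chiVII m (zp m 1) = 1" "chiVII m (zp m 2) = 1" "chiVII m (zp m 3) = -1"
      using c[of 1] c[of 2] c[of 3] by simp_all
    show "odd_ord g \<or> odd_perm g" using g by (simp add: Kp_iff)
  qed (rule g)
qed

lemma TG_restrict: "f \<in> TG \<Longrightarrow> restrict f (Kp m) \<in> TK"
  using K1_restrict[OF P.group_axioms Kp_subgroup, of f] Zp_Kp Kp_carrier subgroup.m_closed[OF Kp_subgroup]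
  by (auto simp: typed_def)

lemma TK_extend: "f \<in> TK \<Longrightarrow> zero_extension (Gp m) (Kp m) f \<in> TG"
proof -
  assume f: "f \<in> TK"
  then have "zero_extension (Gp m) (Kp m) f \<in> K1 (Gp m)"
    using K1_zero_extension[OF P.group_axioms Kp_normal _ Kp_conj] by (simp add: typed_def)
  moreover have "zero_extension (Gp m) (Kp m) f (z \<cdot> h) = chiVII m z * zero_extension (Gp m) (Kp m) f h"
    if z: "z \<in> Zp m" and h: "h \<in> G'" for z h
  proof -
    have zc: "z \<in> G'" "\<not> odd_ord z" "\<not> odd_perm z" using Zp_Kp[OF z] by (simp_all add: Kp_iff)
    then have "z \<cdot> h \<in> Kp m \<longleftrightarrow> h \<in> Kp m" using h by (simp add: Kp_iff odd_simps)
    then show ?thesis using f z h zc(1) by (simp add: zero_extension_def typed_def)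
  qed
  ultimately show ?thesis by (simp add: typed_def)
qed

lemma restrict_extend: "f \<in> TK \<Longrightarrow> restrict (zero_extension (Gp m) (Kp m) f) (Kp m) = f"
proof -
  assume "f \<in> TK"
  then have "f \<in> extensional (Kp m)" using K1D(1)[of f "KpG m"] by (simp add: typed_def)
  then show ?thesis
    by (intro extensionalityI[of _ "Kp m"]) (auto simp: zero_extension_def Kp_carrier)
qed

lemma extend_restrict: "f \<in> TG \<Longrightarrow> zero_extension (Gp m) (Kp m) (restrict f (Kp m)) = f"
proof -
  assume f: "f \<in> TG"
  then have "f \<in> extensional (G')" using K1D(1)[of f "Gp m"] by (simp add: typed_def)
  then show ?thesis
    using TG_vanish[OF f] by (intro extensionalityI[of _ "G'"]) (auto simp: zero_extension_def)
qed

lemma typed_K1: "typed H Z c \<subseteq> K1 H"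
  by (auto simp: typed_def)

lemma Ext_restrict_Kp: "f \<in> TG \<inter> Ext (Gp m) \<Longrightarrow> restrict f (Kp m) \<in> TK \<inter> Ext (KpG m)"
proof (rule Ext_transport[where \<theta> = "\<lambda>f. restrict f (Kp m)" and \<kappa> = "zero_extension (Gp m) (Kp m)",
    OF typed_K1 typed_K1 TG_restrict TK_extend extend_restrict restrict_extend])
  fix f f1 f2 and t :: real
  assume "f \<in> TK" "f1 \<in> K1 (KpG m)" "f2 \<in> K1 (KpG m)" "0 < t" "t < 1"
    "\<And>x. x \<in> carrier (KpG m) \<Longrightarrow> f x = of_real t * f1 x + of_real (1 - t) * f2 x"
  then show "f1 \<in> TK" by (rule TK_face[of f f1 f2 t])
next
qed (simp_all add: zero_extension_def)

lemma Ext_extend_Kp: "f \<in> TK \<inter> Ext (KpG m) \<Longrightarrow> zero_extension (Gp m) (Kp m) f \<in> TG \<inter> Ext (Gp m)"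
proof (rule Ext_transport[where \<theta> = "zero_extension (Gp m) (Kp m)" and \<kappa> = "\<lambda>f. restrict f (Kp m)",
    OF typed_K1 typed_K1 TK_extend TG_restrict restrict_extend extend_restrict])
  fix f f1 f2 and t :: real
  assume "f \<in> TG" "f1 \<in> K1 (Gp m)" "f2 \<in> K1 (Gp m)" "0 < t" "t < 1"
    "\<And>x. x \<in> G' \<Longrightarrow> f x = of_real t * f1 x + of_real (1 - t) * f2 x"
  then show "f1 \<in> TG" by (rule TG_face[of f f1 f2 t])
next
qed (simp_all add: Kp_carrier)

subsection \<open>Multiplication by the character\<close>

lemma mult_up_eq: "g \<in> Kp m \<Longrightarrow> mult_up m (Kinf m) F g = f0VII m g * F (Phi m g)"
  by (simp add: mult_up_def Kp_def)

lemma mult_up_extensional: "mult_up m (Kinf m) F \<in> extensional (Kp m)"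
  by (simp add: mult_up_def Kp_def)

lemma Phi_Kp_hom: "group_hom (KpG m) (KinfG m) (Phi m)"
  using Phi_Kp Kp_carrier group_KpG group_KinfG
  by (auto intro!: group_hom.intro group_hom_axioms.intro homI)

lemma K1_twist_f0:
  assumes "f \<in> extensional (Kp m)" "F \<in> extensional (Kinf m)"
    and "\<And>g. g \<in> Kp m \<Longrightarrow> f g = f0VII m g * F (Phi m g)"
  shows "f \<in> K1 (KpG m) \<longleftrightarrow> F \<in> K1 (KinfG m)"
  by (rule K1_twist_iff[OF Phi_Kp_hom, where \<epsilon> = "f0VII m"])
    (use assms Phi_Kp f0_mult f0_values in simp_all)

lemma mult_up_TK:
  assumes "F \<in> K1 (KinfG m)"
  shows "mult_up m (Kinf m) F \<in> TK"
proof -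
  have ext: "F \<in> extensional (Kinf m)" using K1D(1)[OF assms] by simp
  have "mult_up m (Kinf m) F \<in> K1 (KpG m) \<longleftrightarrow> F \<in> K1 (KinfG m)"
    by (rule K1_twist_f0[OF mult_up_extensional ext]) (rule mult_up_eq)
  then have "mult_up m (Kinf m) F \<in> K1 (KpG m)" using assms by blast
  moreover have "mult_up m (Kinf m) F (z \<cdot> h) = chiVII m z * mult_up m (Kinf m) F h"
    if z: "z \<in> Zp m" and h: "h \<in> Kp m" for z h
    using subgroup.m_closed[OF Kp_subgroup Zp_Kp[OF z] h] f0_mult[OF Zp_Kp[OF z] h] h
      Kp_carrier[OF h] Zp_central(1)[OF z] F.hom_closed[of h]
    by (simp add: mult_up_eq chiVII_eq[OF z] Phi_Zp[OF z])
  ultimately show ?thesis by (simp add: typed_def)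
qed

lemma fibre:
  assumes "g \<in> G'" "h \<in> G'" "Phi m h = Phi m g"
  obtains z where "z \<in> Zp m" "h = z \<cdot> g"
proof
  show "h \<cdot> invP g \<in> Zp m"
    by (rule Phi_kernel) (use assms F.hom_closed[of g] in simp_all)
  show "h = h \<cdot> invP g \<cdot> g" using assms by (simp add: P.m_assoc)
qed

text \<open>On a fibre of \<open>Phi\<close> both \<open>f0VII\<close> and a function of type \<open>chiVII\<close> change by the same sign.\<close>

lemma mult_down_eq:
  assumes L: "L = G \<and> f \<in> TG \<or> L = Kinf m \<and> f \<in> TK" and g: "g \<in> preim m L"
  shows "mult_down m L f (Phi m g) = f0VII m g * f g"
proof -
  have gc: "g \<in> G'" "Phi m g \<in> L" using g by (simp_all add: preim_def)
  have "f0VII m h * f h = f0VII m g * f g" if h: "h \<in> preim m L" "Phi m h = Phi m g" for h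
  proof -
    have hc: "h \<in> G'" using h by (simp add: preim_def)
    obtain z where z: "z \<in> Zp m" "h = z \<cdot> g" using fibre[OF gc(1) hc h(2)] by blast
    show ?thesis
    proof (cases "g \<in> Kp m")
      case True
      then have "f h = chiVII m z * f g" using L z gc by (auto simp: typed_def)
      moreover have "f0VII m h = chiVII m z * f0VII m g"
        using f0_mult[OF Zp_Kp[OF z(1)] True] z by (simp add: chiVII_eq)
      moreover have "chiVII m z * chiVII m z = 1" using chi_values[OF z(1)] by auto
      ultimately show ?thesis by (metis mult.assoc mult.left_commute mult_1)
    next
      case False
      then have "h \<notin> Kp m" using Kp_Phi_iff[OF gc(1)] Kp_Phi_iff[OF hc] h(2) by simp
      then show ?thesis using False by (simp add: f0_not_Kp)
    qed
  qed
  note const = this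
  have "(\<lambda>g'. f0VII m g' * f g') ` {g' \<in> preim m L. Phi m g' = Phi m g} = {f0VII m g * f g}"
  proof (intro equalityI subsetI)
    fix y assume "y \<in> (\<lambda>g'. f0VII m g' * f g') ` {g' \<in> preim m L. Phi m g' = Phi m g}"
    then obtain h where "h \<in> preim m L" "Phi m h = Phi m g" "y = f0VII m h * f h" by blast
    then show "y \<in> {f0VII m g * f g}" using const by blast
  qed (use g in blast)
  then show ?thesis using gc(2) by (simp add: mult_down_def)
qed

lemma mult_down_Kp: "f \<in> TK \<Longrightarrow> g \<in> Kp m \<Longrightarrow> mult_down m (Kinf m) f (Phi m g) = f0VII m g * f g"
  by (rule mult_down_eq) (simp_all add: Kp_def)

lemma mult_down_Gp: "f \<in> TG \<Longrightarrow> g \<in> G' \<Longrightarrow>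
    mult_down m (G) f (Phi m g) = f0VII m g * f g"
  by (rule mult_down_eq) (simp_all add: preim_Ginf)

lemma Kinf_lift: "p \<in> Kinf m \<Longrightarrow> \<exists>g. g \<in> Kp m \<and> p = Phi m g"
  using Phi_Kp by blast

lemma mult_down_K1:
  assumes f: "f \<in> TK"
  shows "mult_down m (Kinf m) f \<in> K1 (KinfG m)"
proof -
  have fK: "f \<in> K1 (KpG m)" "f \<in> extensional (Kp m)"
    using f K1D(1)[of f "KpG m"] by (simp_all add: typed_def)
  have "mult_down m (Kinf m) f \<in> extensional (Kinf m)" by (simp add: mult_down_def)
  moreover have "f g = f0VII m g * mult_down m (Kinf m) f (Phi m g)" if "g \<in> Kp m" for g
    unfolding mult_down_Kp[OF f that] using f0_sq[OF that] by (simp add: mult.assoc[symmetric])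
  ultimately show ?thesis
    using K1_twist_f0[of f "mult_down m (Kinf m) f"] fK by blast
qed

lemma mult_down_up: "F \<in> K1 (KinfG m) \<Longrightarrow> mult_down m (Kinf m) (mult_up m (Kinf m) F) = F"
proof -
  assume F: "F \<in> K1 (KinfG m)"
  show ?thesis
  proof (rule extensionalityI[of _ "Kinf m"])
    show "F \<in> extensional (Kinf m)" using K1D(1)[OF F] by simp
    fix p assume "p \<in> Kinf m"
    then obtain g where g: "g \<in> Kp m" "p = Phi m g" using Kinf_lift by blast
    show "mult_down m (Kinf m) (mult_up m (Kinf m) F) p = F p"
      unfolding g(2) mult_down_Kp[OF mult_up_TK[OF F] g(1)] mult_up_eq[OF g(1)]
      using f0_sq[OF g(1)] by (simp add: mult.assoc[symmetric])
  qed (simp add: mult_down_def)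
qed

lemma mult_up_down: "f \<in> TK \<Longrightarrow> mult_up m (Kinf m) (mult_down m (Kinf m) f) = f"
proof -
  assume f: "f \<in> TK"
  show ?thesis
  proof (rule extensionalityI[OF mult_up_extensional])
    show "f \<in> extensional (Kp m)" using f K1D(1)[of f "KpG m"] by (simp add: typed_def)
    fix g assume g: "g \<in> Kp m"
    show "mult_up m (Kinf m) (mult_down m (Kinf m) f) g = f g"
      unfolding mult_up_eq[OF g] mult_down_Kp[OF f g] using f0_sq[OF g] by (simp add: mult.assoc[symmetric])
  qed
qed

lemma Ext_mult_up: "F \<in> Ext (KinfG m) \<Longrightarrow> mult_up m (Kinf m) F \<in> TK \<inter> Ext (KpG m)"
proof -
  assume F: "F \<in> Ext (KinfG m)"
  show ?thesis
  proof (rule Ext_transport[where \<theta> = "mult_up m (Kinf m)" and \<kappa> = "mult_down m (Kinf m)",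
      OF order.refl typed_K1 mult_up_TK mult_down_K1 mult_down_up mult_up_down])
    show "F \<in> K1 (KinfG m) \<inter> Ext (KinfG m)" using F Ext_K1 by blast
  next
    fix f f1 f2 and t :: real
    assume "f \<in> TK" "f1 \<in> K1 (KpG m)" "f2 \<in> K1 (KpG m)" "0 < t" "t < 1"
      "\<And>x. x \<in> carrier (KpG m) \<Longrightarrow> f x = of_real t * f1 x + of_real (1 - t) * f2 x"
    then show "f1 \<in> TK" by (rule TK_face[of f f1 f2 t])
  next
    fix f f1 f2 and t :: real
    assume f: "f \<in> TK" "f1 \<in> TK" "f2 \<in> TK"
      and eq: "\<And>x. x \<in> carrier (KpG m) \<Longrightarrow> f x = of_real t * f1 x + of_real (1 - t) * f2 x"
    show "\<forall>x\<in>carrier (KinfG m). mult_down m (Kinf m) f x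
        = of_real t * mult_down m (Kinf m) f1 x + of_real (1 - t) * mult_down m (Kinf m) f2 x"
    proof
      fix p assume "p \<in> carrier (KinfG m)"
      then have "p \<in> Kinf m" by simp
      then obtain g where g: "g \<in> Kp m" "p = Phi m g" using Kinf_lift by blast
      show "mult_down m (Kinf m) f p = of_real t * mult_down m (Kinf m) f1 p + of_real (1 - t) * mult_down m (Kinf m) f2 p"
        unfolding g(2) mult_down_Kp[OF f(1) g(1)] mult_down_Kp[OF f(2) g(1)] mult_down_Kp[OF f(3) g(1)]
          eq[of g, simplified, OF g(1)] by (simp add: algebra_simps)
    qed
  qed
qed

lemma Ext_mult_down: "f \<in> TK \<inter> Ext (KpG m) \<Longrightarrow> mult_down m (Kinf m) f \<in> Ext (KinfG m)"
proof -
  assume f: "f \<in> TK \<inter> Ext (KpG m)"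
  have "mult_down m (Kinf m) f \<in> K1 (KinfG m) \<inter> Ext (KinfG m)"
  proof (rule Ext_transport[where \<theta> = "mult_down m (Kinf m)" and \<kappa> = "mult_up m (Kinf m)",
      OF typed_K1 order.refl mult_down_K1 mult_up_TK mult_up_down mult_down_up _ _ f])
    fix F F1 F2 :: "(nat \<Rightarrow> int) \<times> (nat \<Rightarrow> nat) \<Rightarrow> complex" and t :: real
    assume eq: "\<And>x. x \<in> carrier (KinfG m) \<Longrightarrow> F x = of_real t * F1 x + of_real (1 - t) * F2 x"
    show "\<forall>x\<in>carrier (KpG m). mult_up m (Kinf m) F x
        = of_real t * mult_up m (Kinf m) F1 x + of_real (1 - t) * mult_up m (Kinf m) F2 x"
    proof
      fix g assume "g \<in> carrier (KpG m)"
      then have g: "g \<in> Kp m" "Phi m g \<in> carrier (KinfG m)" using Phi_Kp by auto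
      show "mult_up m (Kinf m) F g = of_real t * mult_up m (Kinf m) F1 g + of_real (1 - t) * mult_up m (Kinf m) F2 g"
        unfolding mult_up_eq[OF g(1)] eq[OF g(2)] by (simp add: algebra_simps)
    qed
  qed
  then show ?thesis by blast
qed

subsection \<open>Restriction from $G_\infty$ to $K_\infty$\<close>

lemma Kinf_K1_extend:
  "F \<in> K1 (KinfG m) \<Longrightarrow> zero_extension (Ginf m) (Kinf m) F \<in> K1 (Ginf m)"
  by (rule K1_zero_extension[OF Q.group_axioms Kinf_normal _ Kinf_conj])

text \<open>The orthogonal conjugates of an element of \<open>Kinf m\<close> that extremality on the large group
  provides are already conjugate in \<open>Kinf m\<close>.\<close>

lemma Ext_restrict_Kinf:
  assumes F: "F \<in> Ext (Ginf m)"
  shows "restrict F (Kinf m) \<in> Ext (KinfG m)"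
proof (rule Ext_if_orthogonal_conjugates[OF group_KinfG K1_restrict[OF Q.group_axioms Kinf_subgroup Ext_K1[OF F]]])
  fix x and N :: nat assume "x \<in> carrier (KinfG m)"
  then have x: "x \<in> Kinf m" "x \<in> G" by (simp_all add: Kinf_iff)
  note FK = K1D[OF Ext_K1[OF F]]
  obtain h u where h0: "h (0::nat) = x" and h: "\<And>n. h n \<in> G"
    and u: "\<And>n. u n \<in> G"
    and step: "\<And>n. h (Suc n) = u n \<odot> h n \<odot> invQ (u n)"
    and comm: "\<And>y. y \<in> G \<Longrightarrow> \<forall>\<^sub>F n in sequentially.
      y \<odot> h n = h n \<odot> y \<and> y \<odot> u n = u n \<odot> y"
    by (rule conjugates_to_infinity[OF pos_m x(2)]) blast
  have Fh: "F (h n) = F x" for n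
  proof (induction n)
    case (Suc n)
    then show ?case using FK(4)[OF h u] step by simp
  qed (simp add: h0)
  have mult: "\<forall>\<^sub>F n in sequentially. F (y \<odot> h n) = F y * F x" if "y \<in> G" for y
    using Ext_asymptotically_multiplicative[OF Q.group_axioms F h u step comm that] by (simp add: h0)
  obtain k where k: "\<And>i j. i < N \<Longrightarrow> j < N \<Longrightarrow> i \<noteq> j \<Longrightarrow>
      F (invQ (h (k j)) \<odot> h (k i)) = F x * cnj (F x)"
    using orthogonal_conjugates[OF Q.group_axioms Ext_K1[OF F] h mult Fh, of N] by blast
  have "\<exists>c\<in>G. h n = c \<odot> x \<odot> invQ c" for n
  proof (induction n)
    case 0
    then show ?case using x(2) by (intro bexI[of _ "oneQ"]) (simp_all add: h0)
  next
    case (Suc n)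
    then obtain c where c: "c \<in> G" "h n = c \<odot> x \<odot> invQ c" by blast
    have "h (Suc n) = (u n \<odot> c) \<odot> x \<odot> invQ (u n \<odot> c)"
      unfolding step c(2) using c(1) u[of n] x(2) by (simp add: Q.m_assoc Q.inv_mult_group)
    then show ?case using c(1) u[of n] by blast
  qed
  then have conj: "\<exists>c\<in>Kinf m. h n = c \<odot> x \<odot> invQ c" for n
    using Kinf_conj[OF x(1)] by metis
  have hK: "h n \<in> Kinf m" for n
    using conj[of n] x(1) Kinf_subgroup by (metis subgroup.m_closed subgroup.m_inv_closed)
  show "\<exists>k. (\<forall>i<N. \<exists>c\<in>carrier (KinfG m). k i = c \<otimes>\<^bsub>KinfG m\<^esub> x \<otimes>\<^bsub>KinfG m\<^esub> inv\<^bsub>KinfG m\<^esub> c) \<and>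
      (\<forall>i<N. \<forall>j<N. i \<noteq> j \<longrightarrow> restrict F (Kinf m) (inv\<^bsub>KinfG m\<^esub> (k j) \<otimes>\<^bsub>KinfG m\<^esub> k i)
        = restrict F (Kinf m) x * cnj (restrict F (Kinf m) x))"
  proof (intro exI[of _ "\<lambda>i. h (k i)"] conjI allI impI)
    fix i
    obtain c where "c \<in> Kinf m" "h (k i) = c \<odot> x \<odot> invQ c"
      using conj by blast
    then show "\<exists>c\<in>carrier (KinfG m). h (k i) = c \<otimes>\<^bsub>KinfG m\<^esub> x \<otimes>\<^bsub>KinfG m\<^esub> inv\<^bsub>KinfG m\<^esub> c"
      using Q.m_inv_consistent[OF Kinf_subgroup] by auto
  next
    fix i j assume "i < N" "j < N" "i \<noteq> j"
    moreover have "invQ (h (k j)) \<odot> h (k i) \<in> Kinf m"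
      using hK Kinf_subgroup by (simp add: subgroup.m_closed subgroup.m_inv_closed)
    ultimately show "restrict F (Kinf m) (inv\<^bsub>KinfG m\<^esub> (h (k j)) \<otimes>\<^bsub>KinfG m\<^esub> h (k i))
        = restrict F (Kinf m) x * cnj (restrict F (Kinf m) x)"
      using k x(1) Q.m_inv_consistent[OF Kinf_subgroup hK] by simp
  qed
qed

text \<open>Extension by zero shows that at least one class function restricts to \<open>f\<close>.\<close>

lemma Ext_restrict_Kinf_surj:
  assumes f: "f \<in> Ext (KinfG m)"
  shows "\<exists>F\<in>Ext (Ginf m). restrict F (Kinf m) = f"
proof (rule Ext_extension[OF Q.group_axioms countable_Ginf[OF pos_m] Kinf_subgroup f])
  show "zero_extension (Ginf m) (Kinf m) f \<in> K1 (Ginf m)"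
    by (rule Kinf_K1_extend[OF Ext_K1[OF f]])
  have "f \<in> extensional (Kinf m)" using K1D(1)[OF Ext_K1[OF f]] by simp
  then show "restrict (zero_extension (Ginf m) (Kinf m) f) (Kinf m) = f"
    by (intro extensionalityI[of _ "Kinf m"]) (auto simp: zero_extension_def Kinf_iff)
qed

lemma mult_up_Ginf:
  "mult_up m (G) F = zero_extension (Gp m) (Kp m) (mult_up m (Kinf m) (restrict F (Kinf m)))"
proof (rule extensionalityI[of _ "G'"])
  fix g assume g: "g \<in> G'"
  show "mult_up m (G) F g
      = zero_extension (Gp m) (Kp m) (mult_up m (Kinf m) (restrict F (Kinf m))) g"
  proof (cases "g \<in> Kp m")
    case True
    then have "Phi m g \<in> Kinf m" using Phi_Kp by blast
    then show ?thesis
      using g True by (simp add: mult_up_eq zero_extension_def) (simp add: mult_up_def preim_Ginf)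
  next
    case False
    then show ?thesis using g by (simp add: mult_up_def preim_Ginf zero_extension_def f0_not_Kp)
  qed
qed (simp_all add: mult_up_def preim_Ginf zero_extension_def)

lemma mult_down_Ginf:
  assumes f: "f \<in> TG"
  shows "mult_down m (G) f
    = zero_extension (Ginf m) (Kinf m) (mult_down m (Kinf m) (restrict f (Kp m)))"
proof (rule extensionalityI[of _ "G"])
  fix p assume p: "p \<in> G"
  then obtain g where g: "g \<in> G'" "p = Phi m g" using Phi_surj by blast
  show "mult_down m (G) f p
      = zero_extension (Ginf m) (Kinf m) (mult_down m (Kinf m) (restrict f (Kp m))) p"
  proof (cases "g \<in> Kp m")
    case True
    then have "p \<in> Kinf m" using Phi_Kp g by blast
    then show ?thesis
      using g True p mult_down_Gp[OF f g(1)] mult_down_Kp[OF TG_restrict[OF f] True]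
      by (simp add: zero_extension_def)
  next
    case False
    then have "p \<notin> Kinf m" using Kp_Phi_iff g by simp
    then show ?thesis
      using g False p mult_down_Gp[OF f g(1)] by (simp add: zero_extension_def f0_not_Kp)
  qed
qed (simp_all add: mult_down_def zero_extension_def)

lemma restrict_zero_extension_Kinf:
  "F \<in> K1 (KinfG m) \<Longrightarrow> restrict (zero_extension (Ginf m) (Kinf m) F) (Kinf m) = F"
  using K1D(1)[of F "KinfG m"]
  by (intro extensionalityI[of _ "Kinf m"]) (auto simp: zero_extension_def Kinf_iff)

end

theorem theorem17p6:
  fixes m :: nat
  assumes "even m" and "m > 0"
  defines "EG \<equiv> Ext (Ginf m)"
    and "EK \<equiv> Ext (KinfG m)"
    and "EG' \<equiv> Ext_type (Gp m) (Zp m) (chiVII m)"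
    and "EK' \<equiv> Ext_type (KpG m) (Zp m) (chiVII m)"
    and "ResK \<equiv> (\<lambda>F. restrict F (Kinf m))"
    and "ResK' \<equiv> (\<lambda>f. restrict f (Kp m))"
    and "M \<equiv> mult_up m (carrier (Ginf m))"
    and "N \<equiv> mult_down m (carrier (Ginf m))"
    and "M' \<equiv> mult_up m (Kinf m)"
    and "N' \<equiv> mult_down m (Kinf m)"
  shows
    "ResK ` EG = EK \<and>
     bij_betw ResK' EG' EK' \<and>
     bij_betw M' EK EK' \<and>
     bij_betw N' EK' EK \<and>
     (\<forall>f\<in>EK'. \<forall>g'\<in>Kp m. N' f (Phi m g') = f0VII m g' * f g') \<and>
     (\<forall>F\<in>EG. M F \<in> EG' \<and> ResK' (M F) = M' (ResK F)) \<and>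
     (\<forall>f\<in>EG'. N f \<in> K1 (Ginf m) \<and>
        (\<forall>g'\<in>carrier (Gp m). N f (Phi m g') = f0VII m g' * f g') \<and>
        ResK (N f) = N' (ResK' f)) \<and>
     (\<forall>f\<in>EG'. \<exists>F\<in>EG. M F = f \<and> ResK F = N' (ResK' f))"
proof -
  interpret spin_cover m using assms(1,2) by unfold_locales
  have EG': "EG' = TG \<inter> Ext (Gp m)" and EK': "EK' = TK \<inter> Ext (KpG m)"
    unfolding EG'_def EK'_def by (rule Ext_type_eq)+
  have ResK_in: "ResK F \<in> EK" if "F \<in> EG" for F
    using Ext_restrict_Kinf that by (simp add: EG_def EK_def ResK_def)
  have ResK_surj: "\<exists>F\<in>EG. ResK F = f" if "f \<in> EK" for f
    using Ext_restrict_Kinf_surj that by (simp add: EG_def EK_def ResK_def)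
  have ResK'_in: "ResK' f \<in> EK'" if "f \<in> EG'" for f
    using Ext_restrict_Kp that by (simp add: EG' EK' ResK'_def)
  have ext_in: "zero_extension (Gp m) (Kp m) f \<in> EG'" if "f \<in> EK'" for f
    using Ext_extend_Kp that by (simp add: EG' EK')
  have M'_in: "M' F \<in> EK'" if "F \<in> EK" for F
    using Ext_mult_up that by (simp add: EK_def EK' M'_def)
  have N'_in: "N' f \<in> EK" if "f \<in> EK'" for f
    using Ext_mult_down that by (simp add: EK_def EK' N'_def)
  have N'M': "N' (M' F) = F" if "F \<in> EK" for F
    using mult_down_up[OF Ext_K1] that by (simp add: EK_def M'_def N'_def)
  have M'N': "M' (N' f) = f" if "f \<in> EK'" for f
    using mult_up_down that by (simp add: EK' M'_def N'_def)
  have rest_ext: "ResK' (zero_extension (Gp m) (Kp m) f) = f" if "f \<in> EK'" for f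
    using restrict_extend that by (simp add: EK' ResK'_def)
  have ext_rest: "zero_extension (Gp m) (Kp m) (ResK' f) = f" if "f \<in> EG'" for f
    using extend_restrict that by (simp add: EG' ResK'_def)
  have M_eq: "M F = zero_extension (Gp m) (Kp m) (M' (ResK F))" for F
    by (simp add: M_def M'_def ResK_def mult_up_Ginf)
  have N_eq: "N f = zero_extension (Ginf m) (Kinf m) (N' (ResK' f))" if "f \<in> EG'" for f
    using mult_down_Ginf that by (simp add: N_def N'_def ResK'_def EG')
  show ?thesis
  proof (intro conjI ballI)
    show "ResK ` EG = EK" using ResK_in ResK_surj by blast
    show "bij_betw ResK' EG' EK'"
      by (rule bij_betw_byWitness[where f' = "zero_extension (Gp m) (Kp m)"])
        (use ext_rest rest_ext ResK'_in ext_in in auto)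
    show "bij_betw M' EK EK'"
      by (rule bij_betw_byWitness[where f' = N']) (use N'M' M'N' M'_in N'_in in auto)
    show "bij_betw N' EK' EK"
      by (rule bij_betw_byWitness[where f' = M']) (use N'M' M'N' M'_in N'_in in auto)
  next
    fix f g' assume "f \<in> EK'" "g' \<in> Kp m"
    then show "N' f (Phi m g') = f0VII m g' * f g'"
      using mult_down_Kp by (simp add: N'_def EK')
  next
    fix F assume F: "F \<in> EG"
    have MR: "M' (ResK F) \<in> EK'" using M'_in ResK_in F by blast
    show "M F \<in> EG'" unfolding M_eq by (rule ext_in[OF MR])
    show "ResK' (M F) = M' (ResK F)" unfolding M_eq by (rule rest_ext[OF MR])
  next
    fix f assume f: "f \<in> EG'"
    have NK: "N' (ResK' f) \<in> K1 (KinfG m)"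
      using N'_in[OF ResK'_in[OF f]] Ext_K1 by (simp add: EK_def)
    show "N f \<in> K1 (Ginf m)" unfolding N_eq[OF f] by (rule Kinf_K1_extend[OF NK])
    show "ResK (N f) = N' (ResK' f)"
      unfolding N_eq[OF f] ResK_def by (rule restrict_zero_extension_Kinf[OF NK])
    show "N f (Phi m g') = f0VII m g' * f g'" if "g' \<in> carrier (Gp m)" for g'
      using mult_down_Gp[OF _ that] f by (simp add: N_def EG')
  next
    fix f assume f: "f \<in> EG'"
    obtain F where F: "F \<in> EG" "ResK F = N' (ResK' f)"
      using ResK_surj[OF N'_in[OF ResK'_in[OF f]]] by blast
    have "M F = f" unfolding M_eq F(2) M'N'[OF ResK'_in[OF f]] by (rule ext_rest[OF f])
    then show "\<exists>F\<in>EG. M F = f \<and> ResK F = N' (ResK' f)" using F by blast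
  qed
qed

end
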